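(* Let $\mathbb{F}$ be the prime field of characteristic $p>3$, let $m=2r+1>1$ be an odd integer and $n=2t>1$ an even integer, let $\underline{t}=(t_1,\ldots,t_m)$ be an $m$-tuple of positive integers, and let $K=K(m,n;\underline{t})$ be the contact Lie superalgebra over $\mathbb{F}$. Then $$\mathrm{BDer}(K)=\mathrm{IBDer}(K),$$ that is, every skew-symmetric super-biderivation of $K$ is inner: it has the form $(x,y)\mapsto \lambda[x,y]$ for some $\lambda\in\mathbb{F}$.
   Context: Super-biderivations. Let $L=L_{\bar 0}\oplus L_{\bar 1}$ be a Lie superalgebra over $\mathbb{F}$, with parity $\mathrm{p}(\cdot)$. A bilinear map $\phi:L\times L\to L$ is homogeneous of $\mathbb{Z}_2$-degree $\gamma=\mathrm{p}(\phi)$ if $\phi(L_\alpha,L_\beta)\subset L_{\alpha+\beta+\gamma}$ for all $\alpha,\beta\in\mathbb{Z}_2$. A homogeneous bilinear map $\phi$ is a skew-symmetric super-biderivation if for all homogeneous $x,y,z\in L$: $\phi(x,y)=-(-1)^{\mathrm{p}(x)\mathrm{p}(y)}\phi(y,x)$; $\phi([x,y],z)=(-1)^{\mathrm{p}(\phi)\mathrm{p}(x)}[x,\phi(y,z)]+(-1)^{\mathrm{p}(y)\mathrm{p}(z)}[\phi(x,z),y]$; $\phi(x,[y,z])=[\phi(x,y),z]+(-1)^{(\mathrm{p}(\phi)+\mathrm{p}(x))\mathrm{p}(y)}[y,\phi(x,z)]$. $\mathrm{BDer}_\gamma(L)$ is the set of those of degree $\gamma$, and $\mathrm{BDer}(L)=\mathrm{BDer}_{\bar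 0}(L)\oplus\mathrm{BDer}_{\bar 1}(L)$ is the space of all skew-symmetric super-biderivations. For $\lambda\in\mathbb{F}$ the map $\phi_\lambda(x,y)=\lambda[x,y]$ is called an inner super-biderivation; $\mathrm{IBDer}(L)$ is the set of all $\phi_\lambda$, $\lambda\in\mathbb{F}$. The contact Lie superalgebra. Let $\mathrm{I}_0=\{1,\ldots,m\}$, $s=m+n$, $\mathrm{I}_1=\{m+1,\ldots,s\}$, $\mathrm{I}=\mathrm{I}_0\cup\mathrm{I}_1$, $\mathrm{J}=\mathrm{I}\setminus\{m\}$. Let $\mathcal{O}(m)$ be the divided power algebra with basis $x^{(\alpha)}$, $\alpha\in\mathbb{N}^m$ (with $0\in\mathbb{N}$), and product $x^{(\alpha)}x^{(\beta)}=\binom{\alpha+\beta}{\alpha}x^{(\alpha+\beta)}$, where $\binom{\alpha}{\beta}=\prod_i\binom{\alpha_i}{\beta_i}$; let $\Lambda(n)$ be the exterior superalgebra in $x_{m+1},\ldots,x_s$; let $\mathcal{O}(m,n)=\mathcal{O}(m)\otimes\Lambda(n)$, $\mathbb{Z}_2$-graded by $\mathcal{O}(m)$ even and the natural grading of $\Lambda(n)$. Let $\mathbb{B}$ be the set of strictly increasing tuples $u=\langle i_1<\cdots<i_k\rangle$ in $\mathrm{I}_1$ ($0\le k\le n$), and $x^u=x_{i_1}\cdots x_{i_k}$, $x^\emptyset=1$. For $i\in\mathrm{I}_0$ write $\varepsilon_i$ for the $i$-th unit tuple and $x_i=x^{(\varepsilon_i)}$. Put $\pi=(\pi_1,\ldots,\pi_m)$,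 $\pi_i=p^{t_i}-1$, and $\mathcal{O}(m,n;\underline{t})=\mathrm{span}_{\mathbb{F}}\{x^{(\alpha)}x^u: 0\le\alpha\le\pi,\ u\in\mathbb{B}\}$, a subalgebra of $\mathcal{O}(m,n)$. Let $\partial_1,\ldots,\partial_s$ be the superderivations of $\mathcal{O}(m,n)$ with, for $i\in\mathrm{I}_0$, $\partial_i(x^{(\alpha)})=x^{(\alpha-\varepsilon_i)}$ (zero if $\alpha_i=0$) and $\partial_i(x_k)=0$ for $k\in\mathrm{I}_1$; and for $i\in\mathrm{I}_1$, $\partial_i(x^{(\alpha)})=0$ and $\partial_i(x_k)=\delta_{ik}$ for $k\in\mathrm{I}_1$. Here $\partial_i$ is even for $i\in\mathrm{I}_0$ and odd for $i\in\mathrm{I}_1$. $W(m,n)=\{\sum_{r\in\mathrm{I}}f_r\partial_r: f_r\in\mathcal{O}(m,n)\}$ is a Lie superalgebra with $[f\partial_i,g\partial_j]=f\partial_i(g)\partial_j-(-1)^{\mathrm{p}(f\partial_i)\mathrm{p}(g\partial_j)}g\partial_j(f)\partial_i$. Set $i'=i+r$ for $1\le i\le r$, $i'=i-r$ for $r<i\le 2r$, $i'=i+t$ for $m<i\le m+t$, $i'=i-t$ for $m+t<i\le s$; and $\sigma(i)=1$ for $1\le i\le r$, $\sigma(i)=-1$ for $r<i\le 2r$, $\sigma(i)=1$ for $2r<i\le s$. Define the linear map $D_K:\mathcal{O}(m,n;\underline{t})\to W(m,n)$, on homogeneous $f$, by $$D_K(f)=\sum_{i\in\mathrm{J}}(-1)^{\mathrm{p}(\partial_i)\mathrm{p}(f)}\bigl(x_i\partial_m(f)+\sigma(i')\partial_{i'}(f)\bigr)\partial_i+\Bigl(2f-\sum_{i\in\mathrm{J}}x_i\partial_i(f)\Bigr)\partial_m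 .$$ Let $\widetilde{K}(m,n;\underline{t})$ be the image of $D_K$. The contact Lie superalgebra is the derived algebra $K(m,n;\underline{t})=[\widetilde{K}(m,n;\underline{t}),\widetilde{K}(m,n;\underline{t})]$. *)

theory Defs
  imports Complex_Main "HOL-Library.Poly_Mapping" "HOL-Library.FuncSet" "HOL-Computational_Algebra.Primes"
begin

section \<open>Skew-symmetric super-biderivations\<close>

text \<open>
  The data of a \<open>Z\<^sub>2\<close>-graded algebra over a field whose carrier is a subset of an additive group:
  carrier, homogeneous components (indexed by the residues 0 and 1), scalar multiplication and
  bracket.
\<close>

record ('a, 'v) superalg =
  carr :: "'v set"
  hcomp :: "nat \<Rightarrow> 'v set"
  scal :: "'a \<Rightarrow> 'v \<Rightarrow> 'v"
  brk :: "'v \<Rightarrow> 'v \<Rightarrow> 'v"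

definition sgn_scal :: "('a::ring_1, 'v) superalg \<Rightarrow> nat \<Rightarrow> 'v \<Rightarrow> 'v" where
  "sgn_scal L k x = scal L ((- 1) ^ k) x"

text \<open>
  Maps \<open>L \<times> L \<rightarrow> L\<close> are elements of the extensional function space, so that
  equality of such maps is equality on \<open>L \<times> L\<close>.
\<close>

definition bilinear_maps :: "('a, 'v::ab_group_add) superalg \<Rightarrow> ('v \<times> 'v \<Rightarrow> 'v) set" where
  "bilinear_maps L = {\<phi> \<in> carr L \<times> carr L \<rightarrow>\<^sub>E carr L.
     (\<forall>x\<in>carr L. \<forall>y\<in>carr L. \<forall>z\<in>carr L.
        \<phi> (x + y, z) = \<phi> (x, z) + \<phi> (y, z) \<and> \<phi> (x, y + z) = \<phi> (x, y) + \<phi> (x, z)) \<and>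
     (\<forall>c. \<forall>x\<in>carr L. \<forall>y\<in>carr L.
        \<phi> (scal L c x, y) = scal L c (\<phi> (x, y)) \<and> \<phi> (x, scal L c y) = scal L c (\<phi> (x, y)))}"

definition homogeneous_map :: "('a, 'v) superalg \<Rightarrow> nat \<Rightarrow> ('v \<times> 'v \<Rightarrow> 'v) \<Rightarrow> bool" where
  "homogeneous_map L \<gamma> \<phi> \<longleftrightarrow>
     (\<forall>\<alpha>\<in>{0, 1}. \<forall>\<beta>\<in>{0, 1}. \<forall>x\<in>hcomp L \<alpha>. \<forall>y\<in>hcomp L \<beta>.
        \<phi> (x, y) \<in> hcomp L ((\<alpha> + \<beta> + \<gamma>) mod 2))"

definition BDer_deg ::
    "nat \<Rightarrow> ('a::field, 'v::ab_group_add) superalg \<Rightarrow> ('v \<times> 'v \<Rightarrow> 'v) set" where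
  "BDer_deg \<gamma> L = {\<phi> \<in> bilinear_maps L. homogeneous_map L \<gamma> \<phi> \<and>
     (\<forall>\<alpha>\<in>{0, 1}. \<forall>\<beta>\<in>{0, 1}. \<forall>x\<in>hcomp L \<alpha>. \<forall>y\<in>hcomp L \<beta>.
        \<phi> (x, y) = - sgn_scal L (\<alpha> * \<beta>) (\<phi> (y, x))) \<and>
     (\<forall>\<alpha>\<in>{0, 1}. \<forall>\<beta>\<in>{0, 1}. \<forall>\<delta>\<in>{0, 1}.
        \<forall>x\<in>hcomp L \<alpha>. \<forall>y\<in>hcomp L \<beta>. \<forall>z\<in>hcomp L \<delta>.
        \<phi> (brk L x y, z) = sgn_scal L (\<gamma> * \<alpha>) (brk L x (\<phi> (y, z)))
                          + sgn_scal L (\<beta> * \<delta>) (brk L (\<phi> (x, z)) y) \<and>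
        \<phi> (x, brk L y z) = brk L (\<phi> (x, y)) z
                          + sgn_scal L ((\<gamma> + \<alpha>) * \<beta>) (brk L y (\<phi> (x, z))))}"

text \<open>
  The sum of the two homogeneous parts; it is direct whenever \<open>carr L\<close> is the direct sum of
  its homogeneous components.
\<close>

definition BDer :: "('a::field, 'v::ab_group_add) superalg \<Rightarrow> ('v \<times> 'v \<Rightarrow> 'v) set" where
  "BDer L = {restrict (\<lambda>z. \<phi>\<^sub>0 z + \<phi>\<^sub>1 z) (carr L \<times> carr L) | \<phi>\<^sub>0 \<phi>\<^sub>1.
     \<phi>\<^sub>0 \<in> BDer_deg 0 L \<and> \<phi>\<^sub>1 \<in> BDer_deg 1 L}"

definition inner_bider :: "('a, 'v) superalg \<Rightarrow> 'a \<Rightarrow> 'v \<times> 'v \<Rightarrow> 'v" where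
  "inner_bider L c = restrict (\<lambda>(x, y). scal L c (brk L x y)) (carr L \<times> carr L)"

definition IBDer :: "('a, 'v) superalg \<Rightarrow> ('v \<times> 'v \<Rightarrow> 'v) set" where
  "IBDer L = range (inner_bider L)"

section \<open>The superalgebra \<open>O(m,n)\<close>\<close>

text \<open>
  The pair \<open>(\<alpha>, u)\<close> encodes the basis element \<open>x\<^sup>(\<^sup>\<alpha>\<^sup>) x\<^sup>u\<close>, where the
  strictly increasing tuple \<open>u\<close> is given by the finite set of its entries. An element of
  \<open>O(m,n)\<close> is the finitely supported family of its coefficients. The type does not bound the
  indices of the variables; the restriction to \<open>{1..m}\<close> and \<open>{m+1..m+n}\<close> is made in
  the sets of elements below.
\<close>

type_synonym monom = "(nat \<Rightarrow>\<^sub>0 nat) \<times> nat set"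
type_synonym 'a osup = "monom \<Rightarrow>\<^sub>0 'a"

definition oscale :: "'a::field \<Rightarrow> 'a osup \<Rightarrow> 'a osup" where
  "oscale c f = Poly_Mapping.map (\<lambda>a. c * a) f"

global_interpretation osup: vector_space "oscale :: 'a::field \<Rightarrow> 'a osup \<Rightarrow> 'a osup"
proof -
  have *: "Poly_Mapping.lookup (oscale c f) a = c * Poly_Mapping.lookup f a"
    for c :: 'a and f a
    by (simp add: oscale_def Poly_Mapping.map.rep_eq when_def)
  show "vector_space (oscale :: 'a \<Rightarrow> 'a osup \<Rightarrow> 'a osup)"
    by unfold_locales (auto intro!: poly_mapping_eqI simp: * lookup_add algebra_simps)
qed

definition xmon :: "(nat \<Rightarrow>\<^sub>0 nat) \<Rightarrow> nat set \<Rightarrow> 'a::field osup" where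
  "xmon \<alpha> u = Poly_Mapping.single (\<alpha>, u) 1"

definition mbinom :: "(nat \<Rightarrow>\<^sub>0 nat) \<Rightarrow> (nat \<Rightarrow>\<^sub>0 nat) \<Rightarrow> nat" where
  "mbinom \<alpha> \<beta> = (\<Prod>i\<in>Poly_Mapping.keys \<alpha>.
     Poly_Mapping.lookup \<alpha> i choose Poly_Mapping.lookup \<beta> i)"

text \<open>
  Sorting the word \<open>x\<^sup>u x\<^sup>v\<close> with anticommuting letters costs one sign for each
  pair in \<open>u \<times> v\<close> that is in the wrong order; the word vanishes if a letter is repeated.
\<close>

definition mon_mult :: "monom \<Rightarrow> monom \<Rightarrow> 'a::field osup" where
  "mon_mult = (\<lambda>(\<alpha>, u) (\<beta>, v).
     if u \<inter> v \<noteq> {} then 0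
     else oscale ((- 1) ^ card {(i, j). i \<in> u \<and> j \<in> v \<and> j < i}
                  * of_nat (mbinom (\<alpha> + \<beta>) \<alpha>))
            (xmon (\<alpha> + \<beta>) (u \<union> v)))"

definition omult :: "'a::field osup \<Rightarrow> 'a osup \<Rightarrow> 'a osup" (infixl \<open>\<odot>\<close> 70) where
  "f \<odot> g = (\<Sum>a\<in>Poly_Mapping.keys f. \<Sum>b\<in>Poly_Mapping.keys g.
     oscale (Poly_Mapping.lookup f a * Poly_Mapping.lookup g b) (mon_mult a b))"

definition opart :: "nat \<Rightarrow> 'a::field osup set" where
  "opart \<gamma> = {f. \<forall>(\<alpha>, u)\<in>Poly_Mapping.keys f. card u mod 2 = \<gamma> mod 2}"

definition oproj :: "nat \<Rightarrow> 'a::field osup \<Rightarrow> 'a osup" where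
  "oproj \<gamma> f = (\<Sum>(\<alpha>, u)\<in>{a \<in> Poly_Mapping.keys f. card (snd a) mod 2 = \<gamma> mod 2}.
                    oscale (Poly_Mapping.lookup f (\<alpha>, u)) (xmon \<alpha> u))"

definition xvar :: "nat \<Rightarrow> nat \<Rightarrow> 'a::field osup" where
  "xvar m i = (if i \<le> m then xmon (Poly_Mapping.single i 1) {} else xmon 0 {i})"

definition dpar :: "nat \<Rightarrow> nat \<Rightarrow> nat" where
  "dpar m i = (if i \<le> m then 0 else 1)"

text \<open>
  For \<open>i > m\<close> the odd superderivation \<open>\<partial>\<^sub>i\<close> passes, with one sign each, the
  letters of \<open>x\<^sup>u\<close> to the left of \<open>x\<^sub>i\<close>.
\<close>

definition mon_osder :: "nat \<Rightarrow> nat \<Rightarrow> monom \<Rightarrow> 'a::field osup" where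
  "mon_osder m i = (\<lambda>(\<alpha>, u).
     if i \<le> m then (if Poly_Mapping.lookup \<alpha> i = 0 then 0 else xmon (\<alpha> - Poly_Mapping.single i 1) u)
     else (if i \<in> u then oscale ((- 1) ^ card {j \<in> u. j < i}) (xmon \<alpha> (u - {i})) else 0))"

definition osder :: "nat \<Rightarrow> nat \<Rightarrow> 'a::field osup \<Rightarrow> 'a osup" where
  "osder m i f = (\<Sum>a\<in>Poly_Mapping.keys f. oscale (Poly_Mapping.lookup f a) (mon_osder m i a))"

text \<open>
  The truncation heights are \<open>\<pi>\<^sub>i = p ^ \<tau> i - 1\<close>, where \<open>p\<close> is the
  characteristic of the field and \<open>\<tau> i\<close> is the \<open>i\<close>-th entry of the tuple
  \<open>t\<close>.
\<close>

definition trunc_O :: "nat \<Rightarrow> nat \<Rightarrow> (nat \<Rightarrow> nat) \<Rightarrow> 'a::field osup set" where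
  "trunc_O m n \<tau> = osup.span {xmon \<alpha> u | \<alpha> u.
     Poly_Mapping.keys \<alpha> \<subseteq> {1..m} \<and> (\<forall>i\<in>{1..m}. Poly_Mapping.lookup \<alpha> i \<le> CHAR('a) ^ \<tau> i - 1) \<and>
     u \<subseteq> {m+1..m+n}}"

section \<open>The Lie superalgebra \<open>W(m,n)\<close>\<close>

text \<open>
  A vector field \<open>\<Sum> f\<^sub>i \<partial>\<^sub>i\<close> is the family of its coefficients;
  \<open>Poly_Mapping.single i f\<close> is \<open>f \<partial>\<^sub>i\<close>.
\<close>

type_synonym 'a vfield = "nat \<Rightarrow>\<^sub>0 'a osup"

definition vscale :: "'a::field \<Rightarrow> 'a vfield \<Rightarrow> 'a vfield" where
  "vscale c D = Poly_Mapping.map (oscale c) D"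

global_interpretation vfield: vector_space "vscale :: 'a::field \<Rightarrow> 'a vfield \<Rightarrow> 'a vfield"
proof -
  have *: "Poly_Mapping.lookup (vscale c D) i = oscale c (Poly_Mapping.lookup D i)"
    for c :: 'a and D i
    by (simp add: vscale_def Poly_Mapping.map.rep_eq when_def)
  show "vector_space (vscale :: 'a \<Rightarrow> 'a vfield \<Rightarrow> 'a vfield)"
    by unfold_locales
      (auto intro!: poly_mapping_eqI
        simp: * lookup_add osup.scale_right_distrib osup.scale_left_distrib)
qed

definition vpart :: "nat \<Rightarrow> nat \<Rightarrow> 'a::field vfield set" where
  "vpart m \<gamma> = {D. \<forall>i\<in>Poly_Mapping.keys D. Poly_Mapping.lookup D i \<in> opart (\<gamma> + dpar m i)}"

text \<open>
  The bracket of \<open>f \<partial>\<^sub>i\<close> and \<open>g \<partial>\<^sub>j\<close> for \<open>f\<close>, \<open>g\<close> of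
  parities \<open>\<alpha>\<close>, \<open>\<beta>\<close>, and its bilinear extension.
\<close>

definition bracket_hom ::
    "nat \<Rightarrow> nat \<Rightarrow> 'a::field osup \<Rightarrow> nat \<Rightarrow> nat \<Rightarrow> 'a osup \<Rightarrow> nat \<Rightarrow> 'a vfield" where
  "bracket_hom m \<alpha> f i \<beta> g j =
     Poly_Mapping.single j (f \<odot> osder m i g)
     - vscale ((- 1) ^ ((\<alpha> + dpar m i) * (\<beta> + dpar m j)))
         (Poly_Mapping.single i (g \<odot> osder m j f))"

definition vbracket :: "nat \<Rightarrow> 'a::field vfield \<Rightarrow> 'a vfield \<Rightarrow> 'a vfield" where
  "vbracket m D E =
     (\<Sum>i\<in>Poly_Mapping.keys D. \<Sum>j\<in>Poly_Mapping.keys E. \<Sum>\<alpha>\<in>{0, 1}. \<Sum>\<beta>\<in>{0, 1}.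
        bracket_hom m \<alpha> (oproj \<alpha> (Poly_Mapping.lookup D i)) i \<beta> (oproj \<beta> (Poly_Mapping.lookup E j)) j)"

section \<open>The contact Lie superalgebra\<close>

text \<open>
  Here \<open>r = (m - 1) div 2\<close> and \<open>t = n div 2\<close>, that is, \<open>m = 2 r + 1\<close> and
  \<open>n = 2 t\<close> for odd \<open>m\<close> and even \<open>n\<close>. The index \<open>i = m\<close> has no conjugate;
  the value of \<open>conj_ix\<close> there is irrelevant.
\<close>

definition conj_ix :: "nat \<Rightarrow> nat \<Rightarrow> nat \<Rightarrow> nat" where
  "conj_ix m n i = (let r = (m - 1) div 2; t = n div 2 in
     if i \<le> r then i + r
     else if i \<le> 2 * r then i - r
     else if m < i \<and> i \<le> m + t then i + t
     else i - t)"

definition sig :: "nat \<Rightarrow> nat \<Rightarrow> 'a::field" where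
  "sig m i = (let r = (m - 1) div 2 in if r < i \<and> i \<le> 2 * r then - 1 else 1)"

definition DK_hom :: "nat \<Rightarrow> nat \<Rightarrow> nat \<Rightarrow> 'a::field osup \<Rightarrow> 'a vfield" where
  "DK_hom m n \<gamma> f =
     (\<Sum>i\<in>{1..m+n} - {m}. Poly_Mapping.single i
        (oscale ((- 1) ^ (dpar m i * \<gamma>))
          (xvar m i \<odot> osder m m f
           + oscale (sig m (conj_ix m n i)) (osder m (conj_ix m n i) f))))
     + Poly_Mapping.single m
         (oscale 2 f - (\<Sum>i\<in>{1..m+n} - {m}. xvar m i \<odot> osder m i f))"

definition DK :: "nat \<Rightarrow> nat \<Rightarrow> 'a::field osup \<Rightarrow> 'a vfield" where
  "DK m n f = DK_hom m n 0 (oproj 0 f) + DK_hom m n 1 (oproj 1 f)"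

definition K_tilde :: "nat \<Rightarrow> nat \<Rightarrow> (nat \<Rightarrow> nat) \<Rightarrow> 'a::field vfield set" where
  "K_tilde m n \<tau> = DK m n ` trunc_O m n \<tau>"

definition K_carrier :: "nat \<Rightarrow> nat \<Rightarrow> (nat \<Rightarrow> nat) \<Rightarrow> 'a::field vfield set" where
  "K_carrier m n \<tau> =
     vfield.span {vbracket m D E | D E. D \<in> K_tilde m n \<tau> \<and> E \<in> K_tilde m n \<tau>}"

definition K_contact :: "nat \<Rightarrow> nat \<Rightarrow> (nat \<Rightarrow> nat) \<Rightarrow> ('a::field, 'a vfield) superalg" where
  "K_contact m n \<tau> =
     \<lparr>carr = K_carrier m n \<tau>, hcomp = (\<lambda>\<gamma>. K_carrier m n \<tau> \<inter> vpart m \<gamma>),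
      scal = vscale, brk = vbracket m\<rparr>"

end

(*
  Put e = D_K(1). Expanding phi([e, x], [y, v]) by the derivation rule in either argument shows that
  the defect
  [phi(x, y), [e, v]] + (-1)^(|v| (|x| + |y|)) [phi(e, v), [x, y]] is invariant (up to sign) under
  exchanging y and v; being skew in x and y as well, it vanishes. The elements of K with generating
  functions 1, x_j and x_m have trivial common centralizer and are, up to scalars, of the form [e, v]
  with v generated by x_m, x_j x_m, x_m^2 / 2. Hence phi is determined by phi(e, v) for these v, and
  comparing weights with respect to D_K(x_m), which is possible as p > 3, gives phi(e, v) = c [e, v].

  That inner maps are super-biderivations requires K to be a Lie superalgebra: W(m, n) is one because
  its bracket is the supercommutator of superderivations, and the fields D_K(f) are closed under it
  because they are characterised by preserving the contact form theta up to a factor.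
*)
theory Submission
  imports Defs
begin

text \<open>The field D_K(x_m) supplies the weights: with degree 1 for x_j and degree 2 for x_m, a
  generating function of degree d has weight d - 2. So the elements e, x_j, h, v_j, w generated by
  1, x_j, x_m, x_j x_m, x_m^2 / 2 have weights -2, -1, 0, 1, 2. Whatever commutes with e and all x_j
  is a multiple of e and has weight -2. The constant c is read off from phi(e, h), which lies on the
  line of e. For v_j and w the difference of phi(e, -) and c [e, -] commutes with e and all x_j but
  has weight 1 or 2; 1 = -2 or 2 = -2 would force p = 3 or p = 2.

  K is a derived algebra whose basis is never determined. It is enough that K contains these
  elements and lies inside the image of D_K, where generating functions are available.

  For the Lie structure the obstacle is the signs. Monomials are counted letter by letter only up to
  the Leibniz rule and the commutation of derivatives; from there on all sign calculations use
  parities alone.\<close>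

section \<open>Coefficients and linear extension from monomials\<close>

abbreviation (input) coef :: "('k \<Rightarrow>\<^sub>0 'b::zero) \<Rightarrow> 'k \<Rightarrow> 'b" where
  "coef \<equiv> Poly_Mapping.lookup"

abbreviation (input) supp :: "('k \<Rightarrow>\<^sub>0 'b::zero) \<Rightarrow> 'k set" where
  "supp \<equiv> Poly_Mapping.keys"

abbreviation (input) unit_mon :: "monom \<Rightarrow> 'a::field osup" where
  "unit_mon a \<equiv> Poly_Mapping.single a 1"

lemma coef_sum [simp]: "coef (\<Sum>i\<in>A. f i) k = (\<Sum>i\<in>A. coef (f i) k)"
  by (induction A rule: infinite_finite_induct) (simp_all add: lookup_add)

lemma coef_oscale [simp]: "coef (oscale c f) a = c * coef f a"
  by (simp add: oscale_def Poly_Mapping.map.rep_eq when_def)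

lemma coef_vscale [simp]: "coef (vscale c D) i = oscale c (coef D i)"
  by (simp add: vscale_def Poly_Mapping.map.rep_eq when_def)

lemma oscale_single [simp]: "oscale c (Poly_Mapping.single a b) = Poly_Mapping.single a (c * b)"
  by (rule poly_mapping_eqI) (simp add: lookup_single when_def)

lemma vscale_single [simp]: "vscale c (Poly_Mapping.single i f) = Poly_Mapping.single i (oscale c f)"
  by (rule poly_mapping_eqI) (simp add: lookup_single when_def)

lemma supp_oscale: "supp (oscale c f) \<subseteq> supp f"
  by (auto simp: in_keys_iff)

text \<open>The linear extension of a map given on monomials. Derivatives and, in each argument, the
  product are of this form, so their linearity is proved once.\<close>

definition olin :: "(monom \<Rightarrow> 'a::field osup) \<Rightarrow> 'a osup \<Rightarrow> 'a osup" where
  "olin M f = (\<Sum>a\<in>supp f. oscale (coef f a) (M a))"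

text \<open>Enlarging the index set adds only zero terms. With one common finite set for several
  elements, linearity becomes a termwise statement.\<close>

lemma olin_superset:
  assumes "finite A" "supp f \<subseteq> A"
  shows "olin M f = (\<Sum>a\<in>A. oscale (coef f a) (M a))"
  unfolding olin_def using assms
  by (intro sum.mono_neutral_left) (auto simp: in_keys_iff)

lemma olin_add: "olin M (f + g) = olin M f + olin M g"
proof -
  let ?A = "supp f \<union> supp g"
  have *: "supp (f + g) \<subseteq> ?A" by (rule Poly_Mapping.keys_add)
  show ?thesis
    by (simp add: olin_superset[OF _ *] olin_superset[of ?A f] olin_superset[of ?A g]
        lookup_add osup.scale_left_distrib sum.distrib)
qed

lemma olin_oscale: "olin M (oscale c f) = oscale c (olin M f)"
  by (subst olin_superset[of "supp f"]) (simp_all add: supp_oscale olin_def osup.scale_sum_right)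

lemma linear_olin: "Vector_Spaces.linear oscale oscale (olin M)"
  by unfold_locales (simp_all add: olin_add olin_oscale)

lemma olin_zero [simp]: "olin M 0 = 0"
  by (simp add: olin_def)

lemma olin_single [simp]: "olin M (Poly_Mapping.single a c) = oscale c (M a)"
  by (simp add: olin_superset[of "{a}"])

lemma supp_olin: "supp (olin M f) \<subseteq> (\<Union>a\<in>supp f. supp (M a))"
proof -
  have "supp (olin M f) \<subseteq> (\<Union>a\<in>supp f. supp (oscale (coef f a) (M a)))"
    unfolding olin_def by (rule Poly_Mapping.keys_sum)
  then show ?thesis using supp_oscale by blast
qed

lemma osup_decomp: "f = (\<Sum>a\<in>supp f. oscale (coef f a) (unit_mon a))"
  by (rule poly_mapping_eqI) (auto simp: lookup_single when_def in_keys_iff if_distrib cong: if_cong)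

text \<open>Reduces identities to monomials. The hypothesis speaks only of the support of
  \<open>f\<close> because the sign rules below hold only for finite sets of odd letters, often of a
  given parity.\<close>

lemma linear_eq_on_supp:
  assumes "Vector_Spaces.linear oscale oscale F" "Vector_Spaces.linear oscale oscale G"
    and "\<And>a. a \<in> supp f \<Longrightarrow> F (unit_mon a) = G (unit_mon a)"
  shows "F f = G f"
proof -
  interpret F: Vector_Spaces.linear oscale oscale F by fact
  interpret G: Vector_Spaces.linear oscale oscale G by fact
  show ?thesis
    \<comment> \<open>\<open>oscale_single\<close> would absorb the coefficients into the monomials,
      and the scaling rules for \<open>F\<close> and \<open>G\<close> would no longer apply.\<close>
    by (subst (1 2) osup_decomp[of f]) (simp add: F.sum G.sum F.scale G.scale assms(3) del: oscale_single)
qed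

lemma linear_id: "Vector_Spaces.linear oscale oscale (\<lambda>f. f)"
  by unfold_locales simp_all

lemma linear_comp:
  assumes "Vector_Spaces.linear oscale oscale F" "Vector_Spaces.linear oscale oscale G"
  shows "Vector_Spaces.linear oscale oscale (\<lambda>f. F (G f))"
proof -
  interpret F: Vector_Spaces.linear oscale oscale F by fact
  interpret G: Vector_Spaces.linear oscale oscale G by fact
  show ?thesis by unfold_locales (simp_all add: F.add G.add F.scale G.scale)
qed

lemma linear_plus:
  assumes "Vector_Spaces.linear oscale oscale F" "Vector_Spaces.linear oscale oscale G"
  shows "Vector_Spaces.linear oscale oscale (\<lambda>f. F f + G f)"
proof -
  interpret F: Vector_Spaces.linear oscale oscale F by fact
  interpret G: Vector_Spaces.linear oscale oscale G by fact
  show ?thesis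
    by unfold_locales (simp_all add: F.add G.add F.scale G.scale osup.scale_right_distrib)
qed

lemma linear_oscale: "Vector_Spaces.linear oscale oscale (oscale c)"
  by unfold_locales (simp_all add: osup.scale_right_distrib mult.commute)

lemma osder_olin: "osder m i = olin (mon_osder m i)"
  by (rule ext) (simp add: osder_def olin_def)

lemma omult_olin: "f \<odot> g = olin (\<lambda>a. olin (mon_mult a) g) f"
  by (simp add: omult_def olin_def osup.scale_sum_right)

lemma linear_osder: "Vector_Spaces.linear oscale oscale (osder m i)"
  unfolding osder_olin by (rule linear_olin)

lemma linear_omult_left: "Vector_Spaces.linear oscale oscale (\<lambda>f. f \<odot> g)"
  unfolding omult_olin by (rule linear_olin)

lemma linear_omult_right: "Vector_Spaces.linear oscale oscale (\<lambda>g. f \<odot> g)"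
  by unfold_locales
    (simp_all add: omult_olin olin_add olin_oscale olin_def[of _ f] osup.scale_right_distrib
      sum.distrib osup.scale_sum_right mult.commute)

global_interpretation osder: Vector_Spaces.linear oscale oscale "osder m i"
  by (rule linear_osder)

global_interpretation omult_left: Vector_Spaces.linear oscale oscale "\<lambda>f. f \<odot> g"
  by (rule linear_omult_left)

global_interpretation omult_right: Vector_Spaces.linear oscale oscale "\<lambda>g. f \<odot> g"
  by (rule linear_omult_right)

lemmas olinear_simps = osder.add osder.diff osder.neg osder.scale osder.sum
  omult_left.add omult_left.diff omult_left.neg omult_left.scale omult_left.sum
  omult_right.add omult_right.diff omult_right.neg omult_right.scale omult_right.sum

declare osder.zero [simp] omult_left.zero [simp] omult_right.zero [simp]

lemma omult_unit_mon: "unit_mon a \<odot> unit_mon b = mon_mult a b"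
  by (simp add: omult_olin)

lemma osder_unit_mon: "osder m i (unit_mon a) = mon_osder m i a"
  by (simp add: osder_olin)

subsection \<open>Signs and binomial coefficients\<close>

text \<open>The exponent of the sign in \<open>mon_mult\<close>; for a singleton \<open>u\<close> it
  is also the exponent of the sign in \<open>mon_osder\<close>, so that both can be
  compared.\<close>

definition inversions :: "nat set \<Rightarrow> nat set \<Rightarrow> nat" where
  "inversions u v = card {(i, j). i \<in> u \<and> j \<in> v \<and> j < i}"

lemma finite_inv_pairs:
  "finite u \<Longrightarrow> finite v \<Longrightarrow> finite {(i, j). i \<in> u \<and> j \<in> v \<and> j < (i::nat)}"
  by (rule finite_subset[of _ "u \<times> v"]) auto

lemma inversions_Un_left:
  assumes "finite u" "finite v" "finite w" "u \<inter> v = {}"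
  shows "inversions (u \<union> v) w = inversions u w + inversions v w"
proof -
  have "{(i, j). i \<in> u \<union> v \<and> j \<in> w \<and> j < i} =
    {(i, j). i \<in> u \<and> j \<in> w \<and> j < i} \<union> {(i, j). i \<in> v \<and> j \<in> w \<and> j < i}"
    by auto
  then show ?thesis unfolding inversions_def
    using assms by (simp add: card_Un_disjoint finite_inv_pairs disjoint_iff)
qed

lemma inversions_Un_right:
  assumes "finite u" "finite v" "finite w" "v \<inter> w = {}"
  shows "inversions u (v \<union> w) = inversions u v + inversions u w"
proof -
  have "{(i, j). i \<in> u \<and> j \<in> v \<union> w \<and> j < i} =
    {(i, j). i \<in> u \<and> j \<in> v \<and> j < i} \<union> {(i, j). i \<in> u \<and> j \<in> w \<and> j < i}"
    by auto
  then show ?thesis unfolding inversions_def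
    using assms by (simp add: card_Un_disjoint finite_inv_pairs disjoint_iff)
qed

text \<open>Each pair in \<open>u \<times> v\<close> is in the wrong order in exactly one of the two
  words x^u x^v and x^v x^u. This is the source of the sign (-1)^(a b) in
  \<open>omult_commute\<close>.\<close>

lemma inversions_swap:
  assumes "finite u" "finite v" "u \<inter> v = {}"
  shows "inversions u v + inversions v u = card u * card v"
proof -
  let ?A = "{(i, j). i \<in> u \<and> j \<in> v \<and> j < i}"
  let ?B = "{(i, j). i \<in> v \<and> j \<in> u \<and> j < i}"
  have "u \<times> v = ?A \<union> prod.swap ` ?B"
    using assms(3) by (force simp: image_iff)
  moreover have "?A \<inter> prod.swap ` ?B = {}" by auto
  moreover have "card (prod.swap ` ?B) = card ?B"
    by (rule card_image) simp
  ultimately show ?thesis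
    using assms by (simp add: card_cartesian_product[symmetric] card_Un_disjoint finite_inv_pairs
        inversions_def)
qed

lemma inversions_singleton_left: "inversions {i} v = card {j \<in> v. j < i}"
proof -
  have "{(k, j). k \<in> {i} \<and> j \<in> v \<and> j < k} = Pair i ` {j \<in> v. j < i}" by auto
  then show ?thesis by (simp add: inversions_def card_image inj_on_def)
qed

lemma inversions_empty [simp]: "inversions {} v = 0" "inversions v {} = 0"
  by (simp_all add: inversions_def)

text \<open>Outside the support of \<alpha> the extra factors are 0 choose 0, because \<beta>
  vanishes there as well.\<close>

lemma mbinom_superset:
  assumes "finite A" "supp \<alpha> \<subseteq> A" "supp \<beta> \<subseteq> supp \<alpha>"
  shows "mbinom \<alpha> \<beta> = (\<Prod>i\<in>A. coef \<alpha> i choose coef \<beta> i)"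
  unfolding mbinom_def
proof (rule prod.mono_neutral_left)
  show "\<forall>i\<in>A - supp \<alpha>. coef \<alpha> i choose coef \<beta> i = 1"
    using assms(3) by (auto simp: in_keys_iff subset_iff) (metis binomial_n_0 not_gr_zero One_nat_def)
qed (use assms in auto)

lemma supp_add_nat: "supp (\<alpha> + \<beta> :: nat \<Rightarrow>\<^sub>0 nat) = supp \<alpha> \<union> supp \<beta>"
  by (auto simp: in_keys_iff lookup_add)

text \<open>Both sides are the trinomial coefficient (a + b + c)! / (a! b! c!).\<close>

lemma choose_assoc:
  "(a + b choose a) * (a + b + c choose (a + b)) = (b + c choose b) * (a + b + c choose a)"
proof -
  have 1: "(a + b choose a) * (fact a * fact b) = (fact (a + b) :: nat)"
    using binomial_fact_lemma[of a "a + b"] by (simp add: ac_simps)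
  have 2: "(a + b + c choose (a + b)) * (fact (a + b) * fact c) = (fact (a + b + c) :: nat)"
    using binomial_fact_lemma[of "a + b" "a + b + c"] by (simp add: ac_simps)
  have 3: "(b + c choose b) * (fact b * fact c) = (fact (b + c) :: nat)"
    using binomial_fact_lemma[of b "b + c"] by (simp add: ac_simps)
  have 4: "(a + b + c choose a) * (fact a * fact (b + c)) = (fact (a + b + c) :: nat)"
    using binomial_fact_lemma[of a "a + b + c"] by (simp add: ac_simps)
  have "((a + b choose a) * (a + b + c choose (a + b))) * (fact a * fact b * fact c)
      = (fact (a + b + c) :: nat)"
    unfolding 2[symmetric] 1[symmetric] by (simp only: ac_simps)
  also have "\<dots> = ((b + c choose b) * (a + b + c choose a)) * (fact a * fact b * fact c)"
    unfolding 4[symmetric] 3[symmetric] by (simp only: ac_simps)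
  finally show ?thesis by simp
qed

lemma mbinom_assoc:
  "mbinom (\<alpha> + \<beta>) \<alpha> * mbinom (\<alpha> + \<beta> + \<gamma>) (\<alpha> + \<beta>) = mbinom (\<beta> + \<gamma>) \<beta> * mbinom (\<alpha> + \<beta> + \<gamma>) \<alpha>"
  by (simp add: mbinom_superset[of "supp \<alpha> \<union> supp \<beta> \<union> supp \<gamma>"] supp_add_nat lookup_add
      prod.distrib[symmetric] choose_assoc Un_assoc le_supI1 le_supI2)

lemma mbinom_commute: "mbinom (\<alpha> + \<beta>) \<alpha> = mbinom (\<beta> + \<alpha>) \<beta>"
proof -
  have "(a + b choose a) = (b + a choose b)" for a b :: nat
    using binomial_symmetric[of a "a + b"] by (simp add: add.commute)
  then show ?thesis
    by (simp add: mbinom_superset[of "supp \<alpha> \<union> supp \<beta>"] supp_add_nat lookup_add Un_commute le_supI1 le_supI2)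
qed

subsection \<open>Multiplication\<close>

text \<open>The type of monomials admits infinite sets of odd letters. There \<open>card\<close> is
  0, and the additivity of \<open>inversions\<close> breaks down, so the algebra laws are stated on
  this subspace.\<close>

definition fin_osup :: "'a::field osup set" where
  "fin_osup = {f. \<forall>a\<in>supp f. finite (snd a)}"

lemma mon_mult_eq:
  "mon_mult (\<alpha>, u) (\<beta>, v) = (if u \<inter> v = {} then
     Poly_Mapping.single (\<alpha> + \<beta>, u \<union> v)
       ((- 1) ^ inversions u v * of_nat (mbinom (\<alpha> + \<beta>) \<alpha>)) else 0)"
  by (simp add: mon_mult_def inversions_def xmon_def)

lemma omult_single:
  "Poly_Mapping.single a c \<odot> Poly_Mapping.single b d = oscale (c * d) (mon_mult a b)"
  by (simp add: omult_olin olin_oscale)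

text \<open>Signs and binomial factors agree separately: the signs by additivity of
  \<open>inversions\<close>, the factors by \<open>mbinom_assoc\<close>. If two of the three sets
  meet, both sides vanish.\<close>

lemma omult_assoc_mon:
  assumes "finite u" "finite v" "finite w"
  shows "(unit_mon (\<alpha>, u) \<odot> unit_mon (\<beta>, v)) \<odot> unit_mon (\<gamma>, w) =
    unit_mon (\<alpha>, u) \<odot> (unit_mon (\<beta>, v) \<odot> unit_mon (\<gamma>, w) :: 'a::field osup)"
proof (cases "u \<inter> v = {} \<and> u \<inter> w = {} \<and> v \<inter> w = {}")
  case True
  have b: "of_nat (mbinom (\<alpha> + \<beta>) \<alpha>) * of_nat (mbinom (\<alpha> + \<beta> + \<gamma>) (\<alpha> + \<beta>)) =
     (of_nat (mbinom (\<beta> + \<gamma>) \<beta>) * of_nat (mbinom (\<alpha> + \<beta> + \<gamma>) \<alpha>) :: 'a)"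
    by (metis mbinom_assoc of_nat_mult)
  have i: "inversions u v + inversions (u \<union> v) w = inversions v w + inversions u (v \<union> w)"
    using True assms by (simp add: inversions_Un_left inversions_Un_right)
  have "((- 1) ^ inversions u v * of_nat (mbinom (\<alpha> + \<beta>) \<alpha>)) *
      ((- 1) ^ inversions (u \<union> v) w * of_nat (mbinom (\<alpha> + \<beta> + \<gamma>) (\<alpha> + \<beta>))) =
      (- 1) ^ (inversions u v + inversions (u \<union> v) w) *
      (of_nat (mbinom (\<alpha> + \<beta>) \<alpha>) * of_nat (mbinom (\<alpha> + \<beta> + \<gamma>) (\<alpha> + \<beta>)) :: 'a)"
    by (simp add: power_add)
  also have "\<dots> = ((- 1) ^ inversions v w * of_nat (mbinom (\<beta> + \<gamma>) \<beta>)) *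
      ((- 1) ^ inversions u (v \<union> w) * of_nat (mbinom (\<alpha> + \<beta> + \<gamma>) \<alpha>))"
    unfolding b i by (simp add: power_add)
  finally have "((- 1) ^ inversions u v * of_nat (mbinom (\<alpha> + \<beta>) \<alpha>)) *
      ((- 1) ^ inversions (u \<union> v) w * of_nat (mbinom (\<alpha> + \<beta> + \<gamma>) (\<alpha> + \<beta>)) :: 'a) =
      ((- 1) ^ inversions v w * of_nat (mbinom (\<beta> + \<gamma>) \<beta>)) *
      ((- 1) ^ inversions u (v \<union> w) * of_nat (mbinom (\<alpha> + \<beta> + \<gamma>) \<alpha>))" .
  with True show ?thesis
    by (simp add: omult_single mon_mult_eq Int_Un_distrib Int_Un_distrib2 Un_assoc add.assoc)
next
  case False
  then show ?thesis
    by (auto simp: omult_single mon_mult_eq Int_Un_distrib Int_Un_distrib2)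
qed

lemma omult_assoc:
  fixes f g h :: "'a::field osup"
  assumes "f \<in> fin_osup" "g \<in> fin_osup" "h \<in> fin_osup"
  shows "f \<odot> g \<odot> h = f \<odot> (g \<odot> h)"
proof -
  have 1: "unit_mon a \<odot> unit_mon b \<odot> h = unit_mon a \<odot> (unit_mon b \<odot> h)"
    if "finite (snd a)" "finite (snd b)" for a b
  proof (rule linear_eq_on_supp[of "\<lambda>h. unit_mon a \<odot> unit_mon b \<odot> h" "\<lambda>h. unit_mon a \<odot> (unit_mon b \<odot> h)" h])
    show "unit_mon a \<odot> unit_mon b \<odot> unit_mon c = unit_mon a \<odot> (unit_mon b \<odot> unit_mon c :: 'a osup)"
      if "c \<in> supp h" for c
    proof -
      have "finite (snd c)" using that assms(3) by (simp add: fin_osup_def)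
      then show ?thesis
        using \<open>finite (snd a)\<close> \<open>finite (snd b)\<close>
          omult_assoc_mon[of "snd a" "snd b" "snd c" "fst a" "fst b" "fst c"] by simp
    qed
  qed (rule linear_omult_right linear_comp[OF linear_omult_right[of "unit_mon a"] linear_omult_right[of "unit_mon b"]])+
  have 2: "unit_mon a \<odot> g \<odot> h = unit_mon a \<odot> (g \<odot> h)" if "finite (snd a)" for a
  proof (rule linear_eq_on_supp[of "\<lambda>g. unit_mon a \<odot> g \<odot> h" "\<lambda>g. unit_mon a \<odot> (g \<odot> h)" g])
    show "unit_mon a \<odot> unit_mon b \<odot> h = unit_mon a \<odot> (unit_mon b \<odot> h)" if "b \<in> supp g" for b
      using that \<open>finite (snd a)\<close> assms(2) by (intro 1) (auto simp: fin_osup_def)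
  qed (rule linear_comp[OF linear_omult_left[of h] linear_omult_right[of "unit_mon a"]]
      linear_comp[OF linear_omult_right[of "unit_mon a"] linear_omult_left[of h]])+
  show ?thesis
  proof (rule linear_eq_on_supp[of "\<lambda>f. f \<odot> g \<odot> h" "\<lambda>f. f \<odot> (g \<odot> h)" f])
    show "unit_mon a \<odot> g \<odot> h = unit_mon a \<odot> (g \<odot> h)" if "a \<in> supp f" for a
      using that assms(1) by (intro 2) (auto simp: fin_osup_def)
  qed (rule linear_comp[OF linear_omult_left[of h] linear_omult_left[of g]] linear_omult_left)+
qed

lemma opart_iff: "f \<in> opart a \<longleftrightarrow> (\<forall>(\<alpha>, u)\<in>supp f. even (card u) = even a)"
  by (auto simp: opart_def mod2_eq_if split: if_splits)

lemma opart_cong: "even a = even b \<Longrightarrow> opart a = opart b"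
  by (auto simp: opart_iff)

lemma minus_one_power_cong: "even k = even l \<Longrightarrow> (- 1) ^ k = ((- 1) ^ l :: 'a::ring_1)"
  by (simp add: minus_one_power_iff)

lemma omult_commute:
  fixes f g :: "'a::field osup"
  assumes "f \<in> opart a" "g \<in> opart b" "f \<in> fin_osup" "g \<in> fin_osup"
  shows "g \<odot> f = oscale ((- 1) ^ (a * b)) (f \<odot> g)"
proof -
  have 1: "unit_mon (\<beta>, v) \<odot> unit_mon (\<alpha>, u) =
      oscale ((- 1) ^ (a * b)) (unit_mon (\<alpha>, u) \<odot> unit_mon (\<beta>, v) :: 'a osup)"
    if "(\<alpha>, u) \<in> supp f" "(\<beta>, v) \<in> supp g" for \<alpha> u \<beta> v
  proof (cases "u \<inter> v = {}")
    case True
    have fin: "finite u" "finite v" using that assms(3,4) by (auto simp: fin_osup_def)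
    have "even (inversions v u) = even (a * b + inversions u v)"
    proof -
      have "even (card u) = even a" "even (card v) = even b"
        using that assms(1,2) by (auto simp: opart_iff)
      moreover have "even (inversions u v + inversions v u) = even (card u * card v)"
        by (simp only: inversions_swap[OF fin True])
      ultimately show ?thesis by auto
    qed
    then have "(- 1) ^ inversions v u = ((- 1) ^ (a * b) * (- 1) ^ inversions u v :: 'a)"
      by (metis minus_one_power_cong power_add)
    with True show ?thesis
      by (simp add: omult_single mon_mult_eq Un_commute Int_commute add.commute[of \<beta> \<alpha>]
          mbinom_commute[of \<beta> \<alpha>, unfolded add.commute[of \<beta> \<alpha>]] mult.assoc)
  qed (auto simp: omult_single mon_mult_eq)
  have 2: "g \<odot> unit_mon c = oscale ((- 1) ^ (a * b)) (unit_mon c \<odot> g)" if "c \<in> supp f" for c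
  proof (rule linear_eq_on_supp[of "\<lambda>g. g \<odot> unit_mon c" "\<lambda>g. oscale ((- 1) ^ (a * b)) (unit_mon c \<odot> g)" g])
    show "unit_mon d \<odot> unit_mon c = oscale ((- 1) ^ (a * b)) (unit_mon c \<odot> unit_mon d :: 'a osup)"
      if "d \<in> supp g" for d
      using 1[of "fst c" "snd c" "fst d" "snd d"] that \<open>c \<in> supp f\<close> by simp
  qed (rule linear_comp[OF linear_oscale linear_omult_right[of "unit_mon c"]] linear_omult_left)+
  show ?thesis
    by (rule linear_eq_on_supp[of "\<lambda>f. g \<odot> f" "\<lambda>f. oscale ((- 1) ^ (a * b)) (f \<odot> g)" f, OF _ _ 2])
      (rule linear_comp[OF linear_oscale linear_omult_left[of g]] linear_omult_right)+
qed

lemma oone_omult [simp]: "xmon 0 {} \<odot> f = f"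
proof -
  have "mon_mult (0, {}) a = unit_mon a" for a
    by (cases a) (simp add: mon_mult_eq mbinom_def)
  then show ?thesis
    by (intro linear_eq_on_supp[of "\<lambda>f. xmon 0 {} \<odot> f" "\<lambda>f. f" f] linear_omult_right linear_id)
      (simp add: xmon_def omult_unit_mon)
qed

lemma omult_oone [simp]: "f \<odot> xmon 0 {} = f"
proof -
  have "mon_mult a (0, {}) = unit_mon a" for a
    by (cases a) (simp add: mon_mult_eq mbinom_def)
  then show ?thesis
    by (intro linear_eq_on_supp[of "\<lambda>f. f \<odot> xmon 0 {}" "\<lambda>f. f" f] linear_omult_left linear_id)
      (simp add: xmon_def omult_unit_mon)
qed

subsection \<open>Closure properties and the grading\<close>

text \<open>The subspaces \<open>fin_osup\<close>, \<open>opart\<close> and \<open>trunc_O\<close>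
  are all cut out by a condition on the monomials that may occur, so this one fact covers
  them.\<close>

lemma subspace_supp: "osup.subspace {f :: 'a::field osup. supp f \<subseteq> S}"
proof -
  have "supp (f + g) \<subseteq> S" if "supp f \<subseteq> S" "supp g \<subseteq> S" for f g :: "'a osup"
    using that Poly_Mapping.keys_add[of f g] by blast
  moreover have "supp (oscale c f) \<subseteq> S" if "supp f \<subseteq> S" for c and f :: "'a osup"
    using that supp_oscale[of c f] by blast
  ultimately show ?thesis by (simp add: osup.subspace_def)
qed

lemma span_unit_mon: "osup.span (unit_mon ` S) = {f :: 'a::field osup. supp f \<subseteq> S}"
proof (rule antisym)
  show "osup.span (unit_mon ` S) \<subseteq> {f :: 'a osup. supp f \<subseteq> S}"
    by (intro osup.span_minimal subspace_supp) auto
  show "{f :: 'a osup. supp f \<subseteq> S} \<subseteq> osup.span (unit_mon ` S)"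
  proof clarify
    fix f :: "'a osup" assume "supp f \<subseteq> S"
    then have "(\<Sum>a\<in>supp f. oscale (coef f a) (unit_mon a)) \<in> osup.span (unit_mon ` S)"
      by (intro osup.span_sum osup.span_scale osup.span_base) auto
    then show "f \<in> osup.span (unit_mon ` S)" using osup_decomp[of f] by simp
  qed
qed

lemma fin_osup_supp: "fin_osup = {f. supp f \<subseteq> {a. finite (snd a)}}"
  by (auto simp: fin_osup_def)

lemma opart_supp: "opart a = {f. supp f \<subseteq> {b. even (card (snd b)) = even a}}"
  by (fastforce simp: opart_iff)

lemma subspace_fin_osup: "osup.subspace fin_osup"
  unfolding fin_osup_supp by (rule subspace_supp)

lemma subspace_opart: "osup.subspace (opart a)"
  unfolding opart_supp by (rule subspace_supp)

lemmas fin_osup_lin [simp] =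
  osup.subspace_0[OF subspace_fin_osup] osup.subspace_add[OF subspace_fin_osup]
  osup.subspace_diff[OF subspace_fin_osup] osup.subspace_neg[OF subspace_fin_osup]
  osup.subspace_scale[OF subspace_fin_osup] osup.subspace_sum[OF subspace_fin_osup]

lemmas opart_lin =
  osup.subspace_0[OF subspace_opart] osup.subspace_add[OF subspace_opart]
  osup.subspace_diff[OF subspace_opart] osup.subspace_neg[OF subspace_opart]
  osup.subspace_scale[OF subspace_opart] osup.subspace_sum[OF subspace_opart]

lemma mon_osder_eq:
  "mon_osder m i (\<alpha>, u) =
    (if i \<le> m then if coef \<alpha> i = 0 then 0 else unit_mon (\<alpha> - Poly_Mapping.single i 1, u)
     else if i \<in> u then Poly_Mapping.single (\<alpha>, u - {i}) ((- 1) ^ inversions {i} (u - {i})) else 0)"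
proof -
  have "{j \<in> u - {i}. j < i} = {j \<in> u. j < i}" by auto
  then show ?thesis by (simp add: mon_osder_def xmon_def inversions_singleton_left)
qed

lemma supp_olinE:
  assumes "b \<in> supp (olin M f)"
  obtains a where "a \<in> supp f" "b \<in> supp (M a)"
  using assms supp_olin by blast

lemma fin_osup_osder [simp]: "f \<in> fin_osup \<Longrightarrow> osder m i f \<in> fin_osup"
  by (fastforce simp: fin_osup_def osder_olin mon_osder_eq elim!: supp_olinE split: if_splits)

lemma fin_osup_omult [simp]: "f \<in> fin_osup \<Longrightarrow> g \<in> fin_osup \<Longrightarrow> f \<odot> g \<in> fin_osup"
  by (fastforce simp: fin_osup_def omult_olin mon_mult_eq elim!: supp_olinE split: if_splits)

lemma fin_osup_oone [simp]: "xmon 0 {} \<in> fin_osup"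
  by (simp add: fin_osup_def xmon_def)

lemma fin_osup_xvar [simp]: "xvar m i \<in> fin_osup"
  by (simp add: fin_osup_def xvar_def xmon_def)

lemma opart_oone: "xmon 0 {} \<in> opart 0"
  by (simp add: opart_def xmon_def)

lemma opart_xvar: "xvar m i \<in> opart (dpar m i)"
  by (simp add: opart_def xvar_def xmon_def dpar_def)

lemma opart_omult:
  assumes "f \<in> opart a" "g \<in> opart b" "f \<in> fin_osup" "g \<in> fin_osup"
  shows "f \<odot> g \<in> opart (a + b)"
  using assms
  by (fastforce simp: fin_osup_def opart_supp omult_olin mon_mult_eq card_Un_disjoint
      elim!: supp_olinE split: if_splits)

lemma opart_osder:
  assumes "f \<in> opart a" "f \<in> fin_osup"
  shows "osder m i f \<in> opart (a + dpar m i)"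
proof -
  have "even (card (u - {i})) = odd (card u)" if "i \<in> u" "finite u" for u
    using that card_Suc_Diff1[of u i] by (metis even_Suc)
  then show ?thesis using assms
    by (fastforce simp: fin_osup_def opart_supp osder_olin mon_osder_eq dpar_def
        elim!: supp_olinE split: if_splits)
qed

lemma opart_disjoint:
  assumes "f \<in> opart a" "f \<in> opart b" "even a \<noteq> even b"
  shows "f = 0"
proof -
  have "supp f = {}" using assms by (fastforce simp: opart_supp)
  then show ?thesis by simp
qed

lemma coef_oproj: "coef (oproj \<gamma> f) a = (if even (card (snd a)) = even \<gamma> then coef f a else 0)"
proof -
  let ?A = "{a \<in> supp f. card (snd a) mod 2 = \<gamma> mod 2}"
  have "coef (oproj \<gamma> f) a = (\<Sum>b\<in>?A. coef f b * (if b = a then 1 else 0))"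
    unfolding oproj_def
    by (simp add: case_prod_unfold xmon_def lookup_single when_def if_distrib cong: if_cong)
  also have "\<dots> = (if a \<in> ?A then coef f a else 0)"
    by (simp add: if_distrib cong: if_cong)
  also have "\<dots> = (if even (card (snd a)) = even \<gamma> then coef f a else 0)"
    by (auto simp: in_keys_iff mod2_eq_if)
  finally show ?thesis .
qed

lemma oproj_opart: "oproj \<gamma> f \<in> opart \<gamma>"
  by (auto simp: opart_supp in_keys_iff coef_oproj split: if_splits)

lemma supp_oproj: "supp (oproj \<gamma> f) \<subseteq> supp f"
  by (auto simp: in_keys_iff coef_oproj split: if_splits)

lemma oproj_eq: "f \<in> opart a \<Longrightarrow> oproj \<gamma> f = (if even \<gamma> = even a then f else 0)"
proof (rule poly_mapping_eqI)
  fix b assume "f \<in> opart a"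
  then have "even (card (snd b)) = even a" if "coef f b \<noteq> 0"
    using that by (cases b) (auto simp: opart_supp in_keys_iff subset_iff)
  then show "coef (oproj \<gamma> f) b = coef (if even \<gamma> = even a then f else 0) b"
    by (auto simp: coef_oproj)
qed

lemma oproj_add: "oproj \<gamma> (f + g) = oproj \<gamma> f + oproj \<gamma> g"
  by (auto intro!: poly_mapping_eqI simp: coef_oproj lookup_add)

lemma oproj_oscale: "oproj \<gamma> (oscale c f) = oscale c (oproj \<gamma> f)"
  by (auto intro!: poly_mapping_eqI simp: coef_oproj)

lemma oproj_sum_parts: "oproj 0 f + oproj 1 f = f"
  by (auto intro!: poly_mapping_eqI simp: coef_oproj lookup_add)

subsection \<open>The partial derivatives\<close>

text \<open>Pascal's rule in the i-th factor; the other factors, collected in \<open>R\<close>, are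
  common to all terms. The case distinctions guard the truncated subtraction at exponent 0, where
  \<partial>_i gives zero.\<close>

lemma mbinom_pascal:
  assumes "coef (\<alpha> + \<beta>) i > 0"
  shows "mbinom (\<alpha> + \<beta>) \<alpha> =
    (if coef \<alpha> i > 0 then mbinom (\<alpha> - Poly_Mapping.single i 1 + \<beta>) (\<alpha> - Poly_Mapping.single i 1) else 0) +
    (if coef \<beta> i > 0 then mbinom (\<alpha> + (\<beta> - Poly_Mapping.single i 1)) \<alpha> else 0)"
proof -
  let ?A = "supp (\<alpha> + \<beta>)"
  define R where "R = (\<Prod>j\<in>?A - {i}. coef \<alpha> j + coef \<beta> j choose coef \<alpha> j)"
  have i: "i \<in> ?A" using assms by (simp add: in_keys_iff)
  have 1: "mbinom (\<alpha> + \<beta>) \<alpha> = (coef \<alpha> i + coef \<beta> i choose coef \<alpha> i) * R"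
    unfolding R_def using i
    by (subst mbinom_superset[of ?A]) (auto simp: supp_add_nat prod.remove[of _ i] lookup_add)
  have sub: "supp (\<gamma> - Poly_Mapping.single i 1) \<subseteq> supp \<gamma>" for \<gamma> :: "nat \<Rightarrow>\<^sub>0 nat"
    by (auto simp: in_keys_iff lookup_minus)
  have 2: "mbinom (\<alpha> - Poly_Mapping.single i 1 + \<beta>) (\<alpha> - Poly_Mapping.single i 1) =
      (coef \<alpha> i - 1 + coef \<beta> i choose (coef \<alpha> i - 1)) * R"
    using i sub[of \<alpha>] unfolding R_def
    by (subst mbinom_superset[of ?A])
      (auto simp: supp_add_nat prod.remove[of _ i] lookup_add lookup_minus lookup_single
        intro!: prod.cong arg_cong2[of _ _ _ _ "(*)"])
  have 3: "mbinom (\<alpha> + (\<beta> - Poly_Mapping.single i 1)) \<alpha> =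
      (coef \<alpha> i + (coef \<beta> i - 1) choose coef \<alpha> i) * R"
    using i sub[of \<beta>] unfolding R_def
    by (subst mbinom_superset[of ?A])
      (auto simp: supp_add_nat prod.remove[of _ i] lookup_add lookup_minus lookup_single
        intro!: prod.cong arg_cong2[of _ _ _ _ "(*)"])
  have "(a + b choose a) = (if a > 0 then (a - 1 + b choose (a - 1)) else 0) +
      (if b > 0 then (a + (b - 1) choose a) else 0)" if "a + b > 0" for a b
    using that by (cases a; cases b) auto
  then show ?thesis
    using assms unfolding 1 2 3 by (auto simp: lookup_add distrib_right)
qed

lemma osder_omult_even_mon:
  assumes "i \<le> m"
  shows "osder m i (mon_mult a b) = mon_osder m i a \<odot> unit_mon b + unit_mon a \<odot> mon_osder m i b"
proof -
  obtain \<alpha> u \<beta> v where ab: "a = (\<alpha>, u)" "b = (\<beta>, v)" by (cases a; cases b)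
  let ?e = "Poly_Mapping.single i (1::nat)"
  have 1: "\<alpha> - ?e + \<beta> = \<alpha> + \<beta> - ?e" if "coef \<alpha> i > 0"
    using that by (intro poly_mapping_eqI) (auto simp: lookup_add lookup_minus lookup_single when_def)
  have 2: "\<alpha> + (\<beta> - ?e) = \<alpha> + \<beta> - ?e" if "coef \<beta> i > 0"
    using that by (intro poly_mapping_eqI) (auto simp: lookup_add lookup_minus lookup_single when_def)
  show ?thesis
  proof (cases "u \<inter> v = {} \<and> coef (\<alpha> + \<beta>) i > 0")
    case True
    then show ?thesis
      using assms mbinom_pascal[of \<alpha> \<beta> i] 1 2
      by (auto simp: ab mon_mult_eq mon_osder_eq osder_olin omult_single lookup_add
          single_add[symmetric] distrib_left split: if_splits)
  next
    case False
    then show ?thesis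
      using assms
      by (auto simp: ab mon_mult_eq mon_osder_eq osder_olin omult_single lookup_add)
  qed
qed

lemma mon_osder_insert:
  assumes "m < i" "i \<notin> u"
  shows "mon_osder m i (\<alpha>, insert i u) = Poly_Mapping.single (\<alpha>, u) ((- 1) ^ inversions {i} u)"
  using assms by (simp add: mon_osder_eq)

lemma mon_osder_notin:
  assumes "m < i" "i \<notin> u"
  shows "mon_osder m i (\<alpha>, u) = 0"
  using assms by (simp add: mon_osder_eq)

text \<open>The cases are the possible positions of \<open>i\<close>: in neither, one or both of
  \<open>u\<close> and \<open>v\<close>. If it is in both, the product is zero, and the two terms on
  the right cancel since their sign exponents have different parity.\<close>

lemma osder_omult_odd_mon:
  assumes "m < i" "finite u" "finite v"
  shows "osder m i (mon_mult (\<alpha>, u) (\<beta>, v)) = mon_osder m i (\<alpha>, u) \<odot> unit_mon (\<beta>, v) +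
    oscale ((- 1) ^ card u) (unit_mon (\<alpha>, u) \<odot> mon_osder m i (\<beta>, v) :: 'a::field osup)"
proof -
  consider "i \<notin> u" "i \<notin> v"
    | u' where "u = insert i u'" "i \<notin> u'" "i \<notin> v"
    | v' where "v = insert i v'" "i \<notin> v'" "i \<notin> u"
    | u' v' where "u = insert i u'" "i \<notin> u'" "v = insert i v'" "i \<notin> v'"
    by (metis mk_disjoint_insert)
  then show ?thesis
  proof cases
    case 1
    then show ?thesis using assms
      by (simp add: mon_mult_eq mon_osder_notin osder_olin)
  next
    case 2
    show ?thesis
    proof (cases "u' \<inter> v = {}")
      case True
      \<comment> \<open>The letter \<open>i\<close> passes the smaller letters of \<open>v\<close>
        twice, once when the product is sorted and once when the derivative extracts it; hence the
        even correction.\<close>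
      have "inversions u v + inversions {i} (u' \<union> v) =
          inversions {i} u' + inversions u' v + 2 * inversions {i} v"
        using inversions_Un_left[of "{i}" u' v] inversions_Un_right[of "{i}" u' v] 2 assms True
        by simp
      then have "(- 1) ^ (inversions u v + inversions {i} (u' \<union> v)) =
          ((- 1) ^ (inversions {i} u' + inversions u' v) :: 'a)"
        by (intro minus_one_power_cong) simp
      with True 2 assms show ?thesis
        by (simp add: mon_mult_eq mon_osder_insert mon_osder_notin osder_olin omult_single power_add ac_simps)
    qed (use 2 assms in \<open>simp add: mon_mult_eq mon_osder_insert mon_osder_notin osder_olin omult_single\<close>)
  next
    case 3
    show ?thesis
    proof (cases "u \<inter> v' = {}")
      case True
      have "inversions u v + inversions {i} (u \<union> v') = card u + inversions {i} v' + inversions u v'"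
        using inversions_Un_right[of u "{i}" v'] inversions_Un_right[of "{i}" u v']
          inversions_swap[of u "{i}"] 3 assms True
        by simp
      then have "(- 1) ^ (inversions u v + inversions {i} (u \<union> v')) =
          ((- 1) ^ (card u + inversions {i} v' + inversions u v') :: 'a)"
        by simp
      with True 3 assms show ?thesis
        by (simp add: mon_mult_eq mon_osder_insert mon_osder_notin osder_olin omult_single power_add ac_simps)
    qed (use 3 assms in \<open>simp add: mon_mult_eq mon_osder_insert mon_osder_notin osder_olin omult_single\<close>)
  next
    case 4
    show ?thesis
    proof (cases "u' \<inter> v' = {}")
      case True
      have "inversions {i} u' + inversions u' v = card u' + inversions u' v'"
        using inversions_Un_right[of u' "{i}" v'] inversions_swap[of u' "{i}"] 4 assms True
        by simp
      note 1 = this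
      have 2: "card u + inversions {i} v' + inversions u v' =
          Suc (card u' + inversions u' v' + 2 * inversions {i} v')"
        using inversions_Un_left[of "{i}" u' v'] 4 assms True by simp
      have "(- 1) ^ (card u + inversions {i} v' + inversions u v') =
          (- ((- 1) ^ (inversions {i} u' + inversions u' v)) :: 'a)"
        unfolding 1 2 by (simp add: minus_one_power_iff)
      have "mon_osder m i (\<alpha>, u) \<odot> unit_mon (\<beta>, v) = Poly_Mapping.single (\<alpha> + \<beta>, u' \<union> v)
          ((- 1) ^ (inversions {i} u' + inversions u' v) * of_nat (mbinom (\<alpha> + \<beta>) \<alpha>) :: 'a)"
        using 4 assms True by (simp add: mon_mult_eq mon_osder_insert omult_single power_add ac_simps)
      moreover have "oscale ((- 1) ^ card u) (unit_mon (\<alpha>, u) \<odot> mon_osder m i (\<beta>, v)) =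
          Poly_Mapping.single (\<alpha> + \<beta>, u' \<union> v)
          ((- 1) ^ (card u + inversions {i} v' + inversions u v') * of_nat (mbinom (\<alpha> + \<beta>) \<alpha>) :: 'a)"
        using 4 assms True by (simp add: mon_mult_eq mon_osder_insert omult_single power_add ac_simps)
      moreover have "mon_mult (\<alpha>, u) (\<beta>, v) = (0 :: 'a osup)"
        using 4 by (auto simp: mon_mult_eq)
      ultimately show ?thesis
        by (simp add: \<open>(- 1) ^ (card u + inversions {i} v' + inversions u v') = _\<close> single_add[symmetric])
    qed (use 4 assms in \<open>simp add: mon_mult_eq mon_osder_insert osder_olin omult_single\<close>)
  qed
qed

lemma osder_omult:
  fixes f g :: "'a::field osup"
  assumes "f \<in> opart a" "f \<in> fin_osup" "g \<in> fin_osup"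
  shows "osder m i (f \<odot> g) = osder m i f \<odot> g + oscale ((- 1) ^ (dpar m i * a)) (f \<odot> osder m i g)"
proof -
  let ?s = "oscale ((- 1) ^ (dpar m i * a)) :: 'a osup \<Rightarrow> _"
  have 1: "osder m i (unit_mon c \<odot> unit_mon d) =
      osder m i (unit_mon c) \<odot> unit_mon d + ?s (unit_mon c \<odot> osder m i (unit_mon d))"
    if "c \<in> supp f" "d \<in> supp g" for c d
  proof (cases "i \<le> m")
    case True
    then show ?thesis
      by (simp add: dpar_def osder_unit_mon omult_unit_mon osder_omult_even_mon)
  next
    case False
    have "(- 1) ^ card (snd c) = ((- 1) ^ a :: 'a)"
      using that assms(1) by (intro minus_one_power_cong) (auto simp: opart_supp)
    moreover have "finite (snd c)" "finite (snd d)"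
      using that assms(2,3) by (auto simp: fin_osup_def)
    ultimately show ?thesis
      using False osder_omult_odd_mon[of m i "snd c" "snd d" "fst c" "fst d", where ?'a = 'a]
      by (simp add: dpar_def osder_unit_mon omult_unit_mon)
  qed
  have 2: "osder m i (unit_mon c \<odot> g) = osder m i (unit_mon c) \<odot> g + ?s (unit_mon c \<odot> osder m i g)"
    if "c \<in> supp f" for c
    by (rule linear_eq_on_supp[of "\<lambda>g. osder m i (unit_mon c \<odot> g)"
          "\<lambda>g. osder m i (unit_mon c) \<odot> g + ?s (unit_mon c \<odot> osder m i g)" g, OF _ _ 1[OF that]])
      (rule linear_comp[OF linear_osder linear_omult_right[of "unit_mon c"]]
        linear_plus[OF linear_omult_right linear_comp[OF linear_oscale
          linear_comp[OF linear_omult_right[of "unit_mon c"] linear_osder]]] | assumption)+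
  show ?thesis
    by (rule linear_eq_on_supp[of "\<lambda>f. osder m i (f \<odot> g)"
          "\<lambda>f. osder m i f \<odot> g + ?s (f \<odot> osder m i g)" f, OF _ _ 2])
      (rule linear_comp[OF linear_osder linear_omult_left[of g]]
        linear_plus[OF linear_comp[OF linear_omult_left[of g] linear_osder]
          linear_comp[OF linear_oscale linear_omult_left]] | assumption)+
qed

text \<open>The sign -1 arises for two distinct odd letters of \<open>u\<close>: removing the
  smaller one first shortens the way of the larger one by one step, and not conversely. For equal
  odd indices both sides vanish.\<close>

lemma osder_commute:
  fixes f :: "'a::field osup"
  assumes "f \<in> fin_osup"
  shows "osder m i (osder m j f) = oscale ((- 1) ^ (dpar m i * dpar m j)) (osder m j (osder m i f))"
proof -
  have 1: "osder m i (mon_osder m j (\<alpha>, u)) =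
      oscale ((- 1) ^ (dpar m i * dpar m j)) (osder m j (mon_osder m i (\<alpha>, u)) :: 'a osup)"
    if "finite u" for \<alpha> u
  proof (cases "m < i \<and> m < j \<and> i \<in> u \<and> j \<in> u \<and> i \<noteq> j")
    case True
    define w where "w = u - {i, j}"
    have w: "u = insert i (insert j w)" "i \<notin> w" "j \<notin> w"
      using True by (auto simp: w_def)
    have "finite w" using that w by simp
    then have "inversions {j} (insert i w) = inversions {j} {i} + inversions {j} w"
      "inversions {i} (insert j w) = inversions {i} {j} + inversions {i} w"
      using inversions_Un_right[of "{j}" "{i}" w] inversions_Un_right[of "{i}" "{j}" w] w by simp_all
    moreover have "inversions {i} {j} + inversions {j} {i} = 1"
      using inversions_swap[of "{i}" "{j}"] True by simp
    ultimately have "inversions {j} (insert i w) + inversions {i} w + 2 * inversions {i} {j} =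
        Suc (inversions {i} (insert j w) + inversions {j} w)"
      by simp
    then have "even (inversions {j} (insert i w) + inversions {i} w) =
        even (Suc (inversions {i} (insert j w) + inversions {j} w))"
      by (metis even_add even_mult_iff even_numeral)
    then have "(- 1) ^ (inversions {j} (insert i w) + inversions {i} w) =
        (- ((- 1) ^ (inversions {i} (insert j w) + inversions {j} w)) :: 'a)"
      by (simp add: minus_one_power_iff)
    moreover have "mon_osder m i (\<alpha>, u) =
        Poly_Mapping.single (\<alpha>, insert j w) ((- 1) ^ inversions {i} (insert j w) :: 'a)"
      unfolding w(1) using True w by (intro mon_osder_insert) auto
    moreover have "mon_osder m j (\<alpha>, u) =
        Poly_Mapping.single (\<alpha>, insert i w) ((- 1) ^ inversions {j} (insert i w) :: 'a)"
      unfolding w(1) insert_commute[of i j w] using True w by (intro mon_osder_insert) auto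
    ultimately show ?thesis
      using True w by (simp add: dpar_def osder_olin mon_osder_insert power_add ac_simps)
  next
    case False
    have e: "\<alpha> - Poly_Mapping.single i 1 - Poly_Mapping.single j 1 =
        \<alpha> - Poly_Mapping.single j 1 - Poly_Mapping.single i 1"
      by (rule poly_mapping_eqI) (simp add: lookup_minus)
    consider "i \<le> m" "j \<le> m" | "i \<le> m" "m < j" | "m < i" "j \<le> m" | "m < i" "m < j" "i = j"
      | "m < i" "m < j" "i \<noteq> j" "\<not> (i \<in> u \<and> j \<in> u)"
      using False by (metis linorder_not_le)
    then show ?thesis
    proof cases
      case 1
      then show ?thesis
        using e by (cases "i = j") (simp_all add: dpar_def osder_olin mon_osder_eq lookup_minus lookup_single)
    qed (auto simp: dpar_def osder_olin mon_osder_eq)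
  qed
  show ?thesis
  proof (rule linear_eq_on_supp[of "\<lambda>f. osder m i (osder m j f)"
        "\<lambda>f. oscale ((- 1) ^ (dpar m i * dpar m j)) (osder m j (osder m i f))" f])
    show "osder m i (osder m j (unit_mon a)) = oscale ((- 1) ^ (dpar m i * dpar m j))
        (osder m j (osder m i (unit_mon a :: 'a osup)))" if "a \<in> supp f" for a
      using that assms 1[of "snd a" "fst a"] by (simp add: fin_osup_def osder_unit_mon)
  qed (rule linear_comp[OF linear_osder linear_osder]
      linear_comp[OF linear_oscale linear_comp[OF linear_osder linear_osder]])+
qed

lemma osder_oone [simp]: "osder m i (xmon 0 {}) = 0"
  by (simp add: xmon_def osder_olin mon_osder_eq)

lemma osder_xvar: "osder m i (xvar m j) = (if i = j then xmon 0 {} else 0)"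
  by (auto simp: xvar_def xmon_def osder_olin mon_osder_eq lookup_single when_def)

text \<open>On divided powers \<partial>_i is a pure shift of coefficients without integer factors;
  therefore it loses nothing in characteristic p.\<close>

lemma coef_osder_even:
  assumes "i \<le> m"
  shows "coef (osder m i f) (\<alpha>, u) = coef f (\<alpha> + Poly_Mapping.single i 1, u)"
proof -
  let ?b = "(\<alpha> + Poly_Mapping.single i 1, u)"
  have inj: "\<beta> = \<alpha> + Poly_Mapping.single i 1"
    if "coef \<beta> i \<noteq> 0" "\<beta> - Poly_Mapping.single i 1 = \<alpha>" for \<beta>
    using that by (auto intro!: poly_mapping_eqI simp: lookup_add lookup_minus lookup_single when_def)
  have "coef (osder m i f) (\<alpha>, u) = (\<Sum>a\<in>supp f. coef f a * coef (mon_osder m i a) (\<alpha>, u))"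
    by (simp add: osder_olin olin_def)
  also have "\<dots> = (\<Sum>a\<in>supp f. if a = ?b then coef f a else 0)"
  proof (rule sum.cong)
    fix a assume "a \<in> supp f"
    show "coef f a * coef (mon_osder m i a) (\<alpha>, u) = (if a = ?b then coef f a else 0)"
    proof (cases a)
      case (Pair \<beta> v)
      show ?thesis
      proof (cases "coef \<beta> i = 0")
        case True
        then show ?thesis using assms by (auto simp: Pair mon_osder_eq lookup_add)
      next
        case False
        have "(\<beta> - Poly_Mapping.single i 1 = \<alpha>) = (\<beta> = \<alpha> + Poly_Mapping.single i 1)"
          using inj[OF False] by auto
        then show ?thesis using assms False by (simp add: Pair mon_osder_eq lookup_single when_def)
      qed
    qed
  qed simp
  also have "\<dots> = coef f ?b" by (simp add: in_keys_iff)
  finally show ?thesis .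
qed

lemma coef_osder_odd:
  assumes "m < i" "i \<notin> u"
  shows "coef (osder m i f) (\<alpha>, u) = (- 1) ^ inversions {i} u * coef f (\<alpha>, insert i u)"
proof -
  let ?b = "(\<alpha>, insert i u)"
  have "coef (osder m i f) (\<alpha>, u) = (\<Sum>a\<in>supp f. coef f a * coef (mon_osder m i a) (\<alpha>, u))"
    by (simp add: osder_olin olin_def)
  also have "\<dots> = (\<Sum>a\<in>supp f. if a = ?b then (- 1) ^ inversions {i} u * coef f a else 0)"
  proof (rule sum.cong)
    fix a assume "a \<in> supp f"
    show "coef f a * coef (mon_osder m i a) (\<alpha>, u) =
        (if a = ?b then (- 1) ^ inversions {i} u * coef f a else 0)"
      using assms by (cases a) (auto simp: mon_osder_eq lookup_single when_def)
  qed simp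
  also have "\<dots> = (- 1) ^ inversions {i} u * coef f ?b" by (simp add: in_keys_iff)
  finally show ?thesis .
qed

subsection \<open>The truncated algebra\<close>

text \<open>The number \<open>p\<close> is an explicit argument because a set of monomials does not
  mention the field.\<close>

definition trunc_mons :: "nat \<Rightarrow> nat \<Rightarrow> nat \<Rightarrow> (nat \<Rightarrow> nat) \<Rightarrow> monom set" where
  "trunc_mons p m n \<tau> = {(\<alpha>, u). supp \<alpha> \<subseteq> {1..m} \<and> (\<forall>i\<in>{1..m}. coef \<alpha> i \<le> p ^ \<tau> i - 1) \<and>
     u \<subseteq> {m+1..m+n}}"

lemma trunc_O_supp:
  "(trunc_O m n \<tau> :: 'a::field osup set) = {f. supp f \<subseteq> trunc_mons CHAR('a) m n \<tau>}"
proof -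
  have "{xmon \<alpha> u | \<alpha> u. supp \<alpha> \<subseteq> {1..m} \<and> (\<forall>i\<in>{1..m}. coef \<alpha> i \<le> CHAR('a) ^ \<tau> i - 1) \<and>
     u \<subseteq> {m+1..m+n}} = (unit_mon ` trunc_mons CHAR('a) m n \<tau> :: 'a osup set)"
    by (auto simp: trunc_mons_def xmon_def image_iff)
  then show ?thesis
    by (simp add: trunc_O_def span_unit_mon)
qed

lemma subspace_trunc_O: "osup.subspace (trunc_O m n \<tau>)"
  unfolding trunc_O_supp by (rule subspace_supp)

lemmas trunc_O_lin [simp] =
  osup.subspace_0[OF subspace_trunc_O] osup.subspace_add[OF subspace_trunc_O]
  osup.subspace_diff[OF subspace_trunc_O] osup.subspace_neg[OF subspace_trunc_O]
  osup.subspace_scale[OF subspace_trunc_O] osup.subspace_sum[OF subspace_trunc_O]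

lemma trunc_O_fin [simp]: "f \<in> trunc_O m n \<tau> \<Longrightarrow> f \<in> fin_osup"
proof -
  have "trunc_mons p m n \<tau> \<subseteq> {a. finite (snd a)}" for p
    by (auto simp: trunc_mons_def dest: finite_subset)
  then show "f \<in> trunc_O m n \<tau> \<Longrightarrow> f \<in> fin_osup"
    unfolding trunc_O_supp fin_osup_supp by blast
qed

lemma trunc_O_oproj [simp]: "f \<in> trunc_O m n \<tau> \<Longrightarrow> oproj \<gamma> f \<in> trunc_O m n \<tau>"
  using supp_oproj[of \<gamma> f] by (auto simp: trunc_O_supp)

lemma trunc_O_osder [simp]:
  assumes "f \<in> trunc_O m n \<tau>"
  shows "osder m i f \<in> trunc_O m n \<tau>"
proof -
  have "b \<in> trunc_mons q m n \<tau>" if "a \<in> trunc_mons q m n \<tau>" "b \<in> supp (mon_osder m i a :: 'a osup)" for a b q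
  proof (cases a)
    case (Pair \<alpha> u)
    have "supp (\<alpha> - Poly_Mapping.single i 1) \<subseteq> supp \<alpha>"
      by (auto simp: in_keys_iff lookup_minus)
    moreover have "coef (\<alpha> - Poly_Mapping.single i 1) j \<le> coef \<alpha> j" for j
      by (simp add: lookup_minus)
    ultimately show ?thesis using that
      by (force simp: Pair mon_osder_eq trunc_mons_def split: if_splits intro: order_trans)
  qed
  then show ?thesis
    using assms by (fastforce simp: trunc_O_supp osder_olin elim!: supp_olinE)
qed

lemma trunc_O_oone [simp]: "xmon 0 {} \<in> trunc_O m n \<tau>"
  by (auto simp: trunc_O_supp xmon_def trunc_mons_def)

text \<open>From k (q choose k) = q (q - 1 choose k - 1) with q = p^e: if p did not divide the
  binomial coefficient, q would divide k, which is positive and smaller than q.\<close>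

lemma prime_dvd_choose_prime_power:
  assumes "prime (p::nat)" "0 < k" "k < p ^ e"
  shows "p dvd (p ^ e choose k)"
proof (rule ccontr)
  assume *: "\<not> p dvd (p ^ e choose k)"
  have "k * (p ^ e choose k) = p ^ e * ((p ^ e - 1) choose (k - 1))"
    using assms times_binomial_minus1_eq[of k "p ^ e"] by simp
  then have "p ^ e dvd k * (p ^ e choose k)" by simp
  moreover have "coprime (p ^ e) (p ^ e choose k)"
    using * assms(1) by (simp add: prime_imp_coprime)
  ultimately have "p ^ e dvd k" by (simp add: coprime_dvd_mult_left_iff)
  then show False using assms(2,3) by (simp add: nat_dvd_not_less)
qed

text \<open>Vandermonde's identity with \<open>a + b = p\<^sup>e + c\<close>: every nonzero summand contains a factor
  \<open>p\<^sup>e choose k\<close> with \<open>0 < k < p\<^sup>e\<close>, because \<open>c < a\<close>.\<close>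

lemma prime_dvd_choose_carry:
  assumes "prime (p::nat)" "a < p ^ e" "b < p ^ e" "p ^ e \<le> a + b"
  shows "p dvd (a + b choose a)"
proof -
  define c where "c = a + b - p ^ e"
  have c: "a + b = p ^ e + c" "c < a" using assms by (simp_all add: c_def)
  have "p dvd (p ^ e choose k) * (c choose (a - k))" if "k \<le> a" for k
    using that c assms prime_dvd_choose_prime_power[of p k e] 
    by (cases "k = 0") (auto simp: binomial_eq_0)
  then show ?thesis
    unfolding c(1) by (subst vandermonde[symmetric]) (auto intro!: dvd_sum)
qed

text \<open>If an exponent of the product exceeds its bound p^e - 1, the corresponding binomial
  factor is divisible by p by \<open>prime_dvd_choose_carry\<close>, so the monomial gets
  coefficient 0 in the field.\<close>

lemma trunc_O_omult [simp]:
  fixes f g :: "'a::field osup"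
  assumes "prime CHAR('a)" "f \<in> trunc_O m n \<tau>" "g \<in> trunc_O m n \<tau>"
  shows "f \<odot> g \<in> trunc_O m n \<tau>"
proof -
  let ?p = "CHAR('a)"
  have "c \<in> trunc_mons ?p m n \<tau>"
    if ab: "a \<in> trunc_mons ?p m n \<tau>" "b \<in> trunc_mons ?p m n \<tau>" "c \<in> supp (mon_mult a b :: 'a osup)" for a b c
  proof -
    obtain \<alpha> u \<beta> v where s: "a = (\<alpha>, u)" "b = (\<beta>, v)" by (cases a; cases b)
    have c: "c = (\<alpha> + \<beta>, u \<union> v)" and nz: "of_nat (mbinom (\<alpha> + \<beta>) \<alpha>) \<noteq> (0 :: 'a)"
      using ab(3) by (auto simp: s mon_mult_eq split: if_splits)
    have "coef \<alpha> i + coef \<beta> i \<le> ?p ^ \<tau> i - 1" if i: "i \<in> {1..m}" for i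
    proof (rule ccontr)
      assume gt: "\<not> ?thesis"
      have p: "?p ^ \<tau> i > 0" using assms(1) prime_gt_0_nat by simp
      have "coef \<alpha> i \<le> ?p ^ \<tau> i - 1" "coef \<beta> i \<le> ?p ^ \<tau> i - 1"
        using ab(1,2) i by (auto simp: s trunc_mons_def)
      with p gt have d: "?p dvd (coef \<alpha> i + coef \<beta> i choose coef \<alpha> i)"
        using assms(1) by (intro prime_dvd_choose_carry[of _ _ "\<tau> i"]) linarith+
      have "i \<in> supp (\<alpha> + \<beta>)" using p gt by (auto simp: in_keys_iff lookup_add)
      then have "(coef (\<alpha> + \<beta>) i choose coef \<alpha> i) dvd mbinom (\<alpha> + \<beta>) \<alpha>"
        unfolding mbinom_def by (intro dvd_prodI) auto
      with d have "?p dvd mbinom (\<alpha> + \<beta>) \<alpha>"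
        by (metis dvd_trans lookup_add)
      with nz show False by (simp add: of_nat_eq_0_iff_char_dvd)
    qed
    then show ?thesis
      using ab(1,2) by (auto simp: c s trunc_mons_def supp_add_nat lookup_add)
  qed
  then show ?thesis
    using assms(2,3) by (fastforce simp: trunc_O_supp omult_olin elim!: supp_olinE)
qed

text \<open>An even variable needs a positive height: for height 0 the bound p^0 - 1 excludes
  exponent 1.\<close>

lemma trunc_O_xvar [simp]:
  assumes "CHAR('a::field) > 1" "i \<in> {1..m+n}" "i \<le> m \<Longrightarrow> \<tau> i > 0"
  shows "(xvar m i :: 'a osup) \<in> trunc_O m n \<tau>"
proof (cases "i \<le> m")
  case True
  then have "1 < CHAR('a) ^ \<tau> i" using assms by (intro one_less_power) auto
  then show ?thesis using True assms
    by (auto simp: trunc_O_supp xvar_def xmon_def trunc_mons_def lookup_single when_def)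
qed (use assms in \<open>auto simp: trunc_O_supp xvar_def xmon_def trunc_mons_def\<close>)

text \<open>A nonconstant monomial in the support contains some variable, and the derivative by that
  variable has, up to sign, the same coefficient at the monomial with this variable lowered. Divided
  powers leave no further constants in characteristic p.\<close>

lemma all_osder_zero_imp_const:
  fixes f :: "'a::field osup"
  assumes "f \<in> trunc_O m n \<tau>" "\<And>i. i \<in> {1..m+n} \<Longrightarrow> osder m i f = 0"
  shows "f = oscale (coef f (0, {})) (xmon 0 {})"
proof -
  have "coef f (\<alpha>, u) = 0" if "(\<alpha>, u) \<noteq> (0, {})" for \<alpha> u
  proof (rule ccontr)
    assume nz: "coef f (\<alpha>, u) \<noteq> 0"
    then have "(\<alpha>, u) \<in> trunc_mons CHAR('a) m n \<tau>"
      using assms(1) by (auto simp: trunc_O_supp in_keys_iff)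
    then have k: "supp \<alpha> \<subseteq> {1..m}" "u \<subseteq> {m+1..m+n}" by (auto simp: trunc_mons_def)
    consider i where "i \<in> supp \<alpha>" | i where "i \<in> u"
      using \<open>(\<alpha>, u) \<noteq> (0, {})\<close> 
      by (cases "\<alpha> = 0") (auto simp del: Poly_Mapping.keys_eq_empty simp flip: Poly_Mapping.keys_eq_empty)
    then show False
    proof cases
      case 1
      let ?\<beta> = "\<alpha> - Poly_Mapping.single i 1"
      have e: "?\<beta> + Poly_Mapping.single i 1 = \<alpha>"
        using 1 by (intro poly_mapping_eqI) (auto simp: lookup_add lookup_minus lookup_single when_def in_keys_iff)
      have "i \<in> {1..m}" using 1 k by blast
      then have "coef f (?\<beta> + Poly_Mapping.single i 1, u) = 0"
        using assms(2)[of i] by (subst coef_osder_even[symmetric, where m = m]) auto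
      then show False using nz unfolding e by simp
    next
      case 2
      then have i: "i \<in> {m+1..m+n}" using k by blast
      have "coef (osder m i f) (\<alpha>, u - {i}) = (- 1) ^ inversions {i} (u - {i}) * coef f (\<alpha>, insert i (u - {i}))"
        using i by (intro coef_osder_odd) auto
      moreover have "osder m i f = 0" using i assms(2)[of i] by simp
      moreover have "insert i (u - {i}) = u" using 2 by blast
      ultimately show False using nz by simp
    qed
  qed
  then have "coef f k = 0" if "k \<noteq> (0, {})" for k
    using that by (metis surj_pair)
  then show ?thesis
    by (intro poly_mapping_eqI) (simp add: xmon_def lookup_single when_def)
qed

subsection \<open>Vector fields as superderivations\<close>

definition act :: "nat \<Rightarrow> 'a::field vfield \<Rightarrow> 'a osup \<Rightarrow> 'a osup" where
  "act m D g = (\<Sum>i\<in>supp D. coef D i \<odot> osder m i g)"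

definition fin_vfield :: "'a::field vfield set" where
  "fin_vfield = {D. \<forall>i. coef D i \<in> fin_osup}"

lemma fin_vfieldD [simp]: "D \<in> fin_vfield \<Longrightarrow> coef D i \<in> fin_osup"
  by (simp add: fin_vfield_def)

lemma vpart_iff: "D \<in> vpart m a \<longleftrightarrow> (\<forall>i. coef D i \<in> opart (a + dpar m i))"
  unfolding vpart_def using in_keys_iff opart_lin(1) by fastforce

lemma vpartD: "D \<in> vpart m a \<Longrightarrow> coef D i \<in> opart (a + dpar m i)"
  by (simp add: vpart_iff)

lemma vpart_cong: "even a = even b \<Longrightarrow> vpart m a = (vpart m b :: 'a::field vfield set)"
proof -
  assume "even a = even b"
  then have "opart (a + dpar m i) = (opart (b + dpar m i) :: 'a osup set)" for i
    by (intro opart_cong) simp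
  then show ?thesis by (auto simp: vpart_iff)
qed

lemma subspace_vpart: "vfield.subspace (vpart m a)"
  by (simp add: vfield.subspace_def vpart_iff lookup_add opart_lin)

lemma vpart_disjoint:
  assumes "D \<in> vpart m a" "D \<in> vpart m b" "even a \<noteq> even b"
  shows "D = 0"
proof (rule poly_mapping_eqI)
  show "coef D i = coef 0 i" for i
    using assms opart_disjoint[of "coef D i" "a + dpar m i" "b + dpar m i"] by (auto simp: vpart_iff)
qed

lemma act_superset:
  assumes "finite A" "supp D \<subseteq> A"
  shows "act m D g = (\<Sum>i\<in>A. coef D i \<odot> osder m i g)"
  unfolding act_def using assms
  by (intro sum.mono_neutral_left) (auto simp: in_keys_iff)

lemma act_add_left: "act m (D + E) g = act m D g + act m E g"
proof -
  have *: "supp (D + E) \<subseteq> supp D \<union> supp E" by (rule Poly_Mapping.keys_add)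
  show ?thesis
    by (simp add: act_superset[OF _ *] act_superset[of "supp D \<union> supp E" D]
        act_superset[of "supp D \<union> supp E" E] lookup_add olinear_simps sum.distrib)
qed

lemma act_vscale_left: "act m (vscale c D) g = oscale c (act m D g)"
proof -
  have *: "supp (vscale c D) \<subseteq> supp D" by (auto simp: in_keys_iff)
  show ?thesis
    by (subst act_superset[OF _ *]) (simp_all add: act_def olinear_simps osup.scale_sum_right)
qed

lemma linear_act: "Vector_Spaces.linear oscale oscale (act m D)"
  by unfold_locales
    (simp_all add: act_def olinear_simps sum.distrib osup.scale_sum_right)

global_interpretation act: Vector_Spaces.linear oscale oscale "act m D"
  by (rule linear_act)

lemmas act_simps = act.add act.diff act.neg act.scale act.sum act_add_left act_vscale_left

declare act.zero [simp]

lemma fin_osup_act [simp]: "D \<in> fin_vfield \<Longrightarrow> g \<in> fin_osup \<Longrightarrow> act m D g \<in> fin_osup"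
  by (simp add: act_def)

lemma opart_act:
  assumes "D \<in> vpart m a" "g \<in> opart b" "D \<in> fin_vfield" "g \<in> fin_osup"
  shows "act m D g \<in> opart (a + b)"
  unfolding act_def
proof (rule opart_lin)
  fix i
  have "coef D i \<odot> osder m i g \<in> opart ((a + dpar m i) + (b + dpar m i))"
    using assms by (intro opart_omult opart_osder) (auto simp: vpart_iff)
  then show "coef D i \<odot> osder m i g \<in> opart (a + b)"
    using opart_cong[of "(a + dpar m i) + (b + dpar m i)" "a + b"] by auto
qed

text \<open>A field is determined by its values on the variables, which are its
  coefficients.\<close>

lemma act_xvar: "act m D (xvar m i) = coef D i"
proof -
  have "act m D (xvar m i) = (\<Sum>j\<in>supp D. if j = i then coef D j else 0)"
    unfolding act_def by (rule sum.cong) (simp_all add: osder_xvar)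
  also have "\<dots> = coef D i" by (simp add: in_keys_iff)
  finally show ?thesis .
qed

lemma act_oone [simp]: "act m D (xmon 0 {}) = 0"
  by (simp add: act_def)

lemma act_omult:
  fixes D :: "'a::field vfield"
  assumes "D \<in> vpart m a" "f \<in> opart b" "D \<in> fin_vfield" "f \<in> fin_osup" "g \<in> fin_osup"
  shows "act m D (f \<odot> g) = act m D f \<odot> g + oscale ((- 1) ^ (a * b)) (f \<odot> act m D g)"
proof -
  have "coef D i \<odot> osder m i (f \<odot> g) =
      coef D i \<odot> osder m i f \<odot> g + oscale ((- 1) ^ (a * b)) (f \<odot> (coef D i \<odot> osder m i g))" for i
  proof -
    have 1: "osder m i (f \<odot> g) = osder m i f \<odot> g + oscale ((- 1) ^ (dpar m i * b)) (f \<odot> osder m i g)"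
      using assms by (intro osder_omult)
    have 2: "coef D i \<odot> f = oscale ((- 1) ^ (b * (a + dpar m i))) (f \<odot> coef D i)"
      using assms by (intro omult_commute) (auto simp: vpart_iff)
    \<comment> \<open>Both \<partial>_i and its coefficient pass \<open>f\<close>; the parity of
      \<partial>_i enters twice and drops out, which leaves the parity of the whole field.\<close>
    have 3: "(- 1) ^ (dpar m i * b) * (- 1) ^ (b * (a + dpar m i)) = ((- 1) ^ (a * b) :: 'a)"
      unfolding power_add[symmetric] by (intro minus_one_power_cong) auto
    have "coef D i \<odot> (f \<odot> osder m i g) = coef D i \<odot> f \<odot> osder m i g"
      using assms by (simp add: omult_assoc)
    also have "\<dots> = oscale ((- 1) ^ (b * (a + dpar m i))) (f \<odot> (coef D i \<odot> osder m i g))"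
      using assms by (simp only: 2 olinear_simps) (simp add: omult_assoc)
    finally have "oscale ((- 1) ^ (dpar m i * b)) (coef D i \<odot> (f \<odot> osder m i g)) =
        oscale ((- 1) ^ (a * b)) (f \<odot> (coef D i \<odot> osder m i g))"
      by (simp add: 3)
    then show ?thesis
      using assms by (simp add: 1 olinear_simps omult_assoc)
  qed
  then show ?thesis
    by (simp add: act_def sum.distrib olinear_simps osup.scale_sum_right)
qed

subsection \<open>The bracket of vector fields\<close>

definition pair_bracket :: "nat \<Rightarrow> nat \<Rightarrow> nat \<Rightarrow> 'a::field osup \<Rightarrow> 'a osup \<Rightarrow> 'a vfield" where
  "pair_bracket m i j f g =
     (\<Sum>\<alpha>\<in>{0, 1}. \<Sum>\<beta>\<in>{0, 1}. bracket_hom m \<alpha> (oproj \<alpha> f) i \<beta> (oproj \<beta> g) j)"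

lemma coef_bracket_hom: "coef (bracket_hom m \<alpha> f i \<beta> g j) k =
  (if k = j then f \<odot> osder m i g else 0) -
  oscale ((- 1) ^ ((\<alpha> + dpar m i) * (\<beta> + dpar m j))) (if k = i then g \<odot> osder m j f else 0)"
  by (simp add: bracket_hom_def lookup_minus lookup_single when_def)

lemma bracket_hom_linear:
  "bracket_hom m \<alpha> (f + f') i \<beta> g j = bracket_hom m \<alpha> f i \<beta> g j + bracket_hom m \<alpha> f' i \<beta> g j"
  "bracket_hom m \<alpha> f i \<beta> (g + g') j = bracket_hom m \<alpha> f i \<beta> g j + bracket_hom m \<alpha> f i \<beta> g' j"
  "bracket_hom m \<alpha> (oscale c f) i \<beta> g j = vscale c (bracket_hom m \<alpha> f i \<beta> g j)"
  "bracket_hom m \<alpha> f i \<beta> (oscale c g) j = vscale c (bracket_hom m \<alpha> f i \<beta> g j)"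
  by (rule poly_mapping_eqI, simp add: coef_bracket_hom lookup_add olinear_simps
      osup.scale_right_distrib osup.scale_right_diff_distrib mult.commute)+

lemma bracket_hom_zero [simp]: "bracket_hom m \<alpha> 0 i \<beta> g j = 0" "bracket_hom m \<alpha> f i \<beta> 0 j = 0"
  by (rule poly_mapping_eqI, simp add: coef_bracket_hom)+

lemma pair_bracket_add:
  "pair_bracket m i j (f + f') g = pair_bracket m i j f g + pair_bracket m i j f' g"
  "pair_bracket m i j f (g + g') = pair_bracket m i j f g + pair_bracket m i j f g'"
  by (simp_all add: pair_bracket_def oproj_add bracket_hom_linear)

lemma pair_bracket_oscale:
  "pair_bracket m i j (oscale c f) g = vscale c (pair_bracket m i j f g)"
  "pair_bracket m i j f (oscale c g) = vscale c (pair_bracket m i j f g)"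
  by (simp_all add: pair_bracket_def oproj_oscale bracket_hom_linear vfield.scale_right_distrib)

lemma pair_bracket_zero [simp]: "pair_bracket m i j 0 g = 0" "pair_bracket m i j f 0 = 0"
  using pair_bracket_add(1)[of m i j 0 0 g] pair_bracket_add(2)[of m i j f 0 0] by simp_all

lemma vbracket_superset:
  assumes "finite A" "finite B" "supp D \<subseteq> A" "supp E \<subseteq> B"
  shows "vbracket m D E = (\<Sum>i\<in>A. \<Sum>j\<in>B. pair_bracket m i j (coef D i) (coef E j))"
proof -
  have "vbracket m D E = (\<Sum>i\<in>supp D. \<Sum>j\<in>supp E. pair_bracket m i j (coef D i) (coef E j))"
    by (simp only: vbracket_def pair_bracket_def)
  also have "\<dots> = (\<Sum>i\<in>A. \<Sum>j\<in>supp E. pair_bracket m i j (coef D i) (coef E j))"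
    using assms by (intro sum.mono_neutral_left) (auto simp: in_keys_iff)
  also have "\<dots> = (\<Sum>i\<in>A. \<Sum>j\<in>B. pair_bracket m i j (coef D i) (coef E j))"
    using assms by (intro sum.cong sum.mono_neutral_left) (auto simp: in_keys_iff)
  finally show ?thesis .
qed

lemma vbracket_add_left: "vbracket m (D + D') E = vbracket m D E + vbracket m D' E"
proof -
  let ?A = "supp D \<union> supp D'"
  have *: "supp (D + D') \<subseteq> ?A" by (rule Poly_Mapping.keys_add)
  show ?thesis
    by (simp add: vbracket_superset[of ?A "supp E" "D + D'"] * vbracket_superset[of ?A "supp E" D]
        vbracket_superset[of ?A "supp E" D'] lookup_add pair_bracket_add sum.distrib)
qed

lemma vbracket_add_right: "vbracket m D (E + E') = vbracket m D E + vbracket m D E'"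
proof -
  let ?A = "supp E \<union> supp E'"
  have *: "supp (E + E') \<subseteq> ?A" by (rule Poly_Mapping.keys_add)
  show ?thesis
    by (simp add: vbracket_superset[of "supp D" ?A _ "E + E'"] * vbracket_superset[of "supp D" ?A _ E]
        vbracket_superset[of "supp D" ?A _ E'] lookup_add pair_bracket_add sum.distrib)
qed

lemma vbracket_vscale_left: "vbracket m (vscale c D) E = vscale c (vbracket m D E)"
proof -
  have *: "supp (vscale c D) \<subseteq> supp D" by (auto simp: in_keys_iff)
  show ?thesis
    by (simp add: vbracket_superset[of "supp D" "supp E" "vscale c D"] *
        vbracket_superset[of "supp D" "supp E" D] pair_bracket_oscale vfield.scale_sum_right)
qed

lemma vbracket_vscale_right: "vbracket m D (vscale c E) = vscale c (vbracket m D E)"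
proof -
  have *: "supp (vscale c E) \<subseteq> supp E" by (auto simp: in_keys_iff)
  show ?thesis
    by (simp add: vbracket_superset[of "supp D" "supp E" _ "vscale c E"] *
        vbracket_superset[of "supp D" "supp E" _ E] pair_bracket_oscale vfield.scale_sum_right)
qed

global_interpretation vbracket_left: Vector_Spaces.linear vscale vscale "\<lambda>D. vbracket m D E"
  by unfold_locales (rule vbracket_add_left vbracket_vscale_left)+

global_interpretation vbracket_right: Vector_Spaces.linear vscale vscale "\<lambda>E. vbracket m D E"
  by unfold_locales (rule vbracket_add_right vbracket_vscale_right)+

text \<open>Of the four parity terms only one survives. Its sign involves the parities
  \<open>a\<close> and \<open>b\<close> of the fields and no longer \<open>i\<close> and
  \<open>j\<close>, so it can be taken out of the double sum.\<close>

lemma coef_pair_bracket: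
  assumes "f \<in> opart (a + dpar m i)" "g \<in> opart (b + dpar m j)"
  shows "coef (pair_bracket m i j f g) k = (if k = j then f \<odot> osder m i g else 0) -
    oscale ((- 1) ^ (a * b)) (if k = i then g \<odot> osder m j f else 0)"
proof -
  define \<alpha>0 where "\<alpha>0 = (a + dpar m i) mod 2"
  define \<beta>0 where "\<beta>0 = (b + dpar m j) mod 2"
  have "oproj \<alpha> f = (if \<alpha> = \<alpha>0 then f else 0)" if "\<alpha> \<in> {0, 1}" for \<alpha>
    using that by (auto simp: oproj_eq[OF assms(1)] \<alpha>0_def mod2_eq_if)
  moreover have "oproj \<beta> g = (if \<beta> = \<beta>0 then g else 0)" if "\<beta> \<in> {0, 1}" for \<beta>
    using that by (auto simp: oproj_eq[OF assms(2)] \<beta>0_def mod2_eq_if)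
  moreover have "\<alpha>0 = 0 \<or> \<alpha>0 = 1" "\<beta>0 = 0 \<or> \<beta>0 = 1" by (auto simp: \<alpha>0_def \<beta>0_def)
  ultimately have "pair_bracket m i j f g = bracket_hom m \<alpha>0 f i \<beta>0 g j"
    by (auto simp: pair_bracket_def)
  moreover have "(- 1) ^ ((\<alpha>0 + dpar m i) * (\<beta>0 + dpar m j)) = ((- 1) ^ (a * b) :: 'a)"
    by (rule minus_one_power_cong) (auto simp: \<alpha>0_def \<beta>0_def)
  ultimately show ?thesis
    by (simp add: coef_bracket_hom)
qed

text \<open>By \<open>act_xvar\<close> this is the supercommutator of the two operators evaluated at
  the k-th variable. It replaces the definition of the bracket from here on.\<close>

lemma coef_vbracket:
  assumes "D \<in> vpart m a" "E \<in> vpart m b"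
  shows "coef (vbracket m D E) k =
    act m D (coef E k) - oscale ((- 1) ^ (a * b)) (act m E (coef D k))"
proof -
  let ?s = "oscale ((- 1) ^ (a * b))"
  have "coef (vbracket m D E) k = (\<Sum>i\<in>supp D. \<Sum>j\<in>supp E.
      (if k = j then coef D i \<odot> osder m i (coef E j) else 0) -
      ?s (if k = i then coef E j \<odot> osder m j (coef D i) else 0))"
    by (simp add: vbracket_superset[of "supp D" "supp E"]
        coef_pair_bracket[OF vpartD[OF assms(1)] vpartD[OF assms(2)]])
  also have "\<dots> = (\<Sum>i\<in>supp D. if k \<in> supp E then coef D i \<odot> osder m i (coef E k) else 0) -
      ?s (\<Sum>j\<in>supp E. if k \<in> supp D then coef E j \<odot> osder m j (coef D k) else 0)"
  proof -
    have "(\<Sum>i\<in>supp D. \<Sum>j\<in>supp E. ?s (if k = i then coef E j \<odot> osder m j (coef D i) else 0)) =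
       (\<Sum>j\<in>supp E. \<Sum>i\<in>supp D. ?s (if k = i then coef E j \<odot> osder m j (coef D i) else 0))"
      by (rule sum.swap)
    then show ?thesis
      by (simp add: sum_subtractf osup.scale_sum_right if_distrib[of "oscale _"] cong: if_cong)
  qed
  also have "\<dots> = act m D (coef E k) - ?s (act m E (coef D k))"
    by (cases "k \<in> supp D"; cases "k \<in> supp E") (simp_all add: act_def in_keys_iff)
  finally show ?thesis .
qed

lemma fin_vfield_vbracket:
  assumes "D \<in> vpart m a" "E \<in> vpart m b" "D \<in> fin_vfield" "E \<in> fin_vfield"
  shows "vbracket m D E \<in> fin_vfield"
proof -
  have "coef (vbracket m D E) i \<in> fin_osup" for i
    unfolding coef_vbracket[OF assms(1,2)]
    by (intro fin_osup_lin fin_osup_act fin_vfieldD assms(3,4))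
  then show ?thesis unfolding fin_vfield_def by blast
qed

lemma vpart_vbracket:
  assumes "D \<in> vpart m a" "E \<in> vpart m b" "D \<in> fin_vfield" "E \<in> fin_vfield"
  shows "vbracket m D E \<in> vpart m (a + b)"
proof -
  have "act m D (coef E k) \<in> opart (a + b + dpar m k)"
    "act m E (coef D k) \<in> opart (a + b + dpar m k)" for k
    using opart_act[OF assms(1) vpartD[OF assms(2)], of k] opart_act[OF assms(2) vpartD[OF assms(1)], of k]
      assms(3,4) by (simp_all add: ac_simps)
  then show ?thesis
    unfolding vpart_iff coef_vbracket[OF assms(1,2)] by (intro allI opart_lin) auto
qed

text \<open>The first order terms of the two compositions form the bracket by
  \<open>coef_vbracket\<close>. The second order terms agree up to the sign of the supercommutator
  (\<open>swap\<close>) and cancel.\<close>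

lemma act_vbracket:
  fixes D E :: "'a::field vfield"
  assumes "D \<in> vpart m a" "E \<in> vpart m b" "D \<in> fin_vfield" "E \<in> fin_vfield" "g \<in> fin_osup"
  shows "act m (vbracket m D E) g =
    act m D (act m E g) - oscale ((- 1) ^ (a * b)) (act m E (act m D g))"
proof -
  have second_order: "act m D (act m E g) = (\<Sum>k\<in>supp E. act m D (coef E k) \<odot> osder m k g) +
      (\<Sum>k\<in>supp E. \<Sum>l\<in>supp D. oscale ((- 1) ^ (a * (b + dpar m k)))
        (coef E k \<odot> (coef D l \<odot> osder m l (osder m k g))))"
    if "D \<in> vpart m a" "E \<in> vpart m b" "D \<in> fin_vfield" "E \<in> fin_vfield"
    for D E :: "'a vfield" and a b
  proof -
    have "act m D (coef E k \<odot> osder m k g) = act m D (coef E k) \<odot> osder m k g +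
       oscale ((- 1) ^ (a * (b + dpar m k))) (coef E k \<odot> act m D (osder m k g))" for k
      using that assms(5) by (intro act_omult) (auto simp: vpart_iff)
    then show ?thesis
      unfolding act_def[of m E g]
      by (simp add: act_simps sum.distrib act_def[of m D "osder m _ g"] olinear_simps osup.scale_sum_right)
  qed
  have swap: "oscale ((- 1) ^ (a * (b + dpar m k))) (coef E k \<odot> (coef D l \<odot> osder m l (osder m k g))) =
     oscale ((- 1) ^ (a * b)) (oscale ((- 1) ^ (b * (a + dpar m l)))
       (coef D l \<odot> (coef E k \<odot> osder m k (osder m l g))))" for k l
  proof -
    have 1: "coef E k \<odot> coef D l =
        oscale ((- 1) ^ ((a + dpar m l) * (b + dpar m k))) (coef D l \<odot> coef E k)"
      using assms by (intro omult_commute) (auto simp: vpart_iff)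
    have 2: "osder m l (osder m k g) = oscale ((- 1) ^ (dpar m l * dpar m k)) (osder m k (osder m l g))"
      using assms by (intro osder_commute)
    have 3: "(- 1) ^ (a * (b + dpar m k)) * ((- 1) ^ (dpar m l * dpar m k) *
          (- 1) ^ ((a + dpar m l) * (b + dpar m k))) =
        ((- 1) ^ (a * b) * (- 1) ^ (b * (a + dpar m l)) :: 'a)"
      unfolding power_add[symmetric] by (intro minus_one_power_cong) auto
    have "coef E k \<odot> (coef D l \<odot> osder m l (osder m k g)) =
        coef E k \<odot> coef D l \<odot> osder m l (osder m k g)"
      using assms by (simp add: omult_assoc)
    also have "\<dots> = oscale ((- 1) ^ (dpar m l * dpar m k) * (- 1) ^ ((a + dpar m l) * (b + dpar m k)))
        (coef D l \<odot> coef E k \<odot> osder m k (osder m l g))"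
      by (simp only: 1 2 olinear_simps osup.scale_scale)
    also have "\<dots> = oscale ((- 1) ^ (dpar m l * dpar m k) * (- 1) ^ ((a + dpar m l) * (b + dpar m k)))
        (coef D l \<odot> (coef E k \<odot> osder m k (osder m l g)))"
      using assms by (simp add: omult_assoc)
    finally show ?thesis by (simp only: osup.scale_scale 3)
  qed
  have *: "supp (vbracket m D E) \<subseteq> supp D \<union> supp E"
    by (auto simp: in_keys_iff coef_vbracket[OF assms(1,2)])
  have "act m (vbracket m D E) g = (\<Sum>k\<in>supp D \<union> supp E. act m D (coef E k) \<odot> osder m k g) -
      oscale ((- 1) ^ (a * b)) (\<Sum>k\<in>supp D \<union> supp E. act m E (coef D k) \<odot> osder m k g)"
    by (simp add: act_superset[OF _ *] coef_vbracket[OF assms(1,2)] olinear_simps sum_subtractf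
        osup.scale_sum_right)
  also have "(\<Sum>k\<in>supp D \<union> supp E. act m D (coef E k) \<odot> osder m k g) =
      (\<Sum>k\<in>supp E. act m D (coef E k) \<odot> osder m k g)"
    by (rule sum.mono_neutral_right) (auto simp: in_keys_iff)
  also have "(\<Sum>k\<in>supp D \<union> supp E. act m E (coef D k) \<odot> osder m k g) =
      (\<Sum>k\<in>supp D. act m E (coef D k) \<odot> osder m k g)"
    by (rule sum.mono_neutral_right) (auto simp: in_keys_iff)
  finally have 1: "act m (vbracket m D E) g = (\<Sum>k\<in>supp E. act m D (coef E k) \<odot> osder m k g) -
      oscale ((- 1) ^ (a * b)) (\<Sum>k\<in>supp D. act m E (coef D k) \<odot> osder m k g)" .
  have "(\<Sum>k\<in>supp E. \<Sum>l\<in>supp D. oscale ((- 1) ^ (a * (b + dpar m k)))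
        (coef E k \<odot> (coef D l \<odot> osder m l (osder m k g)))) =
      oscale ((- 1) ^ (a * b)) (\<Sum>l\<in>supp D. \<Sum>k\<in>supp E. oscale ((- 1) ^ (b * (a + dpar m l)))
       (coef D l \<odot> (coef E k \<odot> osder m k (osder m l g))))"
    unfolding swap osup.scale_sum_right by (rule sum.swap)
  then show ?thesis
    unfolding 1 second_order[OF assms(1-4)] second_order[OF assms(2,1,4,3)]
    by (simp add: osup.scale_right_distrib)
qed

lemma vbracket_skew:
  fixes D E :: "'a::field vfield"
  assumes "D \<in> vpart m a" "E \<in> vpart m b"
  shows "vbracket m D E = - vscale ((- 1) ^ (a * b)) (vbracket m E D)"
proof (rule poly_mapping_eqI)
  fix k
  have "(- 1) ^ (a * b) * (- 1) ^ (b * a) = (1 :: 'a)"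
    by (simp add: mult.commute[of b a] flip: power_add)
  then show "coef (vbracket m D E) k = coef (- vscale ((- 1) ^ (a * b)) (vbracket m E D)) k"
    by (simp add: coef_vbracket[OF assms] coef_vbracket[OF assms(2,1)] osup.scale_right_diff_distrib)
qed

text \<open>By \<open>act_vbracket\<close> each coefficient of either side becomes a combination of
  twofold actions on coefficients of X, Y and Z; comparing signs is all that remains.\<close>

lemma vbracket_jacobi:
  fixes X Y Z :: "'a::field vfield"
  assumes "X \<in> vpart m a" "Y \<in> vpart m b" "Z \<in> vpart m c"
    and "X \<in> fin_vfield" "Y \<in> fin_vfield" "Z \<in> fin_vfield"
  shows "vbracket m X (vbracket m Y Z) =
    vbracket m (vbracket m X Y) Z + vscale ((- 1) ^ (a * b)) (vbracket m Y (vbracket m X Z))"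
proof (rule poly_mapping_eqI)
  fix k
  note YZ = vpart_vbracket[OF assms(2,3,5,6)] and XY = vpart_vbracket[OF assms(1,2,4,5)]
    and XZ = vpart_vbracket[OF assms(1,3,4,6)]
  show "coef (vbracket m X (vbracket m Y Z)) k =
    coef (vbracket m (vbracket m X Y) Z + vscale ((- 1) ^ (a * b)) (vbracket m Y (vbracket m X Z))) k"
    using assms
    by (simp add: coef_vbracket[OF assms(1) YZ] coef_vbracket[OF XY assms(3)] coef_vbracket[OF assms(2) XZ]
        coef_vbracket[OF assms(1,2)] coef_vbracket[OF assms(2,3)] coef_vbracket[OF assms(1,3)]
        act_vbracket[OF assms(1,2)] act_vbracket[OF assms(2,3)] act_vbracket[OF assms(1,3)]
        lookup_add act_simps osup.scale_right_distrib osup.scale_right_diff_distrib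
        minus_one_power_iff algebra_simps)
qed

subsection \<open>The contact bracket\<close>

locale contact_indices =
  fixes m n r t :: nat
  assumes m_eq: "m = 2 * r + 1" and n_eq: "n = 2 * t"
begin

definition J :: "nat set" where "J = {1..m+n} - {m}"

abbreviation (input) cj :: "nat \<Rightarrow> nat" where "cj \<equiv> conj_ix m n"

lemma in_J_iff: "i \<in> J \<longleftrightarrow> 1 \<le> i \<and> i \<le> m + n \<and> i \<noteq> m"
  by (auto simp: J_def)

lemma finite_J [simp]: "finite J"
  by (simp add: J_def)

lemma m_notin_J [simp]: "m \<notin> J"
  by (simp add: J_def)

lemma J_neq_m: "i \<in> J \<Longrightarrow> i \<noteq> m"
  by (simp add: J_def)

lemma indices_eq: "{1..m+n} = insert m J"
  unfolding J_def using m_eq by auto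

lemma conj_in_J [simp]: "i \<in> J \<Longrightarrow> cj i \<in> J"
  unfolding in_J_iff conj_ix_def Let_def using m_eq n_eq by auto

lemma conj_conj [simp]: "i \<in> J \<Longrightarrow> cj (cj i) = i"
  unfolding in_J_iff conj_ix_def Let_def using m_eq n_eq by auto

lemma dpar_conj [simp]: "i \<in> J \<Longrightarrow> dpar m (cj i) = dpar m i"
  unfolding in_J_iff conj_ix_def Let_def dpar_def using m_eq n_eq by auto

lemma dpar_m [simp]: "dpar m m = 0"
  by (simp add: dpar_def)

lemma sig_square [simp]: "sig m i * sig m i = (1 :: 'a::field)"
  by (simp add: sig_def Let_def)

text \<open>The underlying bilinear form on the variables is skew on even and symmetric on odd
  indices: conjugation swaps the signs 1 and -1 on the two even halves and keeps the sign 1 on odd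
  indices.\<close>

lemma sig_conj: "i \<in> J \<Longrightarrow> sig m (cj i) = (- ((- 1) ^ dpar m i * sig m i) :: 'a::field)"
  unfolding in_J_iff conj_ix_def Let_def dpar_def sig_def using m_eq n_eq by auto

lemma sum_conj: "(\<Sum>j\<in>J. F (cj j)) = (\<Sum>j\<in>J. F j)"
  by (rule sum.reindex_bij_witness[of _ cj cj]) auto

text \<open>\<open>theta\<close> is the contact form; the fields \<open>hfield i\<close> span its kernel over
  \<open>O(m,n)\<close>.\<close>

definition theta :: "'a::field vfield \<Rightarrow> 'a osup" where
  "theta D = coef D m - (\<Sum>j\<in>J. oscale (sig m j) (coef D j \<odot> xvar m (cj j)))"

text \<open>The action of \<open>hfield i\<close> on functions, see \<open>act_hfield\<close>. Up to
  signs these derivatives are the coefficients of a contact field, see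
  \<open>coef_DK_conj\<close>.\<close>

definition hder :: "nat \<Rightarrow> 'a::field osup \<Rightarrow> 'a osup" where
  "hder i g = osder m i g + oscale (sig m i) (xvar m (cj i) \<odot> osder m m g)"

definition hfield :: "nat \<Rightarrow> 'a::field vfield" where
  "hfield i = Poly_Mapping.single i (xmon 0 {}) +
     Poly_Mapping.single m (oscale (sig m i) (xvar m (cj i)))"

lemma theta_diff: "theta (D - E) = theta D - theta E"
  by (simp add: theta_def lookup_minus olinear_simps osup.scale_right_diff_distrib sum_subtractf)

lemma theta_vscale: "theta (vscale c D) = oscale c (theta D)"
  by (simp add: theta_def olinear_simps osup.scale_right_diff_distrib osup.scale_sum_right mult.commute)

lemma fin_osup_theta [simp]: "D \<in> fin_vfield \<Longrightarrow> theta D \<in> fin_osup"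
  by (simp add: theta_def)

lemma opart_theta:
  fixes D :: "'a::field vfield"
  assumes "D \<in> vpart m a" "D \<in> fin_vfield"
  shows "theta D \<in> opart a"
proof -
  have "coef D j \<odot> xvar m (cj j) \<in> opart a" if "j \<in> J" for j
  proof -
    have "coef D j \<odot> xvar m (cj j) \<in> opart ((a + dpar m j) + dpar m (cj j))"
      using assms by (intro opart_omult opart_xvar vpartD) auto
    moreover have "opart ((a + dpar m j) + dpar m (cj j)) = (opart a :: 'a osup set)"
      using that by (intro opart_cong) auto
    ultimately show ?thesis by simp
  qed
  moreover have "coef D m \<in> opart a" using vpartD[OF assms(1), of m] by simp
  ultimately show ?thesis unfolding theta_def by (intro opart_lin)
qed

lemma fin_osup_hder [simp]: "g \<in> fin_osup \<Longrightarrow> hder i g \<in> fin_osup"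
  by (simp add: hder_def)

lemma hder_oscale: "hder i (oscale c g) = oscale c (hder i g)"
  by (simp add: hder_def olinear_simps osup.scale_right_distrib mult.commute)

lemma coef_hfield:
  "i \<in> J \<Longrightarrow> coef (hfield i) k =
     (if k = i then xmon 0 {} else if k = m then oscale (sig m i) (xvar m (cj i)) else 0)"
  using J_neq_m[of i] by (auto simp: hfield_def lookup_add lookup_single when_def)

lemma opart_hder:
  assumes "g \<in> opart a" "g \<in> fin_osup" "i \<in> J"
  shows "hder i g \<in> opart (a + dpar m i)"
proof -
  have "xvar m (cj i) \<odot> osder m m g \<in> opart (dpar m (cj i) + (a + dpar m m))"
    using assms by (intro opart_omult opart_xvar opart_osder) auto
  then show ?thesis
    unfolding hder_def using assms by (intro opart_lin opart_osder) (auto simp: add.commute)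
qed

lemma act_hfield:
  assumes "i \<in> J"
  shows "act m (hfield i) g = hder i g"
proof -
  have "supp (hfield i) \<subseteq> {i, m}" "i \<noteq> m"
    using assms by (auto simp: in_keys_iff coef_hfield split: if_splits)
  then show ?thesis
    using assms by (subst act_superset[of "{i, m}"]) (auto simp: coef_hfield hder_def olinear_simps)
qed

lemma hfield_vpart:
  assumes "i \<in> J"
  shows "(hfield i :: 'a::field vfield) \<in> vpart m (dpar m i)"
proof -
  have "opart (dpar m i + dpar m i) = (opart 0 :: 'a osup set)" by (intro opart_cong) simp
  then show ?thesis
    using assms opart_oone opart_xvar[of m "cj i"]
    by (auto simp: vpart_iff coef_hfield intro: opart_lin)
qed

lemma hfield_fin: "i \<in> J \<Longrightarrow> hfield i \<in> fin_vfield"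
  unfolding fin_vfield_def by (auto simp: coef_hfield)

lemma theta_hfield:
  assumes "i \<in> J"
  shows "theta (hfield i :: 'a::field vfield) = 0"
proof -
  have "i \<noteq> m" using assms by auto
  have "(\<Sum>j\<in>J. oscale (sig m j) (coef (hfield i :: 'a vfield) j \<odot> xvar m (cj j))) =
      (\<Sum>j\<in>J. if j = i then oscale (sig m i) (xvar m (cj i)) else 0)"
    using assms by (intro sum.cong) (auto simp: coef_hfield)
  then show ?thesis
    unfolding theta_def using assms \<open>i \<noteq> m\<close> by (simp only:) (simp add: coef_hfield)
qed

text \<open>Makes the coefficients of X visible to \<open>theta\<close>: if the bracket with
  \<open>hfield i\<close> stays in the kernel of \<open>theta\<close>, then \<open>theta X\<close>
  determines them. One half of the factor 2 comes from X acting on the coefficient of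
  \<open>hfield i\<close> at \<open>m\<close>, the other from the Leibniz rule for
  \<open>hder i (theta X)\<close>.\<close>

lemma theta_vbracket_hfield:
  fixes X :: "'a::field vfield"
  assumes "X \<in> vpart m a" "X \<in> fin_vfield" "i \<in> J"
  shows "theta (vbracket m X (hfield i)) =
    oscale (2 * sig m i) (coef X (cj i)) - oscale ((- 1) ^ (a * dpar m i)) (hder i (theta X))"
proof -
  let ?Y = "hfield i :: 'a vfield"
  let ?s = "(- 1) ^ (a * dpar m i) :: 'a"
  note Y = hfield_vpart[OF assms(3)] hfield_fin[OF assms(3)]
  have Z: "coef (vbracket m X ?Y) k = act m X (coef ?Y k) - oscale ?s (hder i (coef X k))" for k
    by (simp add: coef_vbracket[OF assms(1) Y(1)] act_hfield assms(3))
  have m: "coef (vbracket m X ?Y) m =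
      oscale (sig m i) (coef X (cj i)) - oscale ?s (hder i (coef X m))"
    using assms(3) J_neq_m[OF assms(3)] by (simp add: Z coef_hfield act_simps act_xvar)
  have j: "coef (vbracket m X ?Y) j = - oscale ?s (hder i (coef X j))" if "j \<in> J" for j
    using assms(3) J_neq_m[OF that] by (simp add: Z coef_hfield)
  have "hder i (coef X j \<odot> xvar m (cj j)) = hder i (coef X j) \<odot> xvar m (cj j) +
      (if j = cj i then oscale ((- 1) ^ (dpar m i * (a + dpar m i))) (coef X (cj i)) else 0)"
    if "j \<in> J" for j
  proof -
    have "j = cj i \<longleftrightarrow> cj j = i" using that assms(3) by auto
    moreover have "cj j \<noteq> m" using conj_in_J[OF that] by auto
    ultimately show ?thesis
      using act_omult[OF Y(1) vpartD[OF assms(1), of j] Y(2) fin_vfieldD[OF assms(2)] fin_osup_xvar, of m "cj j"]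
        that assms(3)
      by (auto simp: act_hfield act_xvar[of m ?Y, unfolded act_hfield[OF assms(3)]] coef_hfield)
  qed
  moreover have "hder i (theta X) = hder i (coef X m) -
      (\<Sum>j\<in>J. oscale (sig m j) (hder i (coef X j \<odot> xvar m (cj j))))"
    unfolding act_hfield[OF assms(3), symmetric] theta_def by (simp add: act_simps)
  ultimately have "hder i (theta X) = hder i (coef X m) -
      (\<Sum>j\<in>J. oscale (sig m j) (hder i (coef X j) \<odot> xvar m (cj j)) +
        (if j = cj i then oscale (sig m j * (- 1) ^ (dpar m i * (a + dpar m i))) (coef X (cj i)) else 0))"
    by (simp add: osup.scale_right_distrib if_distrib[of "oscale _"] cong: if_cong)
  then have 1: "hder i (theta X) = hder i (coef X m) -
      (\<Sum>j\<in>J. oscale (sig m j) (hder i (coef X j) \<odot> xvar m (cj j))) -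
      oscale (sig m (cj i) * (- 1) ^ (dpar m i * (a + dpar m i))) (coef X (cj i))"
    using assms(3) by (simp add: sum.distrib)
  have "?s * (sig m (cj i) * (- 1) ^ (dpar m i * (a + dpar m i))) = - sig m i"
    by (simp add: sig_conj assms(3) minus_one_power_iff)
  with 1 have "oscale ?s (hder i (theta X)) = oscale ?s (hder i (coef X m)) -
      (\<Sum>j\<in>J. oscale (sig m j) (oscale ?s (hder i (coef X j)) \<odot> xvar m (cj j))) +
      oscale (sig m i) (coef X (cj i))"
    by (simp add: osup.scale_right_diff_distrib olinear_simps osup.scale_sum_right mult.commute)
  moreover have "theta (vbracket m X ?Y) =
      oscale (sig m i) (coef X (cj i)) - oscale ?s (hder i (coef X m)) +
      (\<Sum>j\<in>J. oscale (sig m j) (oscale ?s (hder i (coef X j)) \<odot> xvar m (cj j)))"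
    by (simp add: theta_def m j olinear_simps sum_negf)
  moreover have "oscale (2 * sig m i) (coef X (cj i)) =
      oscale (sig m i) (coef X (cj i)) + oscale (sig m i) (coef X (cj i))"
    by (simp flip: osup.scale_left_distrib)
  ultimately show ?thesis by simp
qed

section \<open>Contact fields, their generating functions and their brackets\<close>

lemma coef_DK:
  assumes "f \<in> opart a"
  shows "coef (DK m n f) i = (if i \<in> J then oscale ((- 1) ^ (dpar m i * a))
      (xvar m i \<odot> osder m m f + oscale (sig m (cj i)) (osder m (cj i) f))
    else if i = m then oscale 2 f - (\<Sum>j\<in>J. xvar m j \<odot> osder m j f) else 0)"
proof -
  have hom: "coef (DK_hom m n \<gamma> f) i = (if i \<in> J then oscale ((- 1) ^ (dpar m i * \<gamma>))
      (xvar m i \<odot> osder m m f + oscale (sig m (cj i)) (osder m (cj i) f))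
    else if i = m then oscale 2 f - (\<Sum>j\<in>J. xvar m j \<odot> osder m j f) else 0)"
    for \<gamma> and f :: "'a osup"
    unfolding DK_hom_def J_def[symmetric] by (auto simp: lookup_add lookup_single when_def)
  have "(- 1) ^ (dpar m i * (if even a then 0 else 1)) = ((- 1) ^ (dpar m i * a) :: 'a)"
    by (rule minus_one_power_cong) auto
  then show ?thesis
    by (cases "even a") (auto simp: DK_def hom lookup_add oproj_eq[OF assms])
qed

lemma coef_DK_conj:
  assumes "f \<in> opart a" "i \<in> J"
  shows "coef (DK m n f) (cj i) = oscale ((- 1) ^ (a * dpar m i) * sig m i) (hder i f)"
  using assms by (simp add: coef_DK[OF assms(1)] hder_def osup.scale_right_distrib mult.assoc mult.commute[of _ a]
      add.commute)

lemma supp_DK: "f \<in> opart a \<Longrightarrow> supp (DK m n f) \<subseteq> {1..m+n}"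
  unfolding indices_eq by (auto simp: in_keys_iff coef_DK split: if_splits)

lemma DK_add: "DK m n (f + g) = DK m n f + DK m n g"
  by (rule poly_mapping_eqI)
    (simp add: DK_def DK_hom_def oproj_add lookup_add lookup_single when_def
      olinear_simps osup.scale_right_distrib sum.distrib)

lemma DK_oscale: "DK m n (oscale c f) = vscale c (DK m n f)"
  by (rule poly_mapping_eqI)
    (simp add: DK_def DK_hom_def oproj_oscale lookup_add lookup_single when_def
      olinear_simps osup.scale_right_distrib osup.scale_right_diff_distrib osup.scale_sum_right mult.commute)

lemma DK_fin:
  assumes "f \<in> opart a" "f \<in> fin_osup"
  shows "DK m n f \<in> fin_vfield"
  unfolding fin_vfield_def using assms(2) by (auto simp: coef_DK[OF assms(1)])

lemma DK_vpart:
  fixes f :: "'a::field osup"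
  assumes "f \<in> opart a" "f \<in> fin_osup"
  shows "DK m n f \<in> vpart m a"
proof -
  have "coef (DK m n f) i \<in> opart (a + dpar m i)" for i
  proof -
    have J: "coef (DK m n f) i \<in> opart (a + dpar m i)" if "i \<in> J"
      using coef_DK_conj[OF assms(1), of "cj i"] opart_hder[OF assms, of "cj i"] that
      by (simp add: opart_lin)
    have "opart (dpar m j + (a + dpar m j)) = (opart a :: 'a osup set)" for j
      by (intro opart_cong) auto
    then have "xvar m j \<odot> osder m j f \<in> opart a" for j
      using opart_omult[OF opart_xvar opart_osder[OF assms], of m j m j] assms(2) by simp
    then have "coef (DK m n f) m \<in> opart a"
      using assms(1) by (simp add: coef_DK[OF assms(1)] opart_lin)
    with J show ?thesis by (cases "i = m") (auto simp: coef_DK[OF assms(1)] opart_lin(1))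
  qed
  then show ?thesis by (simp add: vpart_iff)
qed

text \<open>Conjugation permutes the summands and, by supercommutativity and
  \<open>sig_conj\<close>, changes their signs; so the sum equals its own negative.\<close>

lemma sum_sig_xvar_xvar:
  assumes "(2 :: 'a::field) \<noteq> 0"
  shows "(\<Sum>j\<in>J. oscale (sig m j) (xvar m j \<odot> xvar m (cj j))) = (0 :: 'a osup)"
proof -
  let ?S = "\<Sum>j\<in>J. oscale (sig m j) (xvar m j \<odot> xvar m (cj j)) :: 'a osup"
  have "?S = (\<Sum>j\<in>J. oscale (sig m (cj j)) (xvar m (cj j) \<odot> xvar m (cj (cj j))))"
    by (rule sum_conj[symmetric, of "\<lambda>j. oscale (sig m j) (xvar m j \<odot> xvar m (cj j)) :: 'a osup"])
  also have "\<dots> = (\<Sum>j\<in>J. - oscale (sig m j) (xvar m j \<odot> xvar m (cj j)))"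
  proof (rule sum.cong)
    fix j assume j: "j \<in> J"
    have "xvar m (cj j) \<odot> xvar m j =
        oscale ((- 1) ^ (dpar m j * dpar m (cj j))) (xvar m j \<odot> xvar m (cj j) :: 'a osup)"
      by (intro omult_commute opart_xvar fin_osup_xvar)
    then show "oscale (sig m (cj j)) (xvar m (cj j) \<odot> xvar m (cj (cj j))) =
        - oscale (sig m j) (xvar m j \<odot> xvar m (cj j) :: 'a osup)"
      using j by (simp add: sig_conj minus_one_power_iff)
  qed simp
  also have "\<dots> = - ?S" by (rule sum_negf)
  finally have "oscale 2 ?S = 0"
    using osup.scale_left_distrib[of 1 1 ?S] by (simp add: eq_neg_iff_add_eq_0)
  with assms show ?thesis by simp
qed

text \<open>Recovers the generating function from its field, which makes D_K injective on
  homogeneous functions. The sum in \<open>theta\<close> cancels the terms x_j \<partial>_j f of the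
  coefficient at \<open>m\<close>; what is left with \<partial>_m f vanishes by
  \<open>sum_sig_xvar_xvar\<close>.\<close>

lemma theta_DK:
  fixes f :: "'a::field osup"
  assumes "f \<in> opart a" "f \<in> fin_osup" "(2 :: 'a) \<noteq> 0"
  shows "theta (DK m n f) = oscale 2 f"
proof -
  have "(\<Sum>j\<in>J. oscale (sig m j) (coef (DK m n f) j \<odot> xvar m (cj j))) =
      (\<Sum>j\<in>J. oscale (sig m (cj j)) (coef (DK m n f) (cj j) \<odot> xvar m (cj (cj j))))"
    by (rule sum_conj[symmetric, of "\<lambda>j. oscale (sig m j) (coef (DK m n f) j \<odot> xvar m (cj j))"])
  also have "\<dots> = (\<Sum>j\<in>J. - (xvar m j \<odot> hder j f))"
  proof (rule sum.cong)
    fix j assume j: "j \<in> J"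
    have "hder j f \<odot> xvar m j = oscale ((- 1) ^ (dpar m j * (a + dpar m j))) (xvar m j \<odot> hder j f)"
      using assms j by (intro omult_commute opart_xvar opart_hder) auto
    then show "oscale (sig m (cj j)) (coef (DK m n f) (cj j) \<odot> xvar m (cj (cj j))) = - (xvar m j \<odot> hder j f)"
      using j assms by (simp add: coef_DK_conj sig_conj olinear_simps minus_one_power_iff)
  qed simp
  also have "\<dots> = - (\<Sum>j\<in>J. xvar m j \<odot> osder m j f) -
      (\<Sum>j\<in>J. oscale (sig m j) (xvar m j \<odot> xvar m (cj j))) \<odot> osder m m f"
    using assms by (simp add: hder_def olinear_simps sum_subtractf sum_negf omult_assoc)
  finally show ?thesis
    using assms by (simp add: theta_def coef_DK[OF assms(1)] sum_sig_xvar_xvar)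
qed

text \<open>Recognises a contact field: once the coefficients on \<open>J\<close> are known,
  \<open>theta\<close> fixes the one at \<open>m\<close>.\<close>

lemma eq_DKI:
  fixes X :: "'a::field vfield"
  assumes "f \<in> opart a" "f \<in> fin_osup" "(2 :: 'a) \<noteq> 0" "supp X \<subseteq> {1..m+n}"
    and "theta X = oscale 2 f"
    and "\<And>i. i \<in> J \<Longrightarrow> coef X (cj i) = oscale ((- 1) ^ (a * dpar m i) * sig m i) (hder i f)"
  shows "X = DK m n f"
proof (rule poly_mapping_eqI)
  fix k
  have J: "coef X j = coef (DK m n f) j" if "j \<in> J" for j
    using assms(6)[of "cj j"] coef_DK_conj[OF assms(1), of "cj j"] that by simp
  have "coef D m = theta D + (\<Sum>j\<in>J. oscale (sig m j) (coef D j \<odot> xvar m (cj j)))"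
    for D :: "'a vfield"
    by (simp add: theta_def)
  from this[of X] this[of "DK m n f"] have "coef X m = coef (DK m n f) m"
    using theta_DK[OF assms(1-3)] assms(5) J by simp
  moreover have "coef X j = 0" if "j \<notin> insert m J" for j
    using assms(4) that unfolding indices_eq by (auto simp: in_keys_iff)
  ultimately show "coef X k = coef (DK m n f) k"
    using J by (cases "k \<in> insert m J") (auto simp: coef_DK[OF assms(1)])
qed

text \<open>Expansion of V in the frame formed by the \<open>hfield j\<close> and \<partial>_m; in
  this frame the coefficient of \<partial>_m is \<open>theta V\<close>.\<close>

lemma act_split:
  assumes "V \<in> fin_vfield" "f \<in> fin_osup" "supp V \<subseteq> {1..m+n}"
  shows "act m V f = (\<Sum>j\<in>J. coef V j \<odot> hder j f) + theta V \<odot> osder m m f"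
proof -
  have "act m V f = (\<Sum>j\<in>J. coef V j \<odot> osder m j f) + coef V m \<odot> osder m m f"
    using assms(3) unfolding indices_eq by (subst act_superset[of "insert m J"]) (simp_all add: add.commute)
  then show ?thesis
    using assms by (simp add: theta_def hder_def olinear_simps sum.distrib omult_assoc)
qed

text \<open>The Lie derivative of the contact form \<open>theta\<close> along \<open>DK f\<close> is
  \<open>2 \<partial>\<^sub>m(f) theta\<close>.\<close>

lemma theta_vbracket_DK:
  fixes f :: "'a::field osup"
  assumes f: "f \<in> opart a" "f \<in> fin_osup" and two: "(2 :: 'a) \<noteq> 0"
    and V: "V \<in> vpart m b" "V \<in> fin_vfield" "supp V \<subseteq> {1..m+n}"
  shows "theta (vbracket m (DK m n f) V) =
    act m (DK m n f) (theta V) - oscale 2 (osder m m f \<odot> theta V)"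
proof -
  let ?X = "DK m n f"
  let ?e = "(- 1) ^ (a * b) :: 'a"
  note X = DK_vpart[OF f] DK_fin[OF f]
  have 1: "act m ?X (theta V) = act m ?X (coef V m) -
      (\<Sum>j\<in>J. oscale (sig m j) (act m ?X (coef V j) \<odot> xvar m (cj j))) -
      (\<Sum>j\<in>J. oscale (sig m j * (- 1) ^ (a * (b + dpar m j))) (coef V j \<odot> coef ?X (cj j)))"
    using X V
    by (simp add: theta_def act_simps act_omult[OF X(1) vpartD[OF V(1)]] act_xvar
        osup.scale_right_distrib sum.distrib)
  \<comment> \<open>Here 2 f is replaced by the value of \<open>theta\<close> on the contact field
    before V is applied, which brings in the same kind of terms as in 1.\<close>
  have 2: "oscale 2 (act m V f) = act m V (coef ?X m) -
      (\<Sum>j\<in>J. oscale (sig m j) (act m V (coef ?X j) \<odot> xvar m (cj j))) -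
      (\<Sum>j\<in>J. oscale (sig m j * (- 1) ^ (b * (a + dpar m j))) (coef ?X j \<odot> coef V (cj j)))"
    using X V unfolding act.scale[symmetric] theta_DK[OF f two, symmetric]
    by (simp add: theta_def act_simps act_omult[OF V(1) vpartD[OF X(1)]] act_xvar
        osup.scale_right_distrib sum.distrib)
  have 3: "theta (vbracket m ?X V) = act m ?X (coef V m) - oscale ?e (act m V (coef ?X m)) -
      (\<Sum>j\<in>J. oscale (sig m j) (act m ?X (coef V j) \<odot> xvar m (cj j))) +
      oscale ?e (\<Sum>j\<in>J. oscale (sig m j) (act m V (coef ?X j) \<odot> xvar m (cj j)))"
    by (simp add: theta_def coef_vbracket[OF X(1) V(1)] olinear_simps osup.scale_right_diff_distrib
        sum_subtractf osup.scale_sum_right mult.commute)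
  \<comment> \<open>The mixed sums of 1 and 2 both reduce, up to sign, to the horizontal part of
    \<open>act m V f\<close>, which \<open>act_split\<close> evaluates.\<close>
  have "(\<Sum>j\<in>J. oscale (sig m j * (- 1) ^ (b * (a + dpar m j))) (coef ?X j \<odot> coef V (cj j))) =
      (\<Sum>j\<in>J. oscale (sig m (cj j) * (- 1) ^ (b * (a + dpar m (cj j)))) (coef ?X (cj j) \<odot> coef V (cj (cj j))))"
    by (rule sum_conj[symmetric, of "\<lambda>j. oscale (sig m j * (- 1) ^ (b * (a + dpar m j))) (coef ?X j \<odot> coef V (cj j))"])
  also have "\<dots> = (\<Sum>j\<in>J. - (coef V j \<odot> hder j f))"
  proof (rule sum.cong)
    fix j assume j: "j \<in> J"
    have "coef ?X (cj j) \<odot> coef V j =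
        oscale ((- 1) ^ ((b + dpar m j) * (a + dpar m j))) (coef V j \<odot> coef ?X (cj j))"
      using omult_commute[OF vpartD[OF V(1), of j] vpartD[OF X(1), of "cj j"]] X V j by simp
    then show "oscale (sig m (cj j) * (- 1) ^ (b * (a + dpar m (cj j)))) (coef ?X (cj j) \<odot> coef V (cj (cj j))) =
        - (coef V j \<odot> hder j f)"
      using j by (auto simp: coef_DK_conj[OF f(1)] sig_conj olinear_simps minus_one_power_iff)
  qed simp
  finally have 4: "(\<Sum>j\<in>J. oscale (sig m j * (- 1) ^ (b * (a + dpar m j))) (coef ?X j \<odot> coef V (cj j))) =
      - (\<Sum>j\<in>J. coef V j \<odot> hder j f)"
    by (simp add: sum_negf)
  have 5: "(\<Sum>j\<in>J. oscale (sig m j * (- 1) ^ (a * (b + dpar m j))) (coef V j \<odot> coef ?X (cj j))) =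
      oscale ?e (\<Sum>j\<in>J. coef V j \<odot> hder j f)"
    unfolding osup.scale_sum_right
    by (rule sum.cong) (simp_all add: coef_DK_conj[OF f(1)] olinear_simps minus_one_power_iff)
  have 6: "theta V \<odot> osder m m f = oscale ?e (osder m m f \<odot> theta V)"
    using omult_commute[OF opart_osder[OF f, of m m] opart_theta[OF V(1,2)]] f V by simp
  have dbl: "oscale 2 g = g + g" for g :: "'a osup"
    using osup.scale_left_distrib[of 1 1 g] by simp
  have ee: "?e * ?e = 1" by (simp flip: power_add)
  have S: "(\<Sum>j\<in>J. coef V j \<odot> hder j f) = act m V f - oscale ?e (osder m m f \<odot> theta V)"
    using act_split[OF V(2) f(2) V(3)] by (simp add: 6)
  have "act m V (coef ?X m) = act m V f + act m V f +
      (\<Sum>j\<in>J. oscale (sig m j) (act m V (coef ?X j) \<odot> xvar m (cj j))) -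
      (act m V f - oscale ?e (osder m m f \<odot> theta V))"
    using 2 unfolding 4 S dbl by (simp add: algebra_simps)
  moreover have "act m ?X (coef V m) = act m ?X (theta V) +
      (\<Sum>j\<in>J. oscale (sig m j) (act m ?X (coef V j) \<odot> xvar m (cj j))) +
      oscale ?e (act m V f - oscale ?e (osder m m f \<odot> theta V))"
    using 1 unfolding 5 S by (simp add: algebra_simps)
  ultimately show ?thesis
    unfolding 3 dbl by (simp add: osup.scale_right_distrib osup.scale_right_diff_distrib ee algebra_simps)
qed

text \<open>The contact bracket of generating functions. The formula is half of \<open>theta\<close>
  applied to the bracket of the two fields, by \<open>theta_vbracket_DK\<close> and
  \<open>theta_DK\<close>.\<close>

definition cbracket :: "'a::field osup \<Rightarrow> 'a osup \<Rightarrow> 'a osup" where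
  "cbracket f g = act m (DK m n f) g - oscale 2 (osder m m f \<odot> g)"

lemma cbracket_opart:
  assumes "f \<in> opart a" "f \<in> fin_osup" "g \<in> opart b" "g \<in> fin_osup"
  shows "cbracket f g \<in> opart (a + b)"
  unfolding cbracket_def
  using assms opart_act[OF DK_vpart[OF assms(1,2)] assms(3) DK_fin[OF assms(1,2)] assms(4)]
    opart_omult[OF opart_osder[OF assms(1,2), of m m] assms(3)]
  by (simp add: opart_lin)

lemma cbracket_fin:
  assumes "f \<in> opart a" "f \<in> fin_osup" "g \<in> fin_osup"
  shows "cbracket f g \<in> fin_osup"
  using assms DK_fin[OF assms(1,2)] by (simp add: cbracket_def)

lemma supp_vbracket:
  assumes "D \<in> vpart m a" "E \<in> vpart m b"
  shows "supp (vbracket m D E) \<subseteq> supp D \<union> supp E"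
  by (auto simp: in_keys_iff coef_vbracket[OF assms])

text \<open>Contact fields map the kernel of \<open>theta\<close> into itself (\<open>kill\<close>),
  hence by the Jacobi identity so does their bracket Z. Applied to the bracket of Z with
  \<open>hfield i\<close>, \<open>theta_vbracket_hfield\<close> then yields the coefficients of Z
  demanded by \<open>eq_DKI\<close>.\<close>

lemma vbracket_DK:
  fixes f g :: "'a::field osup"
  assumes f: "f \<in> opart a" "f \<in> fin_osup" and g: "g \<in> opart b" "g \<in> fin_osup"
    and two: "(2 :: 'a) \<noteq> 0"
  shows "vbracket m (DK m n f) (DK m n g) = DK m n (cbracket f g)"
proof (rule eq_DKI)
  let ?X = "DK m n f" and ?X' = "DK m n g"
  let ?Z = "vbracket m ?X ?X'"
  note X = DK_vpart[OF f] DK_fin[OF f] supp_DK[OF f(1)]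
    and X' = DK_vpart[OF g] DK_fin[OF g] supp_DK[OF g(1)]
  show "cbracket f g \<in> opart (a + b)" "cbracket f g \<in> fin_osup" "(2 :: 'a) \<noteq> 0"
    using cbracket_opart[OF f g] cbracket_fin[OF f g(2)] two by auto
  show "supp ?Z \<subseteq> {1..m+n}"
    using supp_vbracket[OF X(1) X'(1)] X(3) X'(3) by blast
  show theta_Z: "theta ?Z = oscale 2 (cbracket f g)"
    using theta_vbracket_DK[OF f two X'] theta_DK[OF g two]
    by (simp add: cbracket_def act_simps olinear_simps osup.scale_right_diff_distrib)
  fix i assume i: "i \<in> J"
  let ?Y = "hfield i :: 'a vfield"
  have supp_Y: "supp ?Y \<subseteq> {1..m+n}"
    unfolding indices_eq using i by (auto simp: in_keys_iff coef_hfield split: if_splits)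
  note Y = hfield_vpart[OF i] hfield_fin[OF i]
  have kill: "theta (vbracket m (DK m n h) V) = 0" if "h \<in> opart c" "h \<in> fin_osup"
    "V \<in> vpart m d" "V \<in> fin_vfield" "supp V \<subseteq> {1..m+n}" "theta V = 0" for h :: "'a osup" and V c d
    using theta_vbracket_DK[OF that(1,2) two that(3-5)] that(6) by simp
  have XY: "vbracket m ?X ?Y \<in> vpart m (a + dpar m i)" "vbracket m ?X ?Y \<in> fin_vfield"
    "supp (vbracket m ?X ?Y) \<subseteq> {1..m+n}" "theta (vbracket m ?X ?Y) = 0"
    using vpart_vbracket[OF X(1) Y(1) X(2) Y(2)] fin_vfield_vbracket[OF X(1) Y(1) X(2) Y(2)]
      supp_vbracket[OF X(1) Y(1)] X(3) supp_Y kill[OF f Y supp_Y theta_hfield[OF i]] by blast+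
  have X'Y: "vbracket m ?X' ?Y \<in> vpart m (b + dpar m i)" "vbracket m ?X' ?Y \<in> fin_vfield"
    "supp (vbracket m ?X' ?Y) \<subseteq> {1..m+n}" "theta (vbracket m ?X' ?Y) = 0"
    using vpart_vbracket[OF X'(1) Y(1) X'(2) Y(2)] fin_vfield_vbracket[OF X'(1) Y(1) X'(2) Y(2)]
      supp_vbracket[OF X'(1) Y(1)] X'(3) supp_Y kill[OF g Y supp_Y theta_hfield[OF i]] by blast+
  have "vbracket m ?Z ?Y = vbracket m ?X (vbracket m ?X' ?Y) -
      vscale ((- 1) ^ (a * b)) (vbracket m ?X' (vbracket m ?X ?Y))"
    using vbracket_jacobi[OF X(1) X'(1) Y(1) X(2) X'(2) Y(2)] by simp
  then have "theta (vbracket m ?Z ?Y) = 0"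
    using kill[OF f X'Y] kill[OF g XY] by (simp add: theta_diff theta_vscale)
  then have "oscale (2 * sig m i) (coef ?Z (cj i)) =
      oscale ((- 1) ^ ((a + b) * dpar m i) * 2) (hder i (cbracket f g))"
    using theta_vbracket_hfield[OF vpart_vbracket[OF X(1) X'(1) X(2) X'(2)]
        fin_vfield_vbracket[OF X(1) X'(1) X(2) X'(2)] i]
    by (simp add: theta_Z hder_oscale)
  \<comment> \<open>The factor is the inverse of \<open>2 * sig m i\<close>, since
    \<open>sig m i\<close> squares to 1.\<close>
  then have "oscale (sig m i / 2) (oscale (2 * sig m i) (coef ?Z (cj i))) =
      oscale (sig m i / 2) (oscale ((- 1) ^ ((a + b) * dpar m i) * 2) (hder i (cbracket f g)))"
    by simp
  then show "coef ?Z (cj i) = oscale ((- 1) ^ ((a + b) * dpar m i) * sig m i) (hder i (cbracket f g))"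
    using two by (simp add: mult.commute)
qed

end

subsection \<open>Biderivations of a Lie superalgebra\<close>

text \<open>Parities are arbitrary naturals read modulo 2, so that sums of parities can stand in
  degrees and in sign exponents without reduction.\<close>

locale lie_superalgebra = vector_space scl
  for scl :: "'a::field \<Rightarrow> 'v::ab_group_add \<Rightarrow> 'v" +
  fixes L :: "('a, 'v) superalg"
  assumes scal_eq: "scal L = scl"
    and subspace_hcomp: "subspace (hcomp L (a mod 2))"
    and carr_eq: "carr L = {x + y | x y. x \<in> hcomp L 0 \<and> y \<in> hcomp L 1}"
    and hcomp_disjoint: "hcomp L 0 \<inter> hcomp L 1 = {0}"
    and brk_add_left: "brk L (x + y) z = brk L x z + brk L y z"
    and brk_add_right: "brk L x (y + z) = brk L x y + brk L x z"
    and brk_scl_left: "brk L (scl c x) y = scl c (brk L x y)"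
    and brk_scl_right: "brk L x (scl c y) = scl c (brk L x y)"
    and brk_hcomp: "x \<in> hcomp L (a mod 2) \<Longrightarrow> y \<in> hcomp L (b mod 2) \<Longrightarrow>
      brk L x y \<in> hcomp L ((a + b) mod 2)"
    and brk_skew: "x \<in> hcomp L (a mod 2) \<Longrightarrow> y \<in> hcomp L (b mod 2) \<Longrightarrow>
      brk L x y = - scl ((- 1) ^ (a * b)) (brk L y x)"
    and brk_jacobi: "x \<in> hcomp L (a mod 2) \<Longrightarrow> y \<in> hcomp L (b mod 2) \<Longrightarrow> z \<in> hcomp L (d mod 2) \<Longrightarrow>
      brk L x (brk L y z) = brk L (brk L x y) z + scl ((- 1) ^ (a * b)) (brk L y (brk L x z))"
begin

abbreviation br :: "'v \<Rightarrow> 'v \<Rightarrow> 'v" where "br \<equiv> brk L"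
abbreviation H :: "nat \<Rightarrow> 'v set" where "H a \<equiv> hcomp L (a mod 2)"

lemma H_cong: "even a = even b \<Longrightarrow> H a = H b"
  by (simp add: mod2_eq_if)

lemma H_0 [simp]: "0 \<in> H a"
  by (rule subspace_0[OF subspace_hcomp])

lemma H_add: "x \<in> H a \<Longrightarrow> y \<in> H a \<Longrightarrow> x + y \<in> H a"
  by (rule subspace_add[OF subspace_hcomp])

lemma H_scl: "x \<in> H a \<Longrightarrow> scl c x \<in> H a"
  by (rule subspace_scale[OF subspace_hcomp])

lemma H_diff: "x \<in> H a \<Longrightarrow> y \<in> H a \<Longrightarrow> x - y \<in> H a"
  by (rule subspace_diff[OF subspace_hcomp])

lemma H_subset: "H a \<subseteq> carr L"
proof
  fix x assume x: "x \<in> H a"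
  show "x \<in> carr L"
  proof (cases "even a")
    case True
    then have "x \<in> hcomp L 0" "x = x + 0" "0 \<in> hcomp L 1"
      using x H_0[of 1] by (simp_all add: mod2_eq_if)
    then show ?thesis unfolding carr_eq by blast
  next
    case False
    then have "x \<in> hcomp L 1" "x = 0 + x" "0 \<in> hcomp L 0"
      using x H_0[of 0] by (simp_all add: mod2_eq_if)
    then show ?thesis unfolding carr_eq by blast
  qed
qed

lemma H_disjoint:
  assumes "x \<in> H a" "x \<in> H b" "even a \<noteq> even b"
  shows "x = 0"
  using assms hcomp_disjoint by (auto simp: mod2_eq_if split: if_splits)

sublocale brl: additive "\<lambda>x. br x y" for y
  by unfold_locales (rule brk_add_left)

sublocale brr: additive "\<lambda>y. br x y" for x
  by unfold_locales (rule brk_add_right)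

lemmas br_simps = brk_add_left brk_add_right brk_scl_left brk_scl_right
  brl.diff brl.minus brr.diff brr.minus

declare brl.zero [simp] brr.zero [simp]

lemma br_carr:
  assumes "x \<in> carr L" "y \<in> carr L"
  shows "br x y \<in> carr L"
proof -
  obtain x0 x1 y0 y1 where s: "x = x0 + x1" "y = y0 + y1"
    and x: "x0 \<in> H 0" "x1 \<in> H 1" and y: "y0 \<in> H 0" "y1 \<in> H 1"
    using assms unfolding carr_eq by auto
  have p: "br x0 y0 \<in> H 0" "br x1 y1 \<in> H 0" "br x0 y1 \<in> H 1" "br x1 y0 \<in> H 1"
    using brk_hcomp[OF x(1) y(1)] brk_hcomp[OF x(1) y(2)] brk_hcomp[OF x(2) y(1)] brk_hcomp[OF x(2) y(2)]
    by simp_all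
  have "br x0 y0 + br x1 y1 \<in> H 0" "br x0 y1 + br x1 y0 \<in> H 1"
    by (rule H_add[OF p(1,2)], rule H_add[OF p(3,4)])
  moreover have "br x y = (br x0 y0 + br x1 y1) + (br x0 y1 + br x1 y0)"
    by (simp add: s br_simps algebra_simps)
  ultimately show ?thesis unfolding carr_eq by auto
qed

lemma subspace_carr: "subspace (carr L)"
proof -
  have "span (hcomp L 0) = hcomp L 0" "span (hcomp L 1) = hcomp L 1"
    using subspace_hcomp[of 0] subspace_hcomp[of 1] by (simp_all add: span_eq_iff)
  then have "carr L = span (hcomp L 0 \<union> hcomp L 1)"
    by (simp only: span_Un carr_eq)
  then show ?thesis by simp
qed

lemma zero_bider: "restrict (\<lambda>_. 0) (carr L \<times> carr L) \<in> BDer_deg \<gamma> L"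
proof -
  have c: "0 \<in> carr L" using H_subset[of 0] H_0[of 0] by blast
  have H: "\<And>x. x \<in> hcomp L 0 \<Longrightarrow> x \<in> carr L" "\<And>x. x \<in> hcomp L 1 \<Longrightarrow> x \<in> carr L"
    using H_subset[of 0] H_subset[of 1] by auto
  show ?thesis
    using c H H_0 subspace_add[OF subspace_carr] subspace_scale[OF subspace_carr]
    by (auto simp: BDer_deg_def bilinear_maps_def homogeneous_map_def sgn_scal_def scal_eq br_carr)
qed

lemma inner_bider_in_BDer_deg: "inner_bider L c \<in> BDer_deg 0 L"
proof -
  have H: "x \<in> carr L" if "x \<in> H a" for x a using that H_subset by blast
  have B: "inner_bider L c (x, y) = scl c (br x y)" if "x \<in> carr L" "y \<in> carr L" for x y
    using that by (simp add: inner_bider_def scal_eq)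
  have "inner_bider L c \<in> carr L \<times> carr L \<rightarrow>\<^sub>E carr L"
    unfolding inner_bider_def restrict_PiE_iff
    using subspace_scale[OF subspace_carr] br_carr by (auto simp: scal_eq)
  then have 1: "inner_bider L c \<in> bilinear_maps L"
    unfolding bilinear_maps_def
    using subspace_add[OF subspace_carr] subspace_scale[OF subspace_carr]
    by (auto simp: B scal_eq br_simps scale_right_distrib mult.commute)
  have 2: "homogeneous_map L 0 (inner_bider L c)"
    unfolding homogeneous_map_def
  proof (intro ballI)
    fix a b x y assume "a \<in> {0, 1::nat}" "b \<in> {0, 1::nat}" "x \<in> hcomp L a" "y \<in> hcomp L b"
    then have "x \<in> H a" "y \<in> H b" by auto
    then show "inner_bider L c (x, y) \<in> hcomp L ((a + b + 0) mod 2)"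
      using H H_scl[OF brk_hcomp[of x a y b]] by (simp add: B)
  qed
  have 3: "inner_bider L c (x, y) = - sgn_scal L (a * b) (inner_bider L c (y, x))"
    if "x \<in> H a" "y \<in> H b" for a b x y
    using brk_skew[OF that] H that by (simp add: B sgn_scal_def scal_eq scale_right_distrib mult.commute)
  have 4: "inner_bider L c (x, br y z) = br (inner_bider L c (x, y)) z +
      sgn_scal L ((0 + a) * b) (br y (inner_bider L c (x, z)))"
    if "x \<in> H a" "y \<in> H b" "z \<in> H d" for a b d x y z
    using brk_jacobi[OF that] H that
    by (simp add: B br_carr br_simps sgn_scal_def scal_eq scale_right_distrib mult.commute)
  \<comment> \<open>The rule in the first argument is again the Jacobi identity, with the bracket of
    y and [x, z] turned round by skew-symmetry.\<close>
  have 5: "inner_bider L c (br x y, z) = sgn_scal L (0 * a) (br x (inner_bider L c (y, z))) +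
      sgn_scal L (b * d) (br (inner_bider L c (x, z)) y)"
    if "x \<in> H a" "y \<in> H b" "z \<in> H d" for a b d x y z
  proof -
    have "br y (br x z) = - scl ((- 1) ^ (b * (a + d))) (br (br x z) y)"
      by (rule brk_skew[OF that(2) brk_hcomp[OF that(1,3)]])
    moreover have "(- 1) ^ (a * b) * (- 1) ^ (b * (a + d)) = ((- 1) ^ (b * d) :: 'a)"
      by (simp add: minus_one_power_iff)
    ultimately have "scl ((- 1) ^ (a * b)) (br y (br x z)) = - scl ((- 1) ^ (b * d)) (br (br x z) y)"
      by simp
    then have "br (br x y) z = br x (br y z) + scl ((- 1) ^ (b * d)) (br (br x z) y)"
      using brk_jacobi[OF that] by simp
    then show ?thesis
      using H that by (simp add: B br_carr br_simps sgn_scal_def scal_eq scale_right_distrib mult.commute)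
  qed
  have up: "x \<in> H a" if "x \<in> hcomp L a" "a \<in> {0, 1}" for x a using that by auto
  show ?thesis
    unfolding BDer_deg_def
    by (intro CollectI conjI ballI 1 2; rule 3 4 5; erule (1) up)
qed

text \<open>An inner map is even; its odd part is taken to be the zero map.\<close>

lemma IBDer_subset_BDer: "IBDer L \<subseteq> BDer L"
proof -
  have "inner_bider L c \<in> BDer L" for c
  proof -
    have "inner_bider L c =
        restrict (\<lambda>z. inner_bider L c z + restrict (\<lambda>_. 0) (carr L \<times> carr L) z) (carr L \<times> carr L)"
      by (auto simp: inner_bider_def)
    then show ?thesis
      unfolding BDer_def using inner_bider_in_BDer_deg zero_bider by blast
  qed
  then show ?thesis by (auto simp: IBDer_def)
qed

end

section \<open>Identities for a homogeneous skew-symmetric super-biderivation\<close>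

locale bider = lie_superalgebra scl L
  for scl :: "'a::field \<Rightarrow> 'v::ab_group_add \<Rightarrow> 'v" and L :: "('a, 'v) superalg" +
  fixes \<gamma> :: nat and \<phi> :: "'v \<times> 'v \<Rightarrow> 'v"
  assumes bider: "\<phi> \<in> BDer_deg \<gamma> L" and two: "(2 :: 'a) \<noteq> 0"
begin

lemma hcomp_parity: "(a mod 2 :: nat) \<in> {0, 1}"
  by auto

lemma sgn_scal_parity: "sgn_scal L (a mod 2 * (b mod 2)) x = scl ((- 1) ^ (a * b)) x"
  unfolding sgn_scal_def scal_eq by (rule arg_cong[of _ _ "\<lambda>c. scl c x"]) (rule minus_one_power_cong, auto)

lemma bider_H:
  assumes "x \<in> H a" "y \<in> H b"
  shows "\<phi> (x, y) \<in> H (a + b + \<gamma>)"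
proof -
  have "\<phi> (x, y) \<in> hcomp L ((a mod 2 + b mod 2 + \<gamma>) mod 2)"
    using bider assms hcomp_parity unfolding BDer_deg_def homogeneous_map_def by blast
  moreover have "(a mod 2 + b mod 2 + \<gamma>) mod 2 = (a + b + \<gamma>) mod 2"
    by (metis mod_add_eq mod_add_left_eq)
  ultimately show ?thesis by simp
qed

lemma bider_skew:
  assumes "x \<in> H a" "y \<in> H b"
  shows "\<phi> (x, y) = - scl ((- 1) ^ (a * b)) (\<phi> (y, x))"
  using bider assms hcomp_parity unfolding BDer_deg_def sgn_scal_parity[symmetric] by blast

lemma bider_left:
  assumes "x \<in> H a" "y \<in> H b" "z \<in> H d"
  shows "\<phi> (br x y, z) = scl ((- 1) ^ (\<gamma> * a)) (br x (\<phi> (y, z))) +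
    scl ((- 1) ^ (b * d)) (br (\<phi> (x, z)) y)"
proof -
  have "\<phi> (br x y, z) = sgn_scal L (\<gamma> * (a mod 2)) (br x (\<phi> (y, z))) +
      sgn_scal L (b mod 2 * (d mod 2)) (br (\<phi> (x, z)) y)"
    using bider assms hcomp_parity unfolding BDer_deg_def by blast
  moreover have "(- 1) ^ (\<gamma> * (a mod 2)) = ((- 1) ^ (\<gamma> * a) :: 'a)"
    by (rule minus_one_power_cong) auto
  ultimately show ?thesis unfolding sgn_scal_parity by (simp add: sgn_scal_def scal_eq)
qed

lemma bider_right:
  assumes "x \<in> H a" "y \<in> H b" "z \<in> H d"
  shows "\<phi> (x, br y z) = br (\<phi> (x, y)) z + scl ((- 1) ^ ((\<gamma> + a) * b)) (br y (\<phi> (x, z)))"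
proof -
  have "\<phi> (x, br y z) = br (\<phi> (x, y)) z + sgn_scal L ((\<gamma> + a mod 2) * (b mod 2)) (br y (\<phi> (x, z)))"
    using bider assms hcomp_parity unfolding BDer_deg_def by blast
  moreover have "(- 1) ^ ((\<gamma> + a mod 2) * (b mod 2)) = ((- 1) ^ ((\<gamma> + a) * b) :: 'a)"
    by (rule minus_one_power_cong) auto
  ultimately show ?thesis by (simp add: sgn_scal_def scal_eq)
qed

lemma bider_add_right:
  "x \<in> carr L \<Longrightarrow> y \<in> carr L \<Longrightarrow> z \<in> carr L \<Longrightarrow> \<phi> (x, y + z) = \<phi> (x, y) + \<phi> (x, z)"
  using bider unfolding BDer_deg_def bilinear_maps_def by blast

lemma bider_add_left:
  "x \<in> carr L \<Longrightarrow> y \<in> carr L \<Longrightarrow> z \<in> carr L \<Longrightarrow> \<phi> (x + y, z) = \<phi> (x, z) + \<phi> (y, z)"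
  using bider unfolding BDer_deg_def bilinear_maps_def by blast

lemma bider_scl_right: "x \<in> carr L \<Longrightarrow> y \<in> carr L \<Longrightarrow> \<phi> (x, scl c y) = scl c (\<phi> (x, y))"
  using bider unfolding BDer_deg_def bilinear_maps_def scal_eq by blast

lemma scl_2: "scl 2 x = x + x"
  using scale_left_distrib[of 1 1 x] by simp

lemma double_eq_0: "(x :: 'v) + x = 0 \<longleftrightarrow> x = 0"
  unfolding scl_2[symmetric] using two by simp

text \<open>Expand \<open>\<phi>([e, x], [y, v])\<close> by the derivation rule in the first and in the second argument.\<close>

lemma bider_exchange:
  assumes e: "e \<in> H 0" and x: "x \<in> H px" and y: "y \<in> H py" and v: "v \<in> H pv"
  shows "br (\<phi> (x, y)) (br e v) + scl ((- 1) ^ (pv * (px + py))) (br (\<phi> (e, v)) (br x y)) =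
    scl ((- 1) ^ (py * pv)) (br (\<phi> (x, v)) (br e y) +
      scl ((- 1) ^ (py * (px + pv))) (br (\<phi> (e, y)) (br x v)))"
proof -
  note ex = brk_hcomp[OF e x, simplified] and yv = brk_hcomp[OF y v]
  note pxy = bider_H[OF x y] and pxv = bider_H[OF x v]
  have Dy: "\<phi> (e, y) \<in> H (py + \<gamma>)" and Dv: "\<phi> (e, v) \<in> H (pv + \<gamma>)"
    using bider_H[OF e y] bider_H[OF e v] by simp_all
  have left: "\<phi> (br e x, z) = br e (\<phi> (x, z)) + scl ((- 1) ^ (px * pz)) (br (\<phi> (e, z)) x)"
    if "z \<in> H pz" for z pz
    using bider_left[OF e x that] by simp
  have J0: "br e (br p q) = br (br e p) q + br p (br e q)" if "p \<in> H a" "q \<in> H b" for p q a b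
    using brk_jacobi[OF e that] by simp
  have A: "\<phi> (br e x, br y v) = br (br e (\<phi> (x, y))) v + br (\<phi> (x, y)) (br e v) +
      scl ((- 1) ^ ((\<gamma> + px) * py)) (br (br e y) (\<phi> (x, v)) + br y (br e (\<phi> (x, v)))) +
      scl ((- 1) ^ (px * (py + pv))) (br (br (\<phi> (e, y)) v) x +
        scl ((- 1) ^ (\<gamma> * py)) (br (br y (\<phi> (e, v))) x))"
    unfolding left[OF yv] bider_right[OF x y v] bider_right[OF e y v]
    by (simp add: br_simps J0[OF pxy v] J0[OF y pxv])
  have B: "\<phi> (br e x, br y v) = br (br e (\<phi> (x, y))) v + scl ((- 1) ^ (px * py)) (br (br (\<phi> (e, y)) x) v) +
      scl ((- 1) ^ ((\<gamma> + px) * py)) (br y (br e (\<phi> (x, v))) +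
        scl ((- 1) ^ (px * pv)) (br y (br (\<phi> (e, v)) x)))"
    unfolding bider_right[OF ex y v] left[OF y] left[OF v] by (simp add: br_simps)
  define P where "P = br (\<phi> (x, y)) (br e v)"
  define Q where "Q = br (\<phi> (x, v)) (br e y)"
  define a1 where "a1 = br (br (\<phi> (e, y)) v) x"
  define a2 where "a2 = br (br (\<phi> (e, y)) x) v"
  define b1 where "b1 = br (br y (\<phi> (e, v))) x"
  define b2 where "b2 = br y (br (\<phi> (e, v)) x)"
  define R where "R = br (\<phi> (e, v)) (br x y)"
  define U where "U = br (\<phi> (e, y)) (br x v)"
  have sQ: "br (br e y) (\<phi> (x, v)) = - scl ((- 1) ^ (py * (px + pv + \<gamma>))) Q"
    unfolding Q_def using brk_skew[OF brk_hcomp[OF e y] pxv] by simp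
  \<comment> \<open>The terms containing [e, \<phi>(x, y)] and [e, \<phi>(x, v)] outside
    \<open>P\<close> and \<open>Q\<close> occur in both expansions and cancel.\<close>
  have P: "P = scl ((- 1) ^ ((\<gamma> + px) * py)) (scl ((- 1) ^ (py * (px + pv + \<gamma>))) Q) -
      scl ((- 1) ^ (px * (py + pv))) (a1 + scl ((- 1) ^ (\<gamma> * py)) b1) +
      scl ((- 1) ^ (px * py)) a2 + scl ((- 1) ^ ((\<gamma> + px) * py)) (scl ((- 1) ^ (px * pv)) b2)"
    using A unfolding B sQ unfolding P_def a1_def a2_def b1_def b2_def
    by (simp add: scale_right_distrib algebra_simps)
  have "br x (br (\<phi> (e, y)) v) = - scl ((- 1) ^ (px * (py + \<gamma> + pv))) a1"
    unfolding a1_def using brk_skew[OF x brk_hcomp[OF Dy v]] by simp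
  \<comment> \<open>The Jacobi identity merges \<open>a1\<close>, \<open>a2\<close> into
    \<open>U\<close> and, below, \<open>b1\<close>, \<open>b2\<close> into \<open>R\<close>; these
    are the products in the claim.\<close>
  then have U: "U = a2 - scl ((- 1) ^ ((py + \<gamma>) * px)) (scl ((- 1) ^ (px * (py + \<gamma> + pv))) a1)"
    unfolding U_def a2_def using brk_jacobi[OF Dy x v] by simp
  have "br y x = - scl ((- 1) ^ (py * px)) (br x y)" by (rule brk_skew[OF y x])
  then have b2: "b2 = b1 - scl ((- 1) ^ (py * (pv + \<gamma>))) (scl ((- 1) ^ (py * px)) R)"
    unfolding b1_def b2_def R_def using brk_jacobi[OF y Dv x] by (simp add: br_simps)
  show ?thesis
    unfolding P_def[symmetric] Q_def[symmetric] R_def[symmetric] U_def[symmetric] P U b2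
    by (cases "even px"; cases "even py"; cases "even pv"; cases "even \<gamma>")
      (simp_all add: minus_one_power_iff algebra_simps)
qed

text \<open>Taking e even keeps its parity out of the signs. The defect is \<open>\<Psi>\<close>;
  \<open>bider_exchange\<close> governs y and v, skew-symmetry of \<phi> and of the bracket governs
  x and y.\<close>

lemma bider_star:
  assumes e: "e \<in> H 0" and x: "x \<in> H px" and y: "y \<in> H py" and v: "v \<in> H pv"
  shows "br (\<phi> (x, y)) (br e v) = - scl ((- 1) ^ (pv * (px + py))) (br (\<phi> (e, v)) (br x y))"
proof -
  define \<Psi> where "\<Psi> x y v px py pv = br (\<phi> (x, y)) (br e v) +
      scl ((- 1) ^ (pv * (px + py))) (br (\<phi> (e, v)) (br x y))" for x y v and px py pv :: nat
  have ex: "\<Psi> x y v px py pv = scl ((- 1) ^ (py * pv)) (\<Psi> x v y px pv py)"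
    if "x \<in> H px" "y \<in> H py" "v \<in> H pv" for x y v px py pv
    unfolding \<Psi>_def by (rule bider_exchange[OF e that])
  have sk: "\<Psi> x y v px py pv = - scl ((- 1) ^ (px * py)) (\<Psi> y x v py px pv)"
    if "x \<in> H px" "y \<in> H py" "v \<in> H pv" for x y v px py pv
    unfolding \<Psi>_def
    by (subst bider_skew[OF that(1,2)], subst brk_skew[OF that(1,2)])
      (simp add: br_simps scale_right_distrib add.commute mult.commute)
  \<comment> \<open>Alternating the exchanges of the last two and of the first two arguments five
    times swaps x and y and uses two minus signs; exchanging x and y directly uses one.\<close>
  have "\<Psi> x y v px py pv = scl ((- 1) ^ (py * pv)) (- scl ((- 1) ^ (px * pv))
      (scl ((- 1) ^ (px * py)) (- scl ((- 1) ^ (pv * py)) (scl ((- 1) ^ (pv * px)) (\<Psi> y x v py px pv)))))"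
    by (simp only: ex[OF x y v] sk[OF x v y] ex[OF v x y] sk[OF v y x] ex[OF y v x])
  also have "\<dots> = scl ((- 1) ^ (px * py)) (\<Psi> y x v py px pv)"
    by (simp add: minus_one_power_iff)
  also have "\<dots> = - \<Psi> x y v px py pv"
    by (subst sk[OF x y v]) simp
  finally have "\<Psi> x y v px py pv = - \<Psi> x y v px py pv" .
  then have "\<Psi> x y v px py pv = 0"
    using double_eq_0 by (metis add.left_inverse)
  then show ?thesis by (simp add: \<Psi>_def eq_neg_iff_add_eq_0)
qed

lemma br_eq_0_commute:
  assumes "x \<in> H a" "y \<in> H b"
  shows "br x y = 0 \<longleftrightarrow> br y x = 0"
  using brk_skew[OF assms] brk_skew[OF assms(2,1)] by auto

text \<open>In the contact superalgebra \<open>e\<close>, \<open>h\<close>, \<open>w\<close>, \<open>x\<^sub>j\<close>, \<open>v\<^sub>j\<close> are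
  the elements with generating functions 1, \<open>x\<^sub>m\<close>, \<open>x\<^sub>m\<^sup>2 / 2\<close>, \<open>x\<^sub>j\<close>,
  \<open>x\<^sub>j x\<^sub>m\<close>. As \<open>e\<close>, the \<open>x\<^sub>j\<close> and \<open>h\<close> have trivial common centralizer,
  \<open>bider_star\<close> determines \<open>\<phi>\<close> from its values \<open>\<phi>(e, v)\<close> for
  \<open>v = h, v\<^sub>j, w\<close>.\<close>

lemma bider_scalar:
  fixes e h w :: 'v and I :: "'i set" and q :: "'i \<Rightarrow> nat" and x v :: "'i \<Rightarrow> 'v"
  assumes e: "e \<in> H 0" "e \<noteq> 0" and h: "h \<in> H 0" and w: "w \<in> H 0"
    and x: "\<And>j. j \<in> I \<Longrightarrow> x j \<in> H (q j)" and v: "\<And>j. j \<in> I \<Longrightarrow> v j \<in> H (q j)"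
    and he: "br h e = - scl 2 e" and ex: "\<And>j. j \<in> I \<Longrightarrow> br e (x j) = 0"
    and xx: "\<And>k j. k \<in> I \<Longrightarrow> j \<in> I \<Longrightarrow> \<exists>\<kappa>. br (x k) (x j) = scl \<kappa> e"
    and xh: "\<And>k. k \<in> I \<Longrightarrow> br (x k) h = x k"
    and ev: "\<And>j. j \<in> I \<Longrightarrow> br e (v j) = scl 2 (x j)" and ew: "br e w = scl 2 h"
    and hv: "\<And>j. j \<in> I \<Longrightarrow> br h (v j) = v j" and hw: "br h w = scl 2 w"
    and cent: "\<And>z a. z \<in> H a \<Longrightarrow> br e z = 0 \<Longrightarrow> (\<And>j. j \<in> I \<Longrightarrow> br (x j) z = 0) \<Longrightarrow> \<exists>c. z = scl c e"
    and three: "(3 :: 'a) \<noteq> 0"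
  shows "\<exists>c. (even \<gamma> \<or> c = 0) \<and> (\<forall>y\<in>carr L. \<forall>z\<in>carr L. \<phi> (y, z) = scl c (br y z))"
proof -
  have eh: "br e h = scl 2 e"
    using brk_skew[OF e(1) h] he by simp
  \<comment> \<open>Such a z is a multiple of e and therefore has weight -2, so it cannot have
    another weight unless it is zero.\<close>
  have weight: "z = 0" if "z \<in> H a" "br e z = 0" "\<And>j. j \<in> I \<Longrightarrow> br (x j) z = 0"
    "br h z = scl l z" "l + 2 \<noteq> 0" for z a l
  proof -
    have "\<exists>c. z = scl c e" by (rule cent[OF that(1-3)])
    then obtain c where c: "z = scl c e" by blast
    then have "scl (l * c) e = - scl (2 * c) e"
      using that(4) by (simp add: br_simps he mult.commute)
    then have "scl ((l + 2) * c) e = 0"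
      by (simp add: scale_left_distrib distrib_right)
    with that(5) e(2) c show ?thesis by simp
  qed
  \<comment> \<open>The map \<open>D\<close> is a superderivation of the parity of \<phi> by the
    rule for the second argument. The aim is D = c [e, -] on h, v_j and w.\<close>
  define D where "D z = \<phi> (e, z)" for z
  have D_H: "D z \<in> H (a + \<gamma>)" if "z \<in> H a" for z a
    using bider_H[OF e(1) that] by (simp add: D_def)
  have D_br: "D (br y z) = br (D y) z + scl ((- 1) ^ (\<gamma> * a)) (br y (D z))"
    if "y \<in> H a" "z \<in> H b" for y z a b
    using bider_right[OF e(1) that] by (simp add: D_def)
  have "D e = - D e"
    using bider_skew[OF e(1) e(1)] by (simp add: D_def)
  then have De: "D e = 0"
    using double_eq_0 by (metis add.left_inverse)
  have eD: "br e (D z) = D (br e z)" if "z \<in> H a" for z a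
    using D_br[OF e(1) that] De by simp
  have carr: "z \<in> carr L" if "z \<in> H a" for z a using that H_subset by blast
  have D_diff: "D (y - scl c z) = D y - scl c (D z)" if "y \<in> H a" "z \<in> H b" for y z a b c
  proof -
    have "D (y + scl (- c) z) = D y + scl (- c) (D z)"
      unfolding D_def
      by (simp only: bider_add_right[OF carr[OF e(1)] carr[OF that(1)] carr[OF H_scl[OF that(2)]]]
          bider_scl_right[OF carr[OF e(1)] carr[OF that(2)]])
    then show ?thesis by simp
  qed
  have D_scl: "D (scl c z) = scl c (D z)" if "z \<in> H a" for c z a
    unfolding D_def by (rule bider_scl_right[OF carr[OF e(1)] carr[OF that]])
  have star: "br (\<phi> (y, z)) (br e u) = - scl ((- 1) ^ (c * (a + b))) (br (D u) (br y z))"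
    if "y \<in> H a" "z \<in> H b" "u \<in> H c" for y z u a b c
    unfolding D_def by (rule bider_star[OF e(1) that])
  \<comment> \<open>Commuting with h means weight 0, which differs from -2.\<close>
  have commutes_basis: "z = 0" if z: "z \<in> H a" and c: "br z e = 0" "\<And>j. j \<in> I \<Longrightarrow> br z (x j) = 0" "br z h = 0"
    for z a
  proof -
    have "br h z = scl 0 z" using br_eq_0_commute[OF z h] c(3) by simp
    then show ?thesis
      using weight[OF z, of 0] br_eq_0_commute[OF z e(1)] br_eq_0_commute[OF z x] c two by auto
  qed
  have commutes: "z = 0" if z: "z \<in> H a" and c: "br z (br e h) = 0" "br z (br e w) = 0"
    "\<And>j. j \<in> I \<Longrightarrow> br z (br e (v j)) = 0" for z a
    using commutes_basis[OF z] c two by (simp add: eh ew ev br_simps)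
  \<comment> \<open>For the pair e, y the right side of \<open>star\<close> contains [e, y] = 0. So
    \<open>D y\<close> commutes with all [e, u], in particular with 2 e, 2 h and the 2 x_j.\<close>
  have D_0: "D y = 0" if y: "y \<in> H a" "br e y = 0" for y a
  proof (rule commutes[OF D_H[OF y(1)]])
    have z: "br (D y) (br e u) = 0" if "u \<in> H c" for u c
      using star[OF e(1) y(1) that] y(2) by (simp add: D_def)
    show "br (D y) (br e h) = 0" "br (D y) (br e w) = 0" "\<And>j. j \<in> I \<Longrightarrow> br (D y) (br e (v j)) = 0"
      by (blast intro: z[OF h] z[OF w] z[OF v])+
  qed
  have Dx: "D (x j) = 0" if "j \<in> I" for j using D_0[OF x ex] that by blast
  \<comment> \<open>Apply \<open>star\<close> to the pair e, h and to v_j: the right side has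
    \<open>D (v j)\<close> bracketed with 2 e, and this vanishes because [e, D v_j] = 2 D x_j =
    0.\<close>
  have "br (x j) (D h) = 0" if j: "j \<in> I" for j
  proof -
    have "br e (D (v j)) = 0"
      unfolding eD[OF v[OF j]] ev[OF j] using D_scl[OF x[OF j]] Dx[OF j] by simp
    then have "br (D (v j)) e = 0" using br_eq_0_commute[OF e(1) D_H[OF v[OF j]]] by simp
    then have "br (D h) (scl 2 (x j)) = 0"
      using star[OF e(1) h v[OF j]] by (simp add: ev[OF j] eh br_simps D_def)
    then show ?thesis
      using two br_eq_0_commute[OF x[OF j] D_H[OF h]] by (simp add: br_simps)
  qed
  moreover have "br e (D h) = 0"
    unfolding eD[OF h] eh using D_scl[OF e(1)] De by simp
  ultimately obtain k where k: "D h = scl k e" using cent[OF D_H[OF h]] by blast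
  \<comment> \<open>Halved because [e, h] = 2 e.\<close>
  define c where "c = k / 2"
  have Dh: "D h = scl c (br e h)" using two by (simp add: c_def k eh)
  \<comment> \<open>In the odd case \<open>D h\<close> would be odd, but it is a multiple of the
    even element e.\<close>
  have c0: "c = 0" if "odd \<gamma>"
  proof -
    have "D h \<in> H 0" using k H_scl[OF e(1)] by simp
    then have "D h = 0" using H_disjoint[OF D_H[OF h], of 0] that by simp
    then show ?thesis using k e(2) by (simp add: c_def)
  qed
  have H_sub: "y - scl c z \<in> H (a + \<gamma>)" if "y \<in> H (a + \<gamma>)" "z \<in> H a" for y z a
  proof (cases "even \<gamma>")
    case True
    then show ?thesis using that H_cong[of "a + \<gamma>" a] H_scl H_diff by simp
  qed (use that c0 in simp)
  have inner_value: "D u = scl c (br e u)"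
    if u: "u \<in> H 0 \<or> (\<exists>j\<in>I. u \<in> H (q j))" "br h u = scl l u" "l + 2 \<noteq> 0" "D (br e u) = scl c (br e (br e u))"
      and xu: "\<And>j. j \<in> I \<Longrightarrow> D (br (x j) u) = scl c (br e (br (x j) u))" for u l
  proof -
    obtain a where a: "u \<in> H a" using u(1) by (elim disjE bexE) (rule that, assumption)+
    have eu: "br e u \<in> H a" using brk_hcomp[OF e(1) a] by simp
    have "D u - scl c (br e u) = 0"
    proof (rule weight[of _ "a + \<gamma>"])
      show "D u - scl c (br e u) \<in> H (a + \<gamma>)" by (rule H_sub[OF D_H[OF a] eu])
      show "br e (D u - scl c (br e u)) = 0" using u(4) by (simp add: br_simps eD[OF a])
      show "l + 2 \<noteq> 0" by fact
      show "br (x j) (D u - scl c (br e u)) = 0" if j: "j \<in> I" for j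
      proof -
        have "br e (br (x j) u) = br (x j) (br e u)"
          using brk_jacobi[OF e(1) x[OF j] a] ex[OF j] by simp
        then have "scl ((- 1) ^ (\<gamma> * q j)) (br (x j) (D u)) = scl c (br (x j) (br e u))"
          using xu[OF j] D_br[OF x[OF j] a] Dx[OF j] by simp
        then show ?thesis using c0 by (cases "even \<gamma>") (auto simp: br_simps minus_one_power_iff split: if_splits)
      qed
      \<comment> \<open>The term [e, u] has weight l - 2, and [h, D u] differs from l D u by -2 c
        [e, u] because of the value of \<open>D h\<close>. The two deviations cancel, so the
        difference of D u and c [e, u] has weight l.\<close>
      have "br h (br e u) = - scl 2 (br e u) + scl l (br e u)"
        using brk_jacobi[OF h e(1) a] u(2) by (simp add: he br_simps)
      moreover have "br h (D u) = scl l (D u) - scl (2 * c) (br e u)"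
        using D_br[OF h a] by (simp add: u(2) D_scl[OF a] Dh eh br_simps mult.commute)
      ultimately show "br h (D u - scl c (br e u)) = scl l (D u - scl c (br e u))"
        by (simp add: br_simps scale_right_distrib scale_right_diff_distrib mult.commute)
    qed
    then show ?thesis by simp
  qed
  \<comment> \<open>Weight 1 differs from -2 exactly because 3 is nonzero in the field.\<close>
  have Dv: "D (v j) = scl c (br e (v j))" if j: "j \<in> I" for j
  proof (rule inner_value[where l = 1])
    show "v j \<in> H 0 \<or> (\<exists>j'\<in>I. v j \<in> H (q j'))" using v j by blast
    show "br h (v j) = scl 1 (v j)" using hv[OF j] by simp
    show "(1 :: 'a) + 2 \<noteq> 0" using three by simp
    show "D (br e (v j)) = scl c (br e (br e (v j)))"
      by (simp add: ev[OF j] D_scl[OF x[OF j]] Dx[OF j] br_simps ex[OF j])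
    fix i assume i: "i \<in> I"
    let ?u = "br (x i) (v j)"
    obtain \<kappa> where \<kappa>: "br (x i) (x j) = scl \<kappa> e" using xx i j by blast
    have u: "?u \<in> H (q i + q j)" by (rule brk_hcomp[OF x[OF i] v[OF j]])
    have eu: "br e ?u = scl \<kappa> (br e h)"
      using brk_jacobi[OF e(1) x[OF i] v[OF j]] by (simp add: ex[OF i] ev[OF j] br_simps \<kappa> eh mult.commute)
    \<comment> \<open>If q i + q j is odd, then [x_i, x_j] = \<kappa> e is both odd and even, which
      forces \<kappa> = 0. So subtracting \<kappa> h from \<open>?u\<close> keeps it
      homogeneous.\<close>
    have "scl \<kappa> h \<in> H (q i + q j)"
    proof (cases "even (q i + q j)")
      case True
      then show ?thesis using H_scl[OF h] H_cong[of "q i + q j" 0] by simp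
    next
      case False
      have "scl \<kappa> e = 0"
        using H_disjoint[of "scl \<kappa> e" 0 "q i + q j"] H_scl[OF e(1)] brk_hcomp[OF x[OF i] x[OF j]] \<kappa> False
        by simp
      then show ?thesis using e(2) by simp
    qed
    then have "?u - scl \<kappa> h \<in> H (q i + q j)" using u by (rule H_diff[rotated])
    moreover have "br e (?u - scl \<kappa> h) = 0" using eu by (simp add: br_simps)
    ultimately have "D (?u - scl \<kappa> h) = 0" by (rule D_0)
    then have "D ?u = scl \<kappa> (D h)" using D_diff[OF u h] by simp
    then show "D ?u = scl c (br e ?u)" by (simp add: eu Dh mult.commute)
  qed
  have Dw: "D w = scl c (br e w)"
  proof (rule inner_value[where l = 2])
    show "w \<in> H 0 \<or> (\<exists>j\<in>I. w \<in> H (q j))" using w by blast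
    show "br h w = scl 2 w" by (rule hw)
    have "(2 :: 'a) + 2 = 2 * 2" by simp
    then show "(2 :: 'a) + 2 \<noteq> 0" using two by (metis mult_eq_0_iff)
    show "D (br e w) = scl c (br e (br e w))"
      by (simp add: ew D_scl[OF h] Dh br_simps mult.commute)
    fix i assume i: "i \<in> I"
    let ?u = "br (x i) w"
    have u: "?u \<in> H (q i)" using brk_hcomp[OF x[OF i] w] by simp
    have eu: "br e ?u = br e (v i)"
      using brk_jacobi[OF e(1) x[OF i] w] by (simp add: ex[OF i] ew ev[OF i] br_simps xh[OF i])
    \<comment> \<open>Both [x_i, w] and v_i give 2 x_i under e, so \<open>D_0\<close> applies to
      their difference. The factor 1 only matches the form of \<open>D_diff\<close>.\<close>
    have "?u - scl 1 (v i) \<in> H (q i)" using u v[OF i] by (simp add: H_diff)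
    moreover have "br e (?u - scl 1 (v i)) = 0" using eu by (simp add: br_simps)
    ultimately have "D (?u - scl 1 (v i)) = 0" by (rule D_0)
    then have "D ?u = D (v i)" using D_diff[OF u v[OF i], of 1] by simp
    then show "D ?u = scl c (br e ?u)" by (simp add: eu Dv[OF i])
  qed
  have hom: "\<phi> (y, z) = scl c (br y z)" if y: "y \<in> H a" and z: "z \<in> H b" for y z a b
  proof -
    \<comment> \<open>Once D u = c [e, u] is known, the right side of \<open>star\<close> is c times
      the bracket of [e, u] with [y, z], up to sign; skew-symmetry moves it to the left.\<close>
    have main: "br (\<phi> (y, z) - scl c (br y z)) (br e u) = 0" if u: "u \<in> H d" "D u = scl c (br e u)" for u d
    proof -
      have "br (br y z) (br e u) = - scl ((- 1) ^ ((a + b) * d)) (br (br e u) (br y z))"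
        using brk_skew[OF brk_hcomp[OF y z] brk_hcomp[OF e(1) u(1)]] by simp
      then show ?thesis using star[OF y z u(1)] u(2) by (simp add: br_simps mult.commute)
    qed
    have "\<phi> (y, z) - scl c (br y z) = 0"
    proof (rule commutes)
      show "\<phi> (y, z) - scl c (br y z) \<in> H (a + b + \<gamma>)"
        by (rule H_sub[OF bider_H[OF y z] brk_hcomp[OF y z]])
    qed (use main[OF h Dh] main[OF w Dw] main[OF v Dv] in auto)
    then show ?thesis by simp
  qed
  have "\<phi> (y, z) = scl c (br y z)" if yz: "y \<in> carr L" "z \<in> carr L" for y z
  proof -
    obtain y0 y1 z0 z1 where s: "y = y0 + y1" "z = z0 + z1"
      and y: "y0 \<in> H 0" "y1 \<in> H 1" and z: "z0 \<in> H 0" "z1 \<in> H 1"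
      using yz unfolding carr_eq by auto
    note cc = carr[OF y(1)] carr[OF y(2)] carr[OF z(1)] carr[OF z(2)]
    have "\<phi> (y, z) = \<phi> (y0, z0) + \<phi> (y0, z1) + (\<phi> (y1, z0) + \<phi> (y1, z1))"
      using cc yz(2) by (simp add: s(1) bider_add_left) (simp add: s(2) bider_add_right)
    then show ?thesis
      using hom[OF y(1) z(1)] hom[OF y(1) z(2)] hom[OF y(2) z(1)] hom[OF y(2) z(2)]
      by (simp add: s br_simps scale_right_distrib algebra_simps)
  qed
  then show ?thesis using c0 by blast
qed

end

subsection \<open>The contact superalgebra\<close>

text \<open>The type token \<open>F\<close> binds the field type, which the numerical parameters do
  not mention.\<close>

locale contact_algebra = contact_indices m n r t for m n r t :: nat +
  fixes \<tau> :: "nat \<Rightarrow> nat" and F :: "'a::field itself"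
  assumes char_gt_3: "CHAR('a) > 3" and \<tau>_pos: "\<And>i. i \<in> {1..m} \<Longrightarrow> \<tau> i > 0"
begin

abbreviation (input) T :: "'a osup set" where "T \<equiv> trunc_O m n \<tau>"
abbreviation (input) Kt :: "'a vfield set" where "Kt \<equiv> K_tilde m n \<tau>"
abbreviation (input) K :: "'a vfield set" where "K \<equiv> K_carrier m n \<tau>"
abbreviation (input) L :: "('a, 'a vfield) superalg" where "L \<equiv> K_contact m n \<tau>"
abbreviation (input) one :: "'a osup" where "one \<equiv> xmon 0 {}"

section \<open>The truncated contact superalgebra as a Lie superalgebra\<close>

lemma prime_char: "prime CHAR('a)"
  using char_gt_3 prime_CHAR_semidom[where ?'a = 'a] by simp

lemma small_nonzero: "(2 :: 'a) \<noteq> 0" "(3 :: 'a) \<noteq> 0"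
proof -
  have "\<not> CHAR('a) dvd 2" "\<not> CHAR('a) dvd 3"
    using char_gt_3 by (auto dest: dvd_imp_le)
  then have "of_nat 2 \<noteq> (0 :: 'a)" "of_nat 3 \<noteq> (0 :: 'a)"
    by (simp_all only: of_nat_eq_0_iff_char_dvd not_False_eq_True)
  then show "(2 :: 'a) \<noteq> 0" "(3 :: 'a) \<noteq> 0" by simp_all
qed

lemma xvar_T [simp]: "i \<in> J \<Longrightarrow> xvar m i \<in> T" "xvar m m \<in> T"
proof -
  have "m \<ge> 1" using m_eq by simp
  then show "i \<in> J \<Longrightarrow> xvar m i \<in> T" "xvar m m \<in> T"
    using char_gt_3 \<tau>_pos by (auto intro!: trunc_O_xvar simp: in_J_iff)
qed

lemma omult_T [simp]: "f \<in> T \<Longrightarrow> g \<in> T \<Longrightarrow> f \<odot> g \<in> T"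
  using prime_char by simp

lemma coef_DK_T: "f \<in> opart a \<Longrightarrow> f \<in> T \<Longrightarrow> coef (DK m n f) i \<in> T"
  by (auto simp: coef_DK)

lemma cbracket_T:
  assumes "f \<in> opart a" "f \<in> T" "g \<in> T"
  shows "cbracket f g \<in> T"
proof -
  have "act m (DK m n f) g \<in> T"
    unfolding act_def using assms coef_DK_T[OF assms(1,2)] by auto
  then show ?thesis
    using assms by (simp add: cbracket_def)
qed

lemma Kt_DK: "f \<in> T \<Longrightarrow> DK m n f \<in> Kt"
  by (simp add: K_tilde_def)

lemma subspace_Kt: "vfield.subspace Kt"
proof -
  have "DK m n (0 :: 'a osup) = 0" using DK_oscale[of 0 0] by simp
  moreover have "\<exists>h\<in>T. DK m n f + DK m n g = DK m n h" if "f \<in> T" "g \<in> T" for f g :: "'a osup"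
    using that by (intro bexI[of _ "f + g"]) (simp_all add: DK_add)
  moreover have "\<exists>h\<in>T. vscale c (DK m n f) = DK m n h" if "f \<in> T" for c and f :: "'a osup"
    using that by (intro bexI[of _ "oscale c f"]) (simp_all add: DK_oscale)
  ultimately show ?thesis
    unfolding vfield.subspace_def K_tilde_def by (auto simp: image_iff intro: bexI[of _ 0])
qed

lemma Kt_parts:
  assumes "X \<in> Kt"
  obtains f0 f1 where "f0 \<in> T" "f1 \<in> T" "f0 \<in> opart 0" "f1 \<in> opart 1" "X = DK m n f0 + DK m n f1"
proof -
  obtain f where f: "f \<in> T" "X = DK m n f" using assms by (auto simp: K_tilde_def)
  have "X = DK m n (oproj 0 f) + DK m n (oproj 1 f)"
    by (simp only: f(2) oproj_sum_parts flip: DK_add)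
  with f(1) show ?thesis by (intro that[of "oproj 0 f" "oproj 1 f"]) (simp_all only: trunc_O_oproj oproj_opart)
qed

lemma Kt_fin:
  assumes "X \<in> Kt"
  shows "X \<in> fin_vfield"
proof -
  obtain f0 f1 where f: "f0 \<in> T" "f1 \<in> T" "f0 \<in> opart 0" "f1 \<in> opart 1" "X = DK m n f0 + DK m n f1"
    using Kt_parts[OF assms] .
  then have "coef X i \<in> fin_osup" for i
    using DK_fin[of f0 0] DK_fin[of f1 1] by (simp add: lookup_add)
  then show ?thesis unfolding fin_vfield_def by blast
qed

lemma vbracket_Kt_hom:
  assumes "f \<in> T" "f \<in> opart a" "g \<in> T" "g \<in> opart b"
  shows "vbracket m (DK m n f) (DK m n g) \<in> Kt"
  using assms small_nonzero by (subst vbracket_DK[of f a g b]) (auto intro: Kt_DK cbracket_T)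

lemma vbracket_Kt:
  assumes "X \<in> Kt" "Y \<in> Kt"
  shows "vbracket m X Y \<in> Kt"
proof -
  obtain f0 f1 where f: "f0 \<in> T" "f1 \<in> T" "f0 \<in> opart 0" "f1 \<in> opart 1" "X = DK m n f0 + DK m n f1"
    using Kt_parts[OF assms(1)] .
  obtain g0 g1 where g: "g0 \<in> T" "g1 \<in> T" "g0 \<in> opart 0" "g1 \<in> opart 1" "Y = DK m n g0 + DK m n g1"
    using Kt_parts[OF assms(2)] .
  show ?thesis
    unfolding f(5) g(5) vbracket_add_left vbracket_add_right
    by (intro vfield.subspace_add[OF subspace_Kt] vbracket_Kt_hom[OF f(1,3) g(1,3)]
        vbracket_Kt_hom[OF f(1,3) g(2,4)] vbracket_Kt_hom[OF f(2,4) g(1,3)] vbracket_Kt_hom[OF f(2,4) g(2,4)])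
qed

lemma K_subset_Kt: "K \<subseteq> Kt"
  unfolding K_carrier_def
  by (intro vfield.span_minimal subspace_Kt) (auto intro: vbracket_Kt)

lemma subspace_K: "vfield.subspace K"
  by (simp add: K_carrier_def)

lemma vbracket_K: "X \<in> Kt \<Longrightarrow> Y \<in> Kt \<Longrightarrow> vbracket m X Y \<in> K"
  unfolding K_carrier_def by (intro vfield.span_base) blast

text \<open>The brackets spanning K are taken between arbitrary fields. Splitting both generating
  functions by parity gives four homogeneous brackets, two of each parity, all in K again.\<close>

lemma K_decomp: "K = {x + y | x y. x \<in> K \<inter> vpart m 0 \<and> y \<in> K \<inter> vpart m 1}"
proof
  let ?S = "{x + y | x y. x \<in> K \<inter> vpart m 0 \<and> y \<in> K \<inter> vpart m 1}"
  show "?S \<subseteq> K" using vfield.subspace_add[OF subspace_K] by blast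
  have sub: "vfield.subspace ?S"
    by (intro vfield.subspace_sums vfield.subspace_inter subspace_K subspace_vpart)
  have "vbracket m X Y \<in> ?S" if XY: "X \<in> Kt" "Y \<in> Kt" for X Y
  proof -
    obtain f0 f1 where f: "f0 \<in> T" "f1 \<in> T" "f0 \<in> opart 0" "f1 \<in> opart 1" "X = DK m n f0 + DK m n f1"
      using Kt_parts[OF XY(1)] .
    obtain g0 g1 where g: "g0 \<in> T" "g1 \<in> T" "g0 \<in> opart 0" "g1 \<in> opart 1" "Y = DK m n g0 + DK m n g1"
      using Kt_parts[OF XY(2)] .
    have hom: "vbracket m (DK m n f') (DK m n g') \<in> K \<inter> vpart m (a + b)"
      if "f' \<in> T" "g' \<in> T" "f' \<in> opart a" "g' \<in> opart b" for f' g' a b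
      using that DK_vpart[of f' a] DK_vpart[of g' b] DK_fin[of f' a] DK_fin[of g' b]
      by (auto intro: vbracket_K Kt_DK vpart_vbracket)
    have "vpart m (1 + 1) = (vpart m 0 :: 'a vfield set)" by (intro vpart_cong) simp
    then have "vbracket m (DK m n f0) (DK m n g0) + vbracket m (DK m n f1) (DK m n g1) \<in> K \<inter> vpart m 0"
      "vbracket m (DK m n f0) (DK m n g1) + vbracket m (DK m n f1) (DK m n g0) \<in> K \<inter> vpart m 1"
      using hom[OF f(1) g(1) f(3) g(3)] hom[OF f(2) g(2) f(4) g(4)] hom[OF f(1) g(2) f(3) g(4)]
        hom[OF f(2) g(1) f(4) g(3)] vfield.subspace_add[OF subspace_K] vfield.subspace_add[OF subspace_vpart]
      by auto
    moreover have "vbracket m X Y = (vbracket m (DK m n f0) (DK m n g0) + vbracket m (DK m n f1) (DK m n g1)) +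
      (vbracket m (DK m n f0) (DK m n g1) + vbracket m (DK m n f1) (DK m n g0))"
      by (simp add: f(5) g(5) vbracket_add_left vbracket_add_right algebra_simps)
    ultimately show ?thesis by blast
  qed
  then show "K \<subseteq> ?S"
    unfolding K_carrier_def[of m n \<tau>] by (intro vfield.span_minimal sub[unfolded K_carrier_def]) (auto simp: K_carrier_def)
qed

lemma hcomp_L: "hcomp L (a mod 2) = K \<inter> vpart m a"
  using vpart_cong[of "a mod 2" a m, where ?'a = 'a] by (simp add: K_contact_def)

lemma L_simps: "carr L = K" "scal L = vscale" "brk L = vbracket m"
  by (simp_all add: K_contact_def)

sublocale K: lie_superalgebra vscale L
proof unfold_locales
  have fin: "x \<in> fin_vfield" if "x \<in> K" for x using that K_subset_Kt Kt_fin by blast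
  show "scal L = vscale" by (simp add: L_simps)
  show "vfield.subspace (hcomp L (a mod 2))" for a
    unfolding hcomp_L by (intro vfield.subspace_inter subspace_K subspace_vpart)
  show "carr L = {x + y |x y. x \<in> hcomp L 0 \<and> y \<in> hcomp L 1}"
    using K_decomp hcomp_L[of 0] hcomp_L[of 1] by (simp add: L_simps)
  show "hcomp L 0 \<inter> hcomp L 1 = {0}"
    using hcomp_L[of 0] hcomp_L[of 1] vpart_disjoint[of _ m 0 1] vfield.subspace_0[OF subspace_K]
      vfield.subspace_0[OF subspace_vpart] by auto
  show "brk L (x + y) z = brk L x z + brk L y z" "brk L x (y + z) = brk L x y + brk L x z"
    "brk L (vscale c x) y = vscale c (brk L x y)" "brk L x (vscale c y) = vscale c (brk L x y)" for x y z c
    by (simp_all add: L_simps vbracket_add_left vbracket_add_right vbracket_vscale_left vbracket_vscale_right)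
  fix x y z :: "'a vfield" and a b d :: nat
  assume xy: "x \<in> hcomp L (a mod 2)" "y \<in> hcomp L (b mod 2)"
  note xy' = xy[unfolded hcomp_L]
  show "brk L x y \<in> hcomp L ((a + b) mod 2)"
    unfolding hcomp_L L_simps using xy' fin K_subset_Kt by (auto intro: vbracket_K vpart_vbracket)
  show "brk L x y = - vscale ((- 1) ^ (a * b)) (brk L y x)"
    unfolding L_simps using xy' by (intro vbracket_skew) auto
  assume "z \<in> hcomp L (d mod 2)"
  then show "brk L x (brk L y z) = brk L (brk L x y) z + vscale ((- 1) ^ (a * b)) (brk L y (brk L x z))"
    unfolding L_simps hcomp_L using xy' fin by (intro vbracket_jacobi) auto
qed

subsection \<open>Some brackets\<close>

lemma opart_basic:
  "one \<in> opart 0" "xvar m m \<in> opart 0" "i \<in> J \<Longrightarrow> xvar m i \<in> opart (dpar m i)"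
  using opart_oone opart_xvar[of m m] opart_xvar[of m i] by simp_all

lemma opart_omult_xm:
  "xvar m m \<odot> xvar m m \<in> opart 0" "i \<in> J \<Longrightarrow> xvar m i \<odot> xvar m m \<in> opart (dpar m i)"
  using opart_omult[OF opart_xvar[of m m] opart_xvar[of m m]]
    opart_omult[OF opart_xvar[of m i] opart_xvar[of m m]] by simp_all

lemma osder_m_xvar: "i \<in> J \<Longrightarrow> osder m m (xvar m i) = 0" "osder m m (xvar m m) = xmon 0 {}"
  using J_neq_m[of i] by (auto simp: osder_xvar)

lemma cbracket_one:
  fixes g :: "'a osup"
  assumes "g \<in> fin_osup"
  shows "cbracket one g = oscale 2 (osder m m g)"
proof -
  have c: "coef (DK m n one) i = (if i = m then oscale 2 one else 0)" for i
    by (simp add: coef_DK[OF opart_oone])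
  have "act m (DK m n one) g = oscale 2 (osder m m g)"
    by (subst act_superset[of "{m}"]) (auto simp: c in_keys_iff olinear_simps split: if_splits)
  then show ?thesis by (simp add: cbracket_def)
qed

text \<open>D_K(x_m) is the Euler field with degree 1 for x_j and degree 2 for x_m. Together with
  the -2 in \<open>cbracket_xm\<close> this gives weight d - 2 in degree d.\<close>

lemma coef_DK_xm: "coef (DK m n (xvar m m) :: 'a vfield) i = (if i \<in> J then xvar m i else if i = m then oscale 2 (xvar m m) else 0)"
proof -
  have 1: "osder m (cj i) (xvar m m) = 0" if "i \<in> J" for i
    using J_neq_m[OF conj_in_J[OF that]] by (simp add: osder_xvar)
  have 2: "(\<Sum>j\<in>J. xvar m j \<odot> osder m j (xvar m m)) = 0"
    by (rule sum.neutral) (simp add: osder_xvar J_neq_m)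
  show ?thesis
    by (simp add: coef_DK[OF opart_basic(2)] osder_m_xvar(2) 1 2)
qed

lemma cbracket_xm: "cbracket (xvar m m) (g :: 'a osup) = act m (DK m n (xvar m m)) g - oscale 2 g"
  by (simp add: cbracket_def osder_xvar)

lemma cbracket_xj: "j \<in> J \<Longrightarrow> cbracket (xvar m j) (g :: 'a osup) = act m (DK m n (xvar m j)) g"
  by (simp add: cbracket_def osder_m_xvar)

lemma coef_DK_xj:
  assumes "j \<in> J"
  shows "i \<in> J \<Longrightarrow> coef (DK m n (xvar m j)) i =
      (if cj i = j then oscale ((- 1) ^ (dpar m i * dpar m j) * sig m j) one else 0)"
    and "coef (DK m n (xvar m j)) m = (xvar m j :: 'a osup)"
proof -
  show "i \<in> J \<Longrightarrow> coef (DK m n (xvar m j)) i =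
      (if cj i = j then oscale ((- 1) ^ (dpar m i * dpar m j) * sig m j) one else 0)"
    by (simp add: coef_DK[OF opart_basic(3)[OF assms]] osder_m_xvar(1)[OF assms] osder_xvar[of m "cj i" j])
  have "(\<Sum>i\<in>J. xvar m i \<odot> osder m i (xvar m j)) = (\<Sum>i\<in>J. if i = j then xvar m j else 0 :: 'a osup)"
    by (intro sum.cong) (auto simp: osder_xvar)
  then show "coef (DK m n (xvar m j)) m = (xvar m j :: 'a osup)"
    using assms osup.scale_left_distrib[of 1 1 "xvar m j :: 'a osup"] by (simp add: coef_DK[OF opart_basic(3)])
qed

text \<open>D_K(x_j) is a multiple of the derivative by the conjugate variable plus x_j
  \<partial>_m, and the latter kills g by assumption.\<close>

lemma act_DK_xj:
  fixes g :: "'a osup"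
  assumes "j \<in> J" "osder m m g = 0"
  shows "act m (DK m n (xvar m j)) g =
    oscale ((- 1) ^ (dpar m (cj j) * dpar m j) * sig m j) (osder m (cj j) g)"
proof -
  have "act m (DK m n (xvar m j)) g = (\<Sum>i\<in>insert m J. coef (DK m n (xvar m j)) i \<odot> osder m i g)"
    using supp_DK[OF opart_basic(3)[OF assms(1)], unfolded indices_eq] by (intro act_superset) simp_all
  also have "\<dots> = (\<Sum>i\<in>J. coef (DK m n (xvar m j)) i \<odot> osder m i g)"
    using assms(2) by simp
  also have "\<dots> = (\<Sum>i\<in>J. if i = cj j then oscale ((- 1) ^ (dpar m i * dpar m j) * sig m j) (osder m i g) else 0)"
    using assms(1) by (intro sum.cong) (auto simp: coef_DK_xj olinear_simps)
  finally show ?thesis using assms(1) by simp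
qed

text \<open>The square of x_m is written as a product, so that the Leibniz rule applies. Its
  derivative 2 x_m accounts for the factor 4, which is halved when w is formed.\<close>

lemma cbracket_values:
  shows "cbracket (xvar m m) one = oscale (- 2) one"
    and "j \<in> J \<Longrightarrow> cbracket one (xvar m j) = 0"
    and "k \<in> J \<Longrightarrow> j \<in> J \<Longrightarrow> \<exists>c. cbracket (xvar m k) (xvar m j) = oscale c one"
    and "k \<in> J \<Longrightarrow> cbracket (xvar m k) (xvar m m) = (xvar m k :: 'a osup)"
    and "j \<in> J \<Longrightarrow> cbracket (xvar m m) (xvar m j) = (- xvar m j :: 'a osup)"
    and "j \<in> J \<Longrightarrow> cbracket one (xvar m j \<odot> xvar m m) = oscale 2 (xvar m j)"
    and "cbracket one (xvar m m \<odot> xvar m m) = oscale 4 (xvar m m)"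
    and "j \<in> J \<Longrightarrow> cbracket (xvar m m) (xvar m j \<odot> xvar m m) = (xvar m j \<odot> xvar m m :: 'a osup)"
    and "cbracket (xvar m m) (xvar m m \<odot> xvar m m) = (oscale 2 (xvar m m \<odot> xvar m m) :: 'a osup)"
proof -
  have dbl: "oscale 2 g = g + g" "oscale 4 g = g + g + g + g" for g :: "'a osup"
    using osup.scale_left_distrib[of 1 1 g] osup.scale_left_distrib[of 2 2 g] by (simp_all add: add.assoc)
  note E = DK_vpart[OF opart_basic(2) fin_osup_xvar] DK_fin[OF opart_basic(2) fin_osup_xvar]
  have E_mult: "act m (DK m n (xvar m m)) (f \<odot> g) =
      act m (DK m n (xvar m m)) f \<odot> g + f \<odot> act m (DK m n (xvar m m)) g"
    if "f \<in> opart b" "f \<in> fin_osup" "g \<in> fin_osup" for f g :: "'a osup" and b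
    using act_omult[OF E(1) that(1) E(2) that(2,3)] by simp
  have d_mult: "osder m m (f \<odot> g) = osder m m f \<odot> g + f \<odot> osder m m g"
    if "f \<in> opart b" "f \<in> fin_osup" "g \<in> fin_osup" for f g :: "'a osup" and b
    using osder_omult[OF that, of m m] by simp
  show "cbracket (xvar m m) one = oscale (- 2) one"
    by (simp add: cbracket_xm)
  show "j \<in> J \<Longrightarrow> cbracket one (xvar m j) = 0"
    by (simp add: cbracket_one osder_m_xvar)
  show "k \<in> J \<Longrightarrow> j \<in> J \<Longrightarrow> \<exists>c. cbracket (xvar m k) (xvar m j) = oscale c one"
    by (auto simp: cbracket_xj act_xvar coef_DK_xj intro: exI[of _ 0])
  show "k \<in> J \<Longrightarrow> cbracket (xvar m k) (xvar m m) = (xvar m k :: 'a osup)"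
    by (simp add: cbracket_xj act_xvar coef_DK_xj)
  show "j \<in> J \<Longrightarrow> cbracket (xvar m m) (xvar m j) = (- xvar m j :: 'a osup)"
    by (simp add: cbracket_xm act_xvar coef_DK_xm dbl)
  show "j \<in> J \<Longrightarrow> cbracket one (xvar m j \<odot> xvar m m) = oscale 2 (xvar m j)"
    by (simp add: cbracket_one d_mult[OF opart_xvar] osder_m_xvar)
  show "cbracket one (xvar m m \<odot> xvar m m) = oscale 4 (xvar m m)"
    by (simp add: cbracket_one d_mult[OF opart_xvar] osder_m_xvar dbl)
  show "j \<in> J \<Longrightarrow> cbracket (xvar m m) (xvar m j \<odot> xvar m m) = (xvar m j \<odot> xvar m m :: 'a osup)"
    by (simp add: cbracket_xm E_mult[OF opart_xvar] act_xvar coef_DK_xm olinear_simps dbl)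
  show "cbracket (xvar m m) (xvar m m \<odot> xvar m m) = (oscale 2 (xvar m m \<odot> xvar m m) :: 'a osup)"
    by (simp add: cbracket_xm E_mult[OF opart_xvar] act_xvar coef_DK_xm olinear_simps dbl)
qed

section \<open>Centralizers and the determination of the super-biderivations\<close>

text \<open>D_K preserves parity, so the summand of the wrong parity, being the difference of z and
  the other summand, has both parities and is zero.\<close>

lemma homogeneous_K_DK:
  assumes "z \<in> K" "z \<in> vpart m a"
  obtains g where "g \<in> T" "g \<in> opart a" "z = DK m n g"
proof -
  obtain f0 f1 where f: "f0 \<in> T" "f1 \<in> T" "f0 \<in> opart 0" "f1 \<in> opart 1" "z = DK m n f0 + DK m n f1"
    using Kt_parts[of z] assms(1) K_subset_Kt by blast
  have p: "DK m n f0 \<in> vpart m 0" "DK m n f1 \<in> vpart m 1"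
    using f DK_vpart[of f0 0] DK_vpart[of f1 1] by auto
  show ?thesis
  proof (cases "even a")
    case True
    have "DK m n f1 = z - DK m n f0" using f(5) by simp
    then have "DK m n f1 \<in> vpart m 0"
      using assms(2) p(1) True vpart_cong[of a 0 m, where ?'a = 'a] vfield.subspace_diff[OF subspace_vpart] by auto
    then have "DK m n f1 = 0" using vpart_disjoint[OF _ p(2), of 0] by simp
    then show ?thesis using that[of f0] f True opart_cong[of a 0, where ?'a = 'a] by simp
  next
    case False
    have "DK m n f0 = z - DK m n f1" using f(5) by simp
    then have "DK m n f0 \<in> vpart m 1"
      using assms(2) p(2) False vpart_cong[of a 1 m, where ?'a = 'a] vfield.subspace_diff[OF subspace_vpart] by auto
    then have "DK m n f0 = 0" using vpart_disjoint[OF p(1), of 1] by simp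
    then show ?thesis using that[of f1] f False opart_cong[of a 1, where ?'a = 'a] by simp
  qed
qed

lemma DK_eq_0:
  assumes "f \<in> opart a" "f \<in> T" "DK m n f = 0"
  shows "f = (0 :: 'a osup)"
proof -
  have "oscale 2 f = theta (0 :: 'a vfield)"
    using theta_DK[OF assms(1) trunc_O_fin[OF assms(2)] small_nonzero(1)] assms(3) by simp
  then show ?thesis using small_nonzero(1) by (simp add: theta_def)
qed

text \<open>In generating functions the bracket with 1 is 2 \<partial>_m; once \<partial>_m g = 0,
  the bracket with x_j is, up to sign, the derivative by the conjugate variable. So all derivatives
  of g vanish and g is constant.\<close>

lemma centralizer:
  assumes z: "z \<in> K" "z \<in> vpart m a"
    and e: "vbracket m (DK m n one) z = 0"
    and x: "\<And>j. j \<in> J \<Longrightarrow> vbracket m (DK m n (xvar m j)) z = 0"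
  shows "\<exists>c. z = vscale c (DK m n one)"
proof -
  obtain g where g: "g \<in> T" "g \<in> opart a" "z = DK m n g" using homogeneous_K_DK[OF z] .
  have zero: "cbracket f g = 0" if "f \<in> T" "f \<in> opart b" "vbracket m (DK m n f) z = 0" for f b
    using that g vbracket_DK[OF that(2) trunc_O_fin[OF that(1)] g(2) trunc_O_fin[OF g(1)] small_nonzero(1)]
      DK_eq_0[OF cbracket_opart[OF that(2) trunc_O_fin[OF that(1)] g(2) trunc_O_fin[OF g(1)]]]
      cbracket_T[OF that(2,1) g(1)] by simp
  have m: "osder m m g = 0"
    using zero[OF _ opart_oone e] g(1) small_nonzero(1) by (simp add: cbracket_one)
  have "osder m (cj j) g = 0" if "j \<in> J" for j
    using zero[OF _ opart_xvar x[OF that]] that m act_DK_xj[OF that m]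
    by (auto simp: cbracket_xj sig_def Let_def split: if_splits)
  then have "osder m j g = 0" if "j \<in> J" for j
    using that conj_in_J[OF that] by (metis conj_conj)
  with m have "osder m i g = 0" if "i \<in> {1..m+n}" for i
    using that unfolding indices_eq by auto
  then have "g = oscale (coef g (0, {})) one" by (rule all_osder_zero_imp_const[OF g(1)])
  then show ?thesis using g(3) DK_oscale by metis
qed

lemma BDer_deg_scalar:
  assumes "\<phi> \<in> BDer_deg \<gamma> L"
  shows "\<exists>c. (even \<gamma> \<or> c = 0) \<and> (\<forall>y\<in>K. \<forall>z\<in>K. \<phi> (y, z) = vscale c (vbracket m y z))"
proof -
  interpret \<phi>: bider vscale L \<gamma> \<phi>
    by unfold_locales (fact assms small_nonzero)+
  let ?e = "DK m n one" and ?h = "DK m n (xvar m m) :: 'a vfield" and ?x = "\<lambda>j. DK m n (xvar m j) :: 'a vfield"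
    and ?v = "\<lambda>j. DK m n (xvar m j \<odot> xvar m m) :: 'a vfield"
    and ?w = "vscale (1 / 2) (DK m n (xvar m m \<odot> xvar m m)) :: 'a vfield"
  have br: "vbracket m (DK m n f) (DK m n g) = DK m n (cbracket f g)"
    if "f \<in> opart a" "g \<in> opart b" "f \<in> T" "g \<in> T" for f g a b
    using that small_nonzero(1) by (intro vbracket_DK) auto
  have DK_neg: "DK m n (- f) = - DK m n f" for f :: "'a osup"
    using DK_oscale[of "- 1" f] by simp
  have he: "vbracket m ?h ?e = - vscale 2 ?e"
    by (simp add: br[OF opart_basic(2,1)] cbracket_values DK_oscale DK_neg)
  have ex: "vbracket m ?e (?x j) = 0" if "j \<in> J" for j
    using that DK_oscale[of 0 0] by (simp add: br[OF opart_basic(1,3)] cbracket_values)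
  have hx: "vbracket m ?h (?x j) = - ?x j" if "j \<in> J" for j
    using that by (simp add: br[OF opart_basic(2,3)] cbracket_values DK_neg)
  have xx: "\<exists>c. vbracket m (?x k) (?x j) = vscale c ?e" if "k \<in> J" "j \<in> J" for k j
    using cbracket_values(3)[OF that] that by (auto simp: br[OF opart_basic(3,3)] DK_oscale)
  have xh: "vbracket m (?x k) ?h = ?x k" if "k \<in> J" for k
    using that by (simp add: br[OF opart_basic(3,2)] cbracket_values)
  have ev: "vbracket m ?e (?v j) = vscale 2 (?x j)" if "j \<in> J" for j
    using that by (simp add: br[OF opart_basic(1) opart_omult_xm(2)] cbracket_values DK_oscale)
  have ew: "vbracket m ?e ?w = vscale 2 ?h"
    by (simp add: vbracket_vscale_right br[OF opart_basic(1) opart_omult_xm(1)] cbracket_values DK_oscale)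
  have hv: "vbracket m ?h (?v j) = ?v j" if "j \<in> J" for j
    using that by (simp add: br[OF opart_basic(2) opart_omult_xm(2)] cbracket_values)
  have hw: "vbracket m ?h ?w = vscale 2 ?w"
    by (simp add: vbracket_vscale_right br[OF opart_basic(2) opart_omult_xm(1)] cbracket_values DK_oscale)
  \<comment> \<open>Membership in the derived algebra: an eigenvector of h with nonzero weight is a
    multiple of its own bracket with h. The weight of h itself is 0, so h is obtained from [e, w] =
    2 h.\<close>
  have in_K: "y \<in> K" if "vbracket m X Y = vscale c y" "X \<in> Kt" "Y \<in> Kt" "c \<noteq> 0" for c X Y y
  proof -
    have "vscale (1 / c) (vbracket m X Y) \<in> K"
      by (intro vfield.subspace_scale[OF subspace_K] vbracket_K that)
    then show ?thesis using that(1,4) by simp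
  qed
  have Kt: "?e \<in> Kt" "?h \<in> Kt" "?w \<in> Kt" "\<And>j. j \<in> J \<Longrightarrow> ?x j \<in> Kt" "\<And>j. j \<in> J \<Longrightarrow> ?v j \<in> Kt"
    by (auto intro!: Kt_DK vfield.subspace_scale[OF subspace_Kt])
  have "?e \<in> K" using in_K[of ?h ?e "- 2" ?e] he Kt small_nonzero by simp
  moreover have "?h \<in> K" using in_K[of ?e ?w 2 ?h] ew Kt small_nonzero by simp
  moreover have "?w \<in> K" using in_K[of ?h ?w 2 ?w] hw Kt small_nonzero by simp
  moreover have "?x j \<in> K" if "j \<in> J" for j using in_K[of ?h "?x j" "- 1" "?x j"] hx Kt that by simp
  moreover have "?v j \<in> K" if "j \<in> J" for j using in_K[of ?h "?v j" 1 "?v j"] hv Kt that by simp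
  moreover have "?e \<in> vpart m 0" "?h \<in> vpart m 0" "?w \<in> vpart m 0"
    "\<And>j. j \<in> J \<Longrightarrow> ?x j \<in> vpart m (dpar m j)" "\<And>j. j \<in> J \<Longrightarrow> ?v j \<in> vpart m (dpar m j)"
    by (auto intro!: DK_vpart vfield.subspace_scale[OF subspace_vpart] opart_basic opart_omult_xm)
  ultimately have H: "?e \<in> K \<inter> vpart m 0" "?h \<in> K \<inter> vpart m 0" "?w \<in> K \<inter> vpart m 0"
    "\<And>j. j \<in> J \<Longrightarrow> ?x j \<in> K \<inter> vpart m (dpar m j)"
    "\<And>j. j \<in> J \<Longrightarrow> ?v j \<in> K \<inter> vpart m (dpar m j)"
    by simp_all
  have "coef one (0, {}) \<noteq> 0" by (simp add: xmon_def)
  then have e0: "?e \<noteq> 0" using DK_eq_0[OF opart_oone trunc_O_oone] by auto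
  show ?thesis
  proof (rule \<phi>.bider_scalar[of ?e ?h ?w J ?x "dpar m" ?v, unfolded L_simps(1,3) hcomp_L])
    show "\<exists>c. z = vscale c ?e" if "z \<in> K \<inter> vpart m a" "vbracket m ?e z = 0"
      "\<And>j. j \<in> J \<Longrightarrow> vbracket m (?x j) z = 0" for z a
      using centralizer[of z a] that by blast
  qed (rule H e0 he ex xx xh ev ew hv hw small_nonzero(2); assumption)+
qed

lemma BDer_eq_IBDer: "BDer L = IBDer L"
proof
  show "IBDer L \<subseteq> BDer L" by (rule K.IBDer_subset_BDer)
  show "BDer L \<subseteq> IBDer L"
  proof
    fix \<phi> assume "\<phi> \<in> BDer L"
    then obtain \<phi>0 \<phi>1 where \<phi>: "\<phi> = restrict (\<lambda>z. \<phi>0 z + \<phi>1 z) (K \<times> K)"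
      "\<phi>0 \<in> BDer_deg 0 L" "\<phi>1 \<in> BDer_deg 1 L"
      by (auto simp: BDer_def L_simps)
    obtain c where "\<forall>y\<in>K. \<forall>z\<in>K. \<phi>0 (y, z) = vscale c (vbracket m y z)"
      using BDer_deg_scalar[OF \<phi>(2)] by blast
    \<comment> \<open>The degree is odd here, which forces the scalar to be 0.\<close>
    moreover have "\<forall>y\<in>K. \<forall>z\<in>K. \<phi>1 (y, z) = 0"
      using BDer_deg_scalar[OF \<phi>(3)] by auto
    ultimately have "\<phi> = inner_bider L c"
      by (auto simp: \<phi>(1) inner_bider_def L_simps)
    then show "\<phi> \<in> IBDer L" by (simp add: IBDer_def)
  qed
qed

end

theorem theorem3p14:
  fixes p m n r t :: nat and \<tau> :: "nat \<Rightarrow> nat"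
  assumes "CHAR('a::field) = p" and "card (UNIV :: 'a set) = p" and "p > 3"
    and "m = 2 * r + 1" and "m > 1"
    and "n = 2 * t" and "n > 1"
    and "\<forall>i\<in>{1..m}. \<tau> i > 0"
  shows "BDer (K_contact m n \<tau> :: ('a, 'a vfield) superalg) = IBDer (K_contact m n \<tau>)"
proof -
  interpret contact_algebra m n r t \<tau> "TYPE('a)"
    using assms by unfold_locales auto
  show ?thesis by (rule BDer_eq_IBDer)
qed

end
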